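(* For any $\epsilon>0$, there is a two-sided adaptive algorithm for $\epsilon$-testing $s$-Term DNF with respect to the uniform distribution that makes $\tilde O(s/\epsilon)$ queries.
   Context: Boolean functions $f:\{0,1\}^n\to\{0,1\}$ are accessed through a membership-query oracle that returns $f(x)$ for a queried $x$. $f$ is $\epsilon$-far from a class $C$ (with respect to the uniform distribution) if $\Pr_{x}[f(x)\neq g(x)]\ge\epsilon$ for every $g\in C$, where $x$ is uniform on $\{0,1\}^n$. A two-sided adaptive algorithm for $\epsilon$-testing $C$ is a randomized algorithm that, given $\epsilon$ and membership-query access to an arbitrary $f$ (and able to draw uniform random strings), chooses queries possibly adaptively, accepts with probability at least $2/3$ if $f\in C$, and rejects with probability at least $2/3$ if $f$ is $\epsilon$-far from every function in $C$. $\tilde O(T)$ means $O(T\cdot\mathrm{poly}(\log T))$. $s$-Term DNF is the class of disjunctions of at most $s$ terms, each term a conjunction of literals. *)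

theory Defs
  imports "HOL-Probability.Probability_Mass_Function"
begin

text \<open>
  Points of \<open>{0,1}\<^sup>n\<close> are Boolean lists of length \<open>n\<close>. A Boolean function on the cube is
  a function on all Boolean lists of which only the values on \<open>cube n\<close> matter.
\<close>

definition cube :: "nat \<Rightarrow> bool list set" where
  "cube n = {x. length x = n}"

text \<open>
  The literal \<open>(i, True)\<close> is the variable \<open>x\<^sub>i\<close> and \<open>(i, False)\<close> is its negation. A term is
  a set of literals; the empty term is the constant true and the empty DNF the constant false.
\<close>

type_synonym literal = "nat \<times> bool"

definition satisfies :: "bool list \<Rightarrow> literal set \<Rightarrow> bool" where
  "satisfies x t \<longleftrightarrow> (\<forall>(i, b) \<in> t. x ! i = b)"

definition term_dnf :: "nat \<Rightarrow> nat \<Rightarrow> (bool list \<Rightarrow> bool) set" where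
  "term_dnf n s = {g. \<exists>D :: literal set set.
     finite D \<and> card D \<le> s \<and> (\<forall>t \<in> D. t \<subseteq> {..<n} \<times> UNIV) \<and>
     (\<forall>x \<in> cube n. g x \<longleftrightarrow> (\<exists>t \<in> D. satisfies x t))}"

definition far :: "nat \<Rightarrow> real \<Rightarrow> (bool list \<Rightarrow> bool) set \<Rightarrow> (bool list \<Rightarrow> bool) \<Rightarrow> bool" where
  "far n \<epsilon> C f \<longleftrightarrow> (\<forall>g \<in> C. measure_pmf.prob (pmf_of_set (cube n)) {x. f x \<noteq> g x} \<ge> \<epsilon>)"

text \<open>
  Randomized adaptive query algorithms as interaction trees. \<open>Query x k\<close> asks the oracle for the
  value at \<open>x\<close> and continues with \<open>k\<close> applied to the answer; \<open>Draw m k\<close> draws a uniform string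
  of \<open>m\<close> random bits, without consulting the oracle, and continues with \<open>k\<close> applied to it.
  Continuations may depend on everything seen so far, so queries are adaptive.
\<close>

datatype query_alg =
    Verdict bool
  | Query "bool list" "bool \<Rightarrow> query_alg"
  | Draw nat "bool list \<Rightarrow> query_alg"

primrec run :: "(bool list \<Rightarrow> bool) \<Rightarrow> query_alg \<Rightarrow> bool pmf" where
  "run f (Verdict b) = return_pmf b"
| "run f (Query x k) = run f (k (f x))"
| "run f (Draw m k) = bind_pmf (pmf_of_set (cube m)) (\<lambda>r. run f (k r))"

text \<open>The largest number of oracle queries made with oracle \<open>f\<close>, over all random choices.\<close>

primrec num_queries :: "(bool list \<Rightarrow> bool) \<Rightarrow> query_alg \<Rightarrow> nat" where
  "num_queries f (Verdict b) = 0"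
| "num_queries f (Query x k) = Suc (num_queries f (k (f x)))"
| "num_queries f (Draw m k) = Max ((\<lambda>r. num_queries f (k r)) ` cube m)"

text \<open>All queries are points of \<open>{0,1}\<^sup>n\<close>, where the oracle is meaningful.\<close>

primrec queries_in_cube :: "nat \<Rightarrow> query_alg \<Rightarrow> bool" where
  "queries_in_cube n (Verdict b) \<longleftrightarrow> True"
| "queries_in_cube n (Query x k) \<longleftrightarrow> x \<in> cube n \<and> (\<forall>b. queries_in_cube n (k b))"
| "queries_in_cube n (Draw m k) \<longleftrightarrow> (\<forall>r \<in> cube m. queries_in_cube n (k r))"

definition two_sided_tester ::
    "nat \<Rightarrow> (bool list \<Rightarrow> bool) set \<Rightarrow> real \<Rightarrow> query_alg \<Rightarrow> bool" where
  "two_sided_tester n C \<epsilon> A \<longleftrightarrow>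
     queries_in_cube n A \<and>
     (\<forall>f. (f \<in> C \<longrightarrow> pmf (run f A) True \<ge> 2 / 3) \<and>
          (far n \<epsilon> C f \<longrightarrow> pmf (run f A) False \<ge> 2 / 3))"

end

theory Submission
  imports Defs
begin

text \<open>
  The tester learns a hypothesis and then checks it. Dropping the terms of more than \<open>L = O(log(s/\<epsilon>))\<close>
  literals makes a DNF a junta in \<open>K = s L\<close> variables, and since almost every query is marginally
  uniform (or is made around a base point that is good on average), the run does not notice the
  difference. The coordinates are randomly partitioned into so many blocks that the relevant
  variables are separated. Comparing \<open>f x\<close> with \<open>f\<close> at a point that agrees with \<open>x\<close> on the blocks
  found so far and is uniform elsewhere, and then binary searching, uncovers the relevant blocks.

  On a relevant block the restriction \<open>\<phi>\<close> of \<open>f\<close> is a literal, so that \<open>\<phi> z \<oplus> \<phi> (z \<oplus> x)\<close> decodes the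
  relevant coordinate of \<open>x\<close>. For arbitrary \<open>f\<close>, an elementary version of the linearity test and
  a test of multiplicativity ensure that the decoded function is a coordinate or zero.

  Decoding all relevant coordinates of every example would cost \<open>K\<close> queries per example. The
  examples are therefore taken to be a single uniform string shifted by random bits that are constant
  on blocks: the relevant coordinates are then known relative to the string, and each example costs one
  query. By a union bound over the short DNFs, \<open>O(s/\<epsilon>)\<close> examples up to logarithmic factors determine
  a good hypothesis. Finally \<open>O(1/\<epsilon>)\<close> uniform points are decoded in full to compare \<open>f\<close> with the
  hypothesis. Soundness does not depend on how the hypothesis was found, because composed with
  the decoded coordinates it is always an \<open>s\<close>-term DNF.
\<close>

section \<open>Averages over the cube\<close>

text \<open>Completeness has to survive adaptive queries to an oracle that equals a short DNF only
  up to a fraction \<open>s / 2 ^ L\<close> of the points. Failures are therefore summed over every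
  point that might be queried, including hybrids the binary search never visits; taking
  \<open>L\<close> a large multiple of the logarithm makes the fraction small enough for this.
  Marginal uniformity breaks down only at a stored base point, which is reused for many probes;
  Markov's inequality bounds the chance that too many of its probes are bad.

  The search need not find all relevant blocks. The examples determine \<open>f\<close> with
  everything outside the found blocks frozen to the common shift \<open>w\<close>. This restriction
  is close to \<open>f\<close> on average over \<open>w\<close>, because with high probability the
  search stops only when rerandomizing the rest hardly changes \<open>f\<close>.

  Votes must be unanimous. For arbitrary \<open>f\<close> a vote may be wrong half of the time, so
  that a majority gains nothing, but \<open>t\<close> votes are all wrong with probability at most
  \<open>2 ^ -t\<close>. For a DNF almost every vote is right, and unanimity costs nothing.\<close>

lemma cube_eq_lists: "cube m = {xs. set xs \<subseteq> UNIV \<and> length xs = m}"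
  by (auto simp: cube_def)

lemma finite_cube [simp, intro]: "finite (cube m)"
  unfolding cube_eq_lists by (rule finite_lists_length_eq) simp

lemma card_cube [simp]: "card (cube m) = 2 ^ m"
  unfolding cube_eq_lists by (subst card_lists_length_eq) (auto simp: card_UNIV_bool)

lemma cube_nonempty [simp]: "cube m \<noteq> {}"
  using card_cube[of m] by (metis card.empty power_not_zero zero_neq_numeral)

definition avg :: "nat \<Rightarrow> (bool list \<Rightarrow> real) \<Rightarrow> real" where
  "avg m F = (\<Sum>x\<in>cube m. F x) / 2 ^ m"

lemma avg_const [simp]: "avg m (\<lambda>_. c) = c"
  by (simp add: avg_def)

lemma avg_cong: "(\<And>x. x \<in> cube m \<Longrightarrow> F x = G x) \<Longrightarrow> avg m F = avg m G"
  by (simp add: avg_def)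

lemma avg_mono: "(\<And>x. x \<in> cube m \<Longrightarrow> F x \<le> G x) \<Longrightarrow> avg m F \<le> avg m G"
  by (auto simp: avg_def intro!: divide_right_mono sum_mono)

lemma avg_nonneg: "(\<And>x. x \<in> cube m \<Longrightarrow> 0 \<le> F x) \<Longrightarrow> 0 \<le> avg m F"
  using avg_mono[of m "\<lambda>_. 0" F] by simp

lemma avg_le: "(\<And>x. x \<in> cube m \<Longrightarrow> F x \<le> c) \<Longrightarrow> avg m F \<le> c"
  using avg_mono[of m F "\<lambda>_. c"] by simp

lemma avg_add: "avg m (\<lambda>x. F x + G x) = avg m F + avg m G"
  by (simp add: avg_def sum.distrib add_divide_distrib)

lemma avg_diff: "avg m (\<lambda>x. F x - G x) = avg m F - avg m G"
  by (simp add: avg_def sum_subtractf diff_divide_distrib)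

lemma avg_cmult: "avg m (\<lambda>x. c * F x) = c * avg m F"
  by (simp add: avg_def sum_distrib_left)

lemma avg_sum: "avg m (\<lambda>x. \<Sum>i\<in>I. F i x) = (\<Sum>i\<in>I. avg m (F i))"
  by (simp add: avg_def sum.swap[of _ I] sum_divide_distrib)

lemma avg_swap: "avg m (\<lambda>x. avg k (\<lambda>y. F x y)) = avg k (\<lambda>y. avg m (\<lambda>x. F x y))"
  by (simp add: avg_def sum.swap[of _ "cube k"] flip: sum_divide_distrib)

lemma avg_involution:
  assumes "\<And>x. x \<in> cube m \<Longrightarrow> h x \<in> cube m" "\<And>x. x \<in> cube m \<Longrightarrow> h (h x) = x"
  shows "avg m (\<lambda>x. F (h x)) = avg m F"
proof -
  have "bij_betw h (cube m) (cube m)"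
    by (rule bij_betw_byWitness[where f' = h]) (use assms in auto)
  then show ?thesis
    unfolding avg_def by (subst sum.reindex_bij_betw[of h]) auto
qed

lemma prob_cube: "measure_pmf.prob (pmf_of_set (cube n)) {x. P x} = avg n (\<lambda>x. of_bool (P x))"
proof -
  have "cube n \<inter> {x. P x} = {x \<in> cube n. P x}" by auto
  then show ?thesis
    by (simp add: measure_pmf_of_set avg_def of_bool_def sum.If_cases Int_def)
qed

section \<open>Operations on strings\<close>

definition vxor :: "bool list \<Rightarrow> bool list \<Rightarrow> bool list" where
  "vxor x y = map2 (\<noteq>) x y"

definition meet :: "bool list \<Rightarrow> bool list \<Rightarrow> bool list" where
  "meet x y = map2 (\<and>) x y"

definition mix :: "(nat \<Rightarrow> bool) \<Rightarrow> bool list \<Rightarrow> bool list \<Rightarrow> bool list" where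
  "mix P x u = map (\<lambda>c. if P c then x ! c else u ! c) [0..<length x]"

lemma vxor_cube [simp]: "x \<in> cube n \<Longrightarrow> y \<in> cube n \<Longrightarrow> vxor x y \<in> cube n"
  by (simp add: cube_def vxor_def)

lemma meet_cube [simp]: "x \<in> cube n \<Longrightarrow> y \<in> cube n \<Longrightarrow> meet x y \<in> cube n"
  by (simp add: cube_def meet_def)

lemma mix_cube [simp]: "x \<in> cube n \<Longrightarrow> mix P x u \<in> cube n"
  by (simp add: cube_def mix_def)

lemma length_ops [simp]:
  "length (vxor x y) = min (length x) (length y)" "length (meet x y) = min (length x) (length y)"
  "length (mix P x u) = length x"
  by (simp_all add: vxor_def meet_def mix_def)

lemma nth_vxor [simp]: "c < length x \<Longrightarrow> c < length y \<Longrightarrow> vxor x y ! c = (x ! c \<noteq> y ! c)"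
  by (simp add: vxor_def)

lemma nth_meet [simp]: "c < length x \<Longrightarrow> c < length y \<Longrightarrow> meet x y ! c = (x ! c \<and> y ! c)"
  by (simp add: meet_def)

lemma nth_mix [simp]: "c < length x \<Longrightarrow> mix P x u ! c = (if P c then x ! c else u ! c)"
  by (simp add: mix_def)

lemma cube_eqI: "x \<in> cube n \<Longrightarrow> y \<in> cube n \<Longrightarrow> (\<And>c. c < n \<Longrightarrow> x ! c = y ! c) \<Longrightarrow> x = y"
  by (auto simp: cube_def intro: nth_equalityI)

lemma vxor_cancel:
  assumes "x \<in> cube n" "y \<in> cube n" shows "vxor (vxor x y) y = x"
  by (rule cube_eqI[of _ n]) (use assms in \<open>auto simp: cube_def\<close>)

lemma vxor_assoc:
  assumes "x \<in> cube n" "y \<in> cube n" "z \<in> cube n" shows "vxor (vxor x y) z = vxor x (vxor y z)"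
  by (rule cube_eqI[of _ n]) (use assms in \<open>auto simp: cube_def\<close>)

lemma avg_vxor: "y \<in> cube n \<Longrightarrow> avg n (\<lambda>x. F (vxor x y)) = avg n F"
  by (rule avg_involution) (auto simp: vxor_cancel)

text \<open>Exchanging \<open>x\<close> and \<open>u\<close> outside \<open>P\<close> is an
  involution on pairs of strings, so a mixture of two independent uniform strings is again uniform.
  Hybrids, and probes around random base points, are uniform for this reason.\<close>

lemma avg_mix: "avg n (\<lambda>x. avg n (\<lambda>u. F (mix P x u))) = avg n F"
proof -
  let ?h = "\<lambda>(x, u). (mix P x u, mix P u x)"
  have bij: "bij_betw ?h (cube n \<times> cube n) (cube n \<times> cube n)"
  proof (rule bij_betw_byWitness[where f' = ?h])
    have "mix P (mix P x u) (mix P u x) = x" if "x \<in> cube n" "u \<in> cube n" for x u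
      by (rule cube_eqI[of _ n]) (use that in \<open>auto simp: cube_def\<close>)
    then show "\<forall>a\<in>cube n \<times> cube n. ?h (?h a) = a" "\<forall>a\<in>cube n \<times> cube n. ?h (?h a) = a"
      by auto
  qed auto
  have "(\<Sum>x\<in>cube n. \<Sum>u\<in>cube n. F (mix P x u)) = (\<Sum>p\<in>cube n \<times> cube n. F (fst (?h p)))"
    by (simp add: sum.cartesian_product case_prod_beta)
  also have "\<dots> = (\<Sum>p\<in>cube n \<times> cube n. F (fst p))"
    by (rule sum.reindex_bij_betw[OF bij, of "\<lambda>p. F (fst p)"])
  also have "\<dots> = (\<Sum>x\<in>cube n. \<Sum>u\<in>cube n. F x)"
    unfolding sum.cartesian_product by (simp add: case_prod_beta)
  finally show ?thesis
    by (simp add: avg_def flip: sum_divide_distrib sum_distrib_left)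
qed

section \<open>Programs and their failure probability\<close>

text \<open>Results of arbitrary type permit a monadic bind, from which the subroutines are
  composed; only the finished Boolean program is translated into a \<open>query_alg\<close>.\<close>

datatype 'a prog =
    Ret 'a
  | Ask "bool list" "bool \<Rightarrow> 'a prog"
  | Rnd nat "bool list \<Rightarrow> 'a prog"

primrec bindP :: "'a prog \<Rightarrow> ('a \<Rightarrow> 'b prog) \<Rightarrow> 'b prog" where
  "bindP (Ret a) K = K a"
| "bindP (Ask x k) K = Ask x (\<lambda>b. bindP (k b) K)"
| "bindP (Rnd m k) K = Rnd m (\<lambda>r. bindP (k r) K)"

primrec to_alg :: "bool prog \<Rightarrow> query_alg" where
  "to_alg (Ret b) = Verdict b"
| "to_alg (Ask x k) = Query x (\<lambda>b. to_alg (k b))"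
| "to_alg (Rnd m k) = Draw m (\<lambda>r. to_alg (k r))"

text \<open>
  The oracle is partial: \<open>None\<close> aborts the run, which counts as a failure. For an input DNF
  the points on which its long terms matter are made to abort.
\<close>

primrec err :: "(bool list \<Rightarrow> bool option) \<Rightarrow> 'a prog \<Rightarrow> ('a \<Rightarrow> bool) \<Rightarrow> real" where
  "err g (Ret a) Q = of_bool (\<not> Q a)"
| "err g (Ask x k) Q = (case g x of None \<Rightarrow> 1 | Some b \<Rightarrow> err g (k b) Q)"
| "err g (Rnd m k) Q = avg m (\<lambda>r. err g (k r) Q)"

abbreviation exact :: "(bool list \<Rightarrow> bool) \<Rightarrow> bool list \<Rightarrow> bool option" where
  "exact f \<equiv> \<lambda>x. Some (f x)"

primrec spec :: "nat \<Rightarrow> 'a prog \<Rightarrow> nat \<Rightarrow> ('a \<Rightarrow> bool) \<Rightarrow> bool" where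
  "spec n (Ret a) q P \<longleftrightarrow> P a"
| "spec n (Ask x k) q P \<longleftrightarrow> x \<in> cube n \<and> q > 0 \<and> (\<forall>b. spec n (k b) (q - 1) P)"
| "spec n (Rnd m k) q P \<longleftrightarrow> (\<forall>r\<in>cube m. spec n (k r) q P)"

lemma pmf_run: "pmf (run f (to_alg A)) b = 1 - err (exact f) A (\<lambda>a. a = b)"
proof (induction A)
  case (Rnd m k)
  have "pmf (run f (to_alg (Rnd m k))) b = avg m (\<lambda>r. pmf (run f (to_alg (k r))) b)"
    by (simp add: pmf_bind_pmf_of_set avg_def)
  also have "\<dots> = avg m (\<lambda>r. 1 - err (exact f) (k r) (\<lambda>a. a = b))"
    using Rnd by (intro avg_cong) auto
  finally show ?case by (simp add: avg_diff)
qed auto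

lemma err_nonneg: "0 \<le> err g A Q"
  by (induction A) (auto split: option.splits intro: avg_nonneg)

lemma err_le_1: "err g A Q \<le> 1"
  by (induction A) (auto split: option.splits intro: avg_le)

lemma err_mono: "(\<And>a. P a \<Longrightarrow> Q a) \<Longrightarrow> err g A Q \<le> err g A P"
  by (induction A) (auto split: option.splits intro: avg_mono)

lemma err_conj: "err g A (\<lambda>a. P a \<and> Q a) \<le> err g A P + err g A Q"
  by (induction A) (auto split: option.splits simp flip: avg_add intro: avg_mono)

lemma err_total_True [simp]: "err (exact f) A (\<lambda>_. True) = 0"
  by (induction A) auto

text \<open>Aborts only add failures. This transfers acceptance from the DNF without long terms,
  with aborts where it differs from the input, to the input itself.\<close>

lemma err_oracle_mono:
  assumes "\<And>x. g x = None \<or> g x = Some (f x)"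
  shows "err (exact f) A Q \<le> err g A Q"
proof (induction A)
  case (Ask x k) then show ?case using assms[of x] err_le_1 by (auto split: option.splits)
qed (auto intro: avg_mono)

text \<open>A partial oracle departs from the total one only by aborting, and
  \<open>err g A (\<lambda>_. True)\<close> is the abort probability. The detour through
  \<open>exact f\<close> makes amplification by repetition usable, since a later success cannot undo
  an abort.\<close>

lemma err_split_total:
  assumes "\<And>x. g x = None \<or> g x = Some (f x)"
  shows "err g A Q \<le> err (exact f) A Q + err g A (\<lambda>_. True)"
proof (induction A)
  case (Ask x k) then show ?case using assms[of x] err_nonneg by (auto split: option.splits)
qed (auto simp flip: avg_add intro: avg_mono)

lemma err_bind:
  assumes "\<And>a. P a \<Longrightarrow> err g (K a) Q \<le> d" "0 \<le> d"
  shows "err g (bindP A K) Q \<le> err g A P + d"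
proof (induction A)
  case (Ret a)
  show ?case using assms err_le_1[of g "K a" Q] by (cases "P a") auto
next
  case (Rnd m k)
  have "err g (bindP (Rnd m k) K) Q \<le> avg m (\<lambda>r. err g (k r) P + d)"
    using Rnd by (auto intro: avg_mono)
  then show ?case by (simp add: avg_add)
qed (use assms in \<open>auto split: option.splits\<close>)

lemma err_bind_total:
  assumes "\<And>a. err (exact f) (K a) Q \<le> d" "0 \<le> d"
  shows "err (exact f) (bindP A K) Q \<le> d"
  using err_bind[of "\<lambda>_. True" "exact f" K Q d A] assms by simp

lemma spec_mono:
  "spec n A p P \<Longrightarrow> p \<le> q \<Longrightarrow> (\<And>a. P a \<Longrightarrow> Q a) \<Longrightarrow> spec n A q Q"
proof (induction A arbitrary: p q)
  case (Ask x k)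
  have "spec n (k b) (q - 1) Q" for b
    by (rule Ask.IH[of _ "p - 1"]) (use Ask.prems in auto)
  then show ?case using Ask.prems by auto
qed auto

lemma spec_bind:
  assumes "spec n A p P" "\<And>a. P a \<Longrightarrow> spec n (K a) q Q"
  shows "spec n (bindP A K) (p + q) Q"
  using assms(1)
proof (induction A arbitrary: p)
  case (Ret a) then have "spec n (K a) q Q" using assms(2) by simp
  then show ?case by (simp add: spec_mono[of n "K a" q Q "p + q"])
next
  case (Ask x k)
  then have "spec n (bindP (k b) K) (p - 1 + q) Q" for b by (intro Ask.IH) auto
  moreover have "p - 1 + q = p + q - 1" using Ask.prems by auto
  ultimately show ?case using Ask.prems by auto
qed auto

lemma spec_queries_in_cube: "spec n A q P \<Longrightarrow> queries_in_cube n (to_alg A)"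
  by (induction A arbitrary: q) auto

lemma spec_num_queries: "spec n A q P \<Longrightarrow> num_queries f (to_alg A) \<le> q"
proof (induction A arbitrary: q)
  case (Ask x k)
  then have "num_queries f (to_alg (k (f x))) \<le> q - 1" by (intro Ask.IH) auto
  then show ?case using Ask.prems by auto
qed auto

text \<open>The continuation may also rely on what holds surely of every result, such as the length
  of the entry list, at no cost in failure probability.\<close>

lemma err_bind_spec:
  assumes "spec n A p R" "\<And>a. P a \<Longrightarrow> R a \<Longrightarrow> err g (K a) Q \<le> d" "0 \<le> d"
  shows "err g (bindP A K) Q \<le> err g A P + d"
  using assms(1)
proof (induction A arbitrary: p)
  case (Ret a)
  then show ?case using assms err_le_1[of g "K a" Q] by (cases "P a") auto
next
  case (Ask x k)
  then have "err g (bindP (k b) K) Q \<le> err g (k b) P + d" for b by (intro Ask.IH) auto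
  then show ?case using assms(3) by (auto split: option.splits)
next
  case (Rnd m k)
  then have "err g (bindP (Rnd m k) K) Q \<le> avg m (\<lambda>r. err g (k r) P + d)"
    by (auto intro!: avg_mono Rnd.IH)
  then show ?case by (simp add: avg_add)
qed

section \<open>Repetition: union bounds and amplification\<close>

primrec mapM :: "('b \<Rightarrow> 'a prog) \<Rightarrow> 'b list \<Rightarrow> 'a list prog" where
  "mapM A [] = Ret []"
| "mapM A (x # xs) = bindP (A x) (\<lambda>a. bindP (mapM A xs) (\<lambda>l. Ret (a # l)))"

definition rep :: "nat \<Rightarrow> 'a prog \<Rightarrow> 'a list prog" where
  "rep m A = mapM (\<lambda>_. A) (replicate m ())"

lemma err_mapM:
  "err g (mapM A xs) (list_all2 P xs) \<le> (\<Sum>x\<leftarrow>xs. err g (A x) (P x))"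
proof (induction xs)
  case (Cons x xs)
  have "err g (bindP (mapM A xs) (\<lambda>l. Ret (a # l))) (list_all2 P (x # xs))
      \<le> err g (mapM A xs) (list_all2 P xs) + 0" if "P x a" for a
    by (rule err_bind) (use that in auto)
  then have "err g (mapM A (x # xs)) (list_all2 P (x # xs))
      \<le> err g (A x) (P x) + err g (mapM A xs) (list_all2 P xs)"
    by (auto intro!: err_bind err_nonneg)
  then show ?case using Cons by simp
qed simp

lemma err_mapM_member:
  "x \<in> set xs \<Longrightarrow> err (exact f) (mapM A xs) (\<lambda>l. \<exists>a\<in>set l. Q a) \<le> err (exact f) (A x) Q"
proof (induction xs)
  case (Cons y xs)
  show ?case
  proof (cases "x = y")
    case True
    have "err (exact f) (bindP (mapM A xs) (\<lambda>l. Ret (a # l))) (\<lambda>l. \<exists>a\<in>set l. Q a) \<le> 0" if "Q a" for a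
      by (rule err_bind_total) (use that in auto)
    then show ?thesis using True by (auto intro!: err_bind[of Q _ _ _ 0, simplified])
  next
    case False
    then have IH: "err (exact f) (mapM A xs) (\<lambda>l. \<exists>a\<in>set l. Q a) \<le> err (exact f) (A x) Q"
      using Cons by auto
    have "err (exact f) (bindP (mapM A xs) (\<lambda>l. Ret (a # l))) (\<lambda>l. \<exists>a\<in>set l. Q a)
        \<le> err (exact f) (mapM A xs) (\<lambda>l. \<exists>a\<in>set l. Q a) + 0" for a
      by (rule err_bind) auto
    then have "err (exact f) (bindP (mapM A xs) (\<lambda>l. Ret (a # l))) (\<lambda>l. \<exists>a\<in>set l. Q a)
        \<le> err (exact f) (A x) Q" for a
      using IH by (intro order_trans[OF _ IH]) simp
    then show ?thesis
      unfolding mapM.simps by (rule err_bind_total) (rule err_nonneg)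
  qed
qed simp

lemma spec_mapM:
  assumes "\<And>x. x \<in> set xs \<Longrightarrow> spec n (A x) q (P x)"
  shows "spec n (mapM A xs) (length xs * q) (list_all2 P xs)"
  using assms
proof (induction xs)
  case (Cons x xs)
  have "spec n (mapM A (x # xs)) (q + (length xs * q + 0)) (list_all2 P (x # xs))"
    unfolding mapM.simps
    by (rule spec_bind[where P = "P x"] spec_bind[where P = "list_all2 P xs"] Cons.IH
        | use Cons.prems in force)+
  then show ?case by simp
qed simp

lemma err_rep_all: "err g (rep m A) (\<lambda>l. length l = m \<and> (\<forall>a\<in>set l. P a)) \<le> m * err g A P"
proof -
  have "err g (rep m A) (\<lambda>l. length l = m \<and> (\<forall>a\<in>set l. P a))
      \<le> err g (rep m A) (list_all2 (\<lambda>_. P) (replicate m ()))"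
    by (rule err_mono) (auto simp: list_all2_conv_all_nth in_set_conv_nth)
  also have "\<dots> \<le> m * err g A P"
    using err_mapM[of g "\<lambda>_. A" "replicate m ()" "\<lambda>_. P"] by (simp add: rep_def sum_list_replicate)
  finally show ?thesis .
qed

lemma err_rep_ball: "err g (rep m A) (\<lambda>l. \<forall>a\<in>set l. P a) \<le> m * err g A P"
  by (rule order_trans[OF err_mono err_rep_all]) simp

lemma err_rep_ex: "err (exact f) (rep m A) (\<lambda>l. \<exists>a\<in>set l. Q a) \<le> err (exact f) A Q ^ m"
proof (induction m)
  case (Suc m)
  let ?E = "err (exact f) (rep m A) (\<lambda>l. \<exists>a\<in>set l. Q a)"
  define K where "K = (\<lambda>a. bindP (rep m A) (\<lambda>l. Ret (a # l)))"
  have K1: "err (exact f) (K a) (\<lambda>l. \<exists>a\<in>set l. Q a) \<le> ?E" for a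
    unfolding K_def using err_bind[of "\<lambda>l. \<exists>a\<in>set l. Q a" "exact f" "\<lambda>l. Ret (a # l)" _ 0 "rep m A"]
    by auto
  have K0: "err (exact f) (K a) (\<lambda>l. \<exists>a\<in>set l. Q a) = 0" if "Q a" for a
    unfolding K_def using that
    by (intro antisym err_nonneg) (rule err_bind_total, auto)
  \<comment> \<open>Independence of the first run from the rest is obtained by induction on the
    first program, generalized to any \<open>B\<close>: at a leaf either \<open>Q\<close> holds and
    the continuation cannot fail, or it fails with probability at most \<open>?E\<close>.\<close>
  have "err (exact f) (bindP B K) (\<lambda>l. \<exists>a\<in>set l. Q a) \<le> err (exact f) B Q * ?E" for B
  proof (induction B)
    case (Rnd j k)
    then have "err (exact f) (bindP (Rnd j k) K) (\<lambda>l. \<exists>a\<in>set l. Q a)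
        \<le> avg j (\<lambda>r. ?E * err (exact f) (k r) Q)"
      unfolding bindP.simps err.simps by (intro avg_mono) (simp add: mult.commute)
    then show ?case unfolding avg_cmult err.simps by (simp add: mult.commute)
  qed (use K0 K1 in auto)
  from this[of A] have "err (exact f) (rep (Suc m) A) (\<lambda>l. \<exists>a\<in>set l. Q a) \<le> err (exact f) A Q * ?E"
    by (simp add: rep_def K_def)
  also have "\<dots> \<le> err (exact f) A Q * err (exact f) A Q ^ m"
    by (intro mult_left_mono Suc err_nonneg)
  finally show ?case by simp
qed (simp add: rep_def)

lemma spec_rep:
  assumes "spec n A q P"
  shows "spec n (rep m A) (m * q) (\<lambda>l. length l = m \<and> (\<forall>a\<in>set l. P a))"
proof -
  have "spec n (rep m A) (m * q) (list_all2 (\<lambda>_. P) (replicate m ()))"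
    unfolding rep_def using spec_mapM[of "replicate m ()" n "\<lambda>_. A" q "\<lambda>_. P"] assms by simp
  then show ?thesis
    by (rule spec_mono) (auto simp: list_all2_conv_all_nth in_set_conv_nth)
qed

section \<open>Additive and multiplicative functions on the cube\<close>

definition additive_on_cube :: "nat \<Rightarrow> (bool list \<Rightarrow> bool) \<Rightarrow> bool" where
  "additive_on_cube n D \<longleftrightarrow>
     (\<forall>x\<in>cube n. \<forall>y\<in>cube n. D (vxor x y) = (D x \<noteq> D y))"

definition multiplicative_on_cube :: "nat \<Rightarrow> (bool list \<Rightarrow> bool) \<Rightarrow> bool" where
  "multiplicative_on_cube n D \<longleftrightarrow>
     (\<forall>x\<in>cube n. \<forall>y\<in>cube n. D (meet x y) = (D x \<and> D y))"

text \<open>Translation by \<open>x0\<close> exchanges the points where \<open>D\<close> is true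
  with those where it is false.\<close>

lemma additive_avg_half:
  assumes "additive_on_cube n D" "x0 \<in> cube n" "D x0"
  shows "avg n (\<lambda>x. of_bool (D x)) = 1 / 2"
proof -
  have "avg n (\<lambda>x. of_bool (D x)) = avg n (\<lambda>x. of_bool (D (vxor x x0)))"
    by (rule avg_vxor[symmetric]) fact
  also have "\<dots> = avg n (\<lambda>x. 1 - of_bool (D x))"
    using assms by (intro avg_cong) (auto simp: additive_on_cube_def)
  finally show ?thesis by (simp add: avg_diff)
qed

lemma meet_vxor_left:
  assumes "x \<in> cube n" "x' \<in> cube n" "y \<in> cube n"
  shows "meet (vxor x x') y = vxor (meet x y) (meet x' y)"
  by (rule cube_eqI[of _ n]) (use assms in \<open>auto simp: cube_def\<close>)

lemma meet_vxor_right: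
  assumes "x \<in> cube n" "y \<in> cube n" "y' \<in> cube n"
  shows "meet x (vxor y y') = vxor (meet x y) (meet x y')"
  by (rule cube_eqI[of _ n]) (use assms in \<open>auto simp: cube_def\<close>)

text \<open>The deviation from multiplicativity is additive in each argument, a bilinear form over
  the two-element field. If it is true at \<open>(x0, y0)\<close>, it is true at
  \<open>(x, y0)\<close> for half of the \<open>x\<close>, and for each of these at
  \<open>(x, y)\<close> for half of the \<open>y\<close>.\<close>

lemma not_multiplicative_avg:
  assumes D: "additive_on_cube n D" and nm: "\<not> multiplicative_on_cube n D"
  shows "1 / 4 \<le> avg n (\<lambda>x. avg n (\<lambda>y. of_bool (D (meet x y) \<noteq> (D x \<and> D y))))"
proof -
  let ?p = "\<lambda>x y. D (meet x y) \<noteq> (D x \<and> D y)"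
  obtain x0 y0 where xy: "x0 \<in> cube n" "y0 \<in> cube n" "?p x0 y0"
    using nm by (auto simp: multiplicative_on_cube_def)
  have addx: "additive_on_cube n (\<lambda>x. ?p x y)" if "y \<in> cube n" for y
    using D that by (auto simp: additive_on_cube_def meet_vxor_left)
  have addy: "additive_on_cube n (\<lambda>y. ?p x y)" if "x \<in> cube n" for x
    using D that by (auto simp: additive_on_cube_def meet_vxor_right)
  have "1 / 4 = avg n (\<lambda>x. 1 / 2 * of_bool (?p x y0))"
    unfolding avg_cmult using additive_avg_half[OF addx[OF xy(2)] xy(1,3)] by simp
  also have "\<dots> \<le> avg n (\<lambda>x. avg n (\<lambda>y. of_bool (?p x y)))"
  proof (rule avg_mono)
    fix x assume x: "x \<in> cube n"
    show "1 / 2 * of_bool (?p x y0) \<le> avg n (\<lambda>y. of_bool (?p x y))"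
    proof (cases "?p x y0")
      case True
      then show ?thesis using additive_avg_half[OF addy[OF x] xy(2) True] by simp
    qed (auto intro: avg_nonneg)
  qed
  finally show ?thesis .
qed

text \<open>Writing a point where \<open>D\<close> is true as a sum of unit vectors shows that
  \<open>D\<close> is true at some \<open>unit c\<close>. Then
  \<open>D x = D (meet x (unit c))\<close> by multiplicativity, and this meet is
  \<open>unit c\<close> or zero according to \<open>x ! c\<close>.\<close>

lemma additive_multiplicative_cases:
  assumes add: "additive_on_cube n D" and mult: "multiplicative_on_cube n D"
  shows "(\<forall>x\<in>cube n. \<not> D x) \<or> (\<exists>c<n. \<forall>x\<in>cube n. D x = x ! c)"
proof (rule disjCI)
  assume "\<not> (\<exists>c<n. \<forall>x\<in>cube n. D x = x ! c)"
  show "\<forall>x\<in>cube n. \<not> D x"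
  proof (rule ccontr)
    assume "\<not> (\<forall>x\<in>cube n. \<not> D x)"
    then obtain x0 where x0: "x0 \<in> cube n" "D x0" by auto
    define unit where "unit c = map (\<lambda>d. d = c) [0..<n]" for c
    define pre where "pre j = map (\<lambda>d. d < j \<and> x0 ! d) [0..<n]" for j
    have cube: "unit c \<in> cube n" "pre j \<in> cube n" for c j
      by (auto simp: unit_def pre_def cube_def)
    have zero: "D x = False" if "x \<in> cube n" "\<And>d. d < n \<Longrightarrow> \<not> x ! d" for x
    proof -
      have "vxor x x = x" by (rule cube_eqI[of _ n]) (use that in \<open>auto simp: cube_def\<close>)
      moreover have "D (vxor x x) = (D x \<noteq> D x)"
        using add that(1) unfolding additive_on_cube_def by blast
      ultimately show ?thesis by simp
    qed
    have "\<exists>c<n. D (unit c)"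
    proof (rule ccontr)
      assume none: "\<not> (\<exists>c<n. D (unit c))"
      have "\<not> D (pre j)" if "j \<le> n" for j
        using that
      proof (induction j)
        case 0
        show ?case using zero[of "pre 0"] cube(2)[of 0] by (simp add: pre_def)
      next
        case (Suc j)
        show ?case
        proof (cases "x0 ! j")
          case True
          have "pre (Suc j) = vxor (pre j) (unit j)"
            by (rule cube_eqI[of _ n])
              (use Suc True in \<open>auto simp: pre_def unit_def cube_def less_Suc_eq\<close>)
          then show ?thesis
            using add none Suc cube by (auto simp: additive_on_cube_def)
        next
          case False
          then have "pre (Suc j) = pre j" by (auto simp: pre_def less_Suc_eq)
          then show ?thesis using Suc by simp
        qed
      qed
      moreover have "pre n = x0"
        by (rule cube_eqI[of _ n]) (use x0 cube in \<open>auto simp: pre_def cube_def\<close>)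
      ultimately show False using x0 by auto
    qed
    then obtain c where c: "c < n" "D (unit c)" by blast
    have "D x = x ! c" if x: "x \<in> cube n" for x
    proof (cases "x ! c")
      case True
      have "meet x (unit c) = unit c"
        by (rule cube_eqI[of _ n]) (use x True in \<open>auto simp: unit_def cube_def\<close>)
      moreover have "D (meet x (unit c)) = (D x \<and> D (unit c))"
        using mult x cube unfolding multiplicative_on_cube_def by blast
      ultimately show ?thesis using c True by simp
    next
      case False
      have "D (meet x (unit c)) = False"
        by (rule zero) (use x False c in \<open>auto simp: unit_def cube_def\<close>)
      moreover have "D (meet x (unit c)) = (D x \<and> D (unit c))"
        using mult x cube unfolding multiplicative_on_cube_def by blast
      ultimately show ?thesis using c False by simp
    qed
    then show False using \<open>\<not> (\<exists>c<n. \<forall>x\<in>cube n. D x = x ! c)\<close> c(1) by blast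
  qed
qed

section \<open>Decoding a coordinate and testing that this is possible\<close>

text \<open>A constant added to the restriction cancels in \<open>a \<noteq> b\<close>, so a
  variable and its negation decode alike. For fixed \<open>x\<close> both queries are at
  \<open>p\<close> of a uniform string.\<close>

definition decode1 :: "nat \<Rightarrow> (bool list \<Rightarrow> bool list) \<Rightarrow> bool list \<Rightarrow> bool prog" where
  "decode1 n p x = Rnd n (\<lambda>z. Ask (p z) (\<lambda>a. Ask (p (vxor z x)) (\<lambda>b. Ret (a \<noteq> b))))"

text \<open>The flag records whether the votes are unanimous.\<close>

definition decode :: "nat \<Rightarrow> nat \<Rightarrow> (bool list \<Rightarrow> bool list) \<Rightarrow> bool list \<Rightarrow> (bool \<times> bool) prog" where
  "decode n t p x =
     bindP (rep t (decode1 n p x)) (\<lambda>l. Ret (\<not> (True \<in> set l \<and> False \<in> set l), True \<in> set l))"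

text \<open>Two votes about one random point are compared, that is, the values at four points with
  sum zero. As a vote does not change under negation, this is a test for affine functions in the
  style of Blum, Luby and Rubinfeld.\<close>

definition lin_test :: "nat \<Rightarrow> (bool list \<Rightarrow> bool list) \<Rightarrow> bool prog" where
  "lin_test n p =
     Rnd n (\<lambda>x. bindP (decode1 n p x) (\<lambda>a. bindP (decode1 n p x) (\<lambda>b. Ret (a = b))))"

definition mult_test :: "nat \<Rightarrow> nat \<Rightarrow> (bool list \<Rightarrow> bool list) \<Rightarrow> bool prog" where
  "mult_test n t p = Rnd n (\<lambda>x. Rnd n (\<lambda>y.
     bindP (decode n t p x) (\<lambda>a. bindP (decode n t p y) (\<lambda>b. bindP (decode n t p (meet x y)) (\<lambda>c.
       Ret (fst a \<and> fst b \<and> fst c \<and> snd c = (snd a \<and> snd b)))))))"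

text \<open>Seven and nine are the least numbers of repetitions that bring
  \<open>(5 / 6) ^ 7\<close> and \<open>(7 / 8) ^ 9\<close> below 1/3.\<close>

definition block_test :: "nat \<Rightarrow> nat \<Rightarrow> (bool list \<Rightarrow> bool list) \<Rightarrow> bool prog" where
  "block_test n t p =
     bindP (rep 7 (lin_test n p)) (\<lambda>l. bindP (rep 9 (mult_test n t p)) (\<lambda>l'.
       Ret ((\<forall>a\<in>set l. a) \<and> (\<forall>a\<in>set l'. a))))"

section \<open>Soundness of decoding and of the block test\<close>

lemma decode1_majority:
  "\<exists>D. \<forall>x. err (exact f) (decode1 n p x) (\<lambda>a. a = D x) \<le> 1 / 2"
proof -
  define F where "F x = err (exact f) (decode1 n p x) (\<lambda>a. a = True)" for x
  have "err (exact f) (decode1 n p x) (\<lambda>a. a = False) = 1 - F x" for x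
  proof -
    have "err (exact f) (decode1 n p x) (\<lambda>a. a = False)
        = avg n (\<lambda>z. 1 - of_bool (f (p z) = f (p (vxor z x))))"
      by (auto simp: decode1_def intro: avg_cong)
    then show ?thesis by (simp add: F_def decode1_def avg_diff)
  qed
  then have "err (exact f) (decode1 n p x) (\<lambda>a. a = (F x \<le> 1 / 2)) \<le> 1 / 2" for x
    by (cases "F x \<le> 1 / 2") (auto simp: F_def)
  then show ?thesis by (intro exI[of _ "\<lambda>x. F x \<le> 1 / 2"] allI)
qed

text \<open>A unanimous wrong answer requires all \<open>t\<close> votes to miss
  \<open>d\<close>.\<close>

lemma decode_sound:
  assumes "err (exact f) (decode1 n p x) (\<lambda>a. a = d) \<le> 1 / 2"
  shows "err (exact f) (decode n t p x) (\<lambda>r. fst r \<longrightarrow> snd r = d) \<le> (1 / 2) ^ t"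
proof -
  have "err (exact f) (decode n t p x) (\<lambda>r. fst r \<longrightarrow> snd r = d)
      \<le> err (exact f) (rep t (decode1 n p x)) (\<lambda>l. \<exists>a\<in>set l. a = d) + 0"
    unfolding decode_def by (rule err_bind) (cases d; auto)+
  also have "\<dots> \<le> err (exact f) (decode1 n p x) (\<lambda>a. a = d) ^ t"
    using err_rep_ex[of f t "decode1 n p x" "\<lambda>a. a = d"] by simp
  also have "\<dots> \<le> (1 / 2) ^ t"
    by (intro power_mono assms err_nonneg)
  finally show ?thesis .
qed

context
  fixes n :: nat and p :: "bool list \<Rightarrow> bool list" and f D :: "bool list \<Rightarrow> bool"
  assumes maj: "\<And>x. err (exact f) (decode1 n p x) (\<lambda>a. a = D x) \<le> 1 / 2"
begin

private definition E where "E x z \<longleftrightarrow> f (p z) \<noteq> f (p (vxor z x))"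

text \<open>If a share \<open>m \<le> 1 / 2\<close> of the votes is in the minority, two independent
  votes differ with probability \<open>2 * m * (1 - m)\<close>, which is at least
  \<open>m\<close>.\<close>

private lemma minority_le_collision:
  "avg n (\<lambda>z. of_bool (E x z \<noteq> D x)) \<le> avg n (\<lambda>z. avg n (\<lambda>z'. of_bool (E x z \<noteq> E x z')))"
proof -
  define m where "m = avg n (\<lambda>z. of_bool (E x z \<noteq> D x))"
  have m: "0 \<le> m" "m \<le> 1 / 2"
    using maj[of x] by (auto simp: m_def E_def decode1_def intro: avg_nonneg)
  have "avg n (\<lambda>z'. of_bool (E x z \<noteq> E x z')) = m + of_bool (E x z \<noteq> D x) * (1 - 2 * m)" for z
  proof (cases "E x z = D x")
    case True
    then show ?thesis by (auto simp: m_def intro: avg_cong)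
  next
    case False
    then have "avg n (\<lambda>z'. of_bool (E x z \<noteq> E x z')) = avg n (\<lambda>z'. 1 - of_bool (E x z' \<noteq> D x))"
      by (intro avg_cong) auto
    then show ?thesis using False by (simp add: avg_diff m_def)
  qed
  then have "avg n (\<lambda>z. avg n (\<lambda>z'. of_bool (E x z \<noteq> E x z'))) = m + m * (1 - 2 * m)"
    using avg_cmult[of n "1 - 2 * m"] by (simp add: avg_add m_def mult.commute)
  moreover have "m \<le> m + m * (1 - 2 * m)" using m by simp
  ultimately show ?thesis by (simp add: m_def)
qed

private definition eta where
  "eta = avg n (\<lambda>x. avg n (\<lambda>z. avg n (\<lambda>z'. of_bool (E x z \<noteq> E x z'))))"

text \<open>Passes from an average over \<open>x\<close> to every \<open>x\<close>. The points
  \<open>z\<close>, \<open>vxor z x\<close>, \<open>z'\<close>, \<open>vxor z' x\<close> also form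
  two votes about \<open>s = vxor z' z\<close>, cast by \<open>z\<close> and by
  \<open>vxor z x\<close>. If these two differ, one of them differs from a third vote about
  \<open>s\<close>, cast by a fresh \<open>y\<close>; and since \<open>s\<close> is uniform, each of
  these events has probability \<open>eta\<close>.\<close>

private lemma collision_le:
  assumes x: "x \<in> cube n"
  shows "avg n (\<lambda>z. avg n (\<lambda>z'. of_bool (E x z \<noteq> E x z'))) \<le> 2 * eta"
proof -
  define G where "G s z = avg n (\<lambda>y. of_bool (E s z \<noteq> E s y))" for s z
  have eta: "eta = avg n (\<lambda>z. avg n (\<lambda>s. G s z))"
    unfolding eta_def G_def by (rule avg_swap)
  have "of_bool (E x z \<noteq> E x z') \<le> G (vxor z' z) z + G (vxor z' z) (vxor z x)"
    if z: "z \<in> cube n" "z' \<in> cube n" for z z'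
  proof -
    let ?s = "vxor z' z"
    have eqs: "vxor z ?s = z'" "vxor (vxor z x) ?s = vxor z' x"
      by (rule cube_eqI[of _ n]; use z x in \<open>auto simp: cube_def\<close>)+
    have "of_bool (E x z \<noteq> E x z')
        \<le> (of_bool (E ?s z \<noteq> E ?s y) + of_bool (E ?s (vxor z x) \<noteq> E ?s y) :: real)" for y
      using eqs by (auto simp: E_def)
    then have "of_bool (E x z \<noteq> E x z') \<le>
        avg n (\<lambda>y. of_bool (E ?s z \<noteq> E ?s y) + of_bool (E ?s (vxor z x) \<noteq> E ?s y))"
      by (metis (no_types, lifting) avg_const avg_mono)
    then show ?thesis by (simp add: avg_add G_def)
  qed
  then have "avg n (\<lambda>z. avg n (\<lambda>z'. of_bool (E x z \<noteq> E x z')))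
      \<le> avg n (\<lambda>z. avg n (\<lambda>z'. G (vxor z' z) z + G (vxor z' z) (vxor z x)))"
    by (intro avg_mono) auto
  also have "\<dots> = avg n (\<lambda>z. avg n (\<lambda>s. G s z)) + avg n (\<lambda>z. avg n (\<lambda>s. G s (vxor z x)))"
  proof -
    have "avg n (\<lambda>z'. G (vxor z' z) z + G (vxor z' z) (vxor z x))
        = avg n (\<lambda>s. G s z) + avg n (\<lambda>s. G s (vxor z x))" if "z \<in> cube n" for z
      using avg_vxor[OF that, of "\<lambda>s. G s z + G s (vxor z x)"] by (simp add: avg_add)
    then show ?thesis by (simp add: avg_add cong: avg_cong)
  qed
  also have "avg n (\<lambda>z. avg n (\<lambda>s. G s (vxor z x))) = avg n (\<lambda>z. avg n (\<lambda>s. G s z))"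
    using avg_vxor[OF x, of "\<lambda>z. avg n (\<lambda>s. G s z)"] .
  finally show ?thesis by (simp add: eta)
qed

text \<open>For a total oracle the error of \<open>\<lambda>r. \<not> r\<close> is the acceptance
  probability. Acceptance above 5/6 makes every minority smaller than 1/3, so for some
  \<open>z\<close> the votes on \<open>x\<close> (cast by \<open>z\<close>), on \<open>y\<close>
  (cast by \<open>vxor z x\<close>) and on \<open>vxor x y\<close> (cast by \<open>z\<close>) are
  all correct, and the third is the sum of the other two.\<close>

lemma majority_additive:
  assumes "5 / 6 < err (exact f) (lin_test n p) (\<lambda>r. \<not> r)"
  shows "additive_on_cube n D"
proof -
  have "err (exact f) (lin_test n p) (\<lambda>r. \<not> r)
      = avg n (\<lambda>x. avg n (\<lambda>z. avg n (\<lambda>z'. 1 - of_bool (E x z \<noteq> E x z'))))"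
    unfolding lin_test_def decode1_def by (auto simp: E_def intro!: avg_cong)
  also have "\<dots> = 1 - eta" by (simp add: avg_diff eta_def)
  finally have eta: "eta < 1 / 6" using assms by simp
  have minority: "avg n (\<lambda>z. of_bool (E x z \<noteq> D x)) < 1 / 3" if "x \<in> cube n" for x
    using minority_le_collision[of x] collision_le[OF that] eta by linarith
  show ?thesis
    unfolding additive_on_cube_def
  proof (intro ballI)
    fix x y assume x: "x \<in> cube n" and y: "y \<in> cube n"
    define B where "B z = (of_bool (E x z \<noteq> D x) + of_bool (E y (vxor z x) \<noteq> D y)
        + of_bool (E (vxor x y) z \<noteq> D (vxor x y)) :: real)" for z
    have "avg n B = avg n (\<lambda>z. of_bool (E x z \<noteq> D x)) + avg n (\<lambda>z. of_bool (E y z \<noteq> D y))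
        + avg n (\<lambda>z. of_bool (E (vxor x y) z \<noteq> D (vxor x y)))"
      unfolding B_def avg_add avg_vxor[OF x, of "\<lambda>z. of_bool (E y z \<noteq> D y)"] ..
    also have "\<dots> < 1" using minority[OF x] minority[OF y] minority[of "vxor x y"] x y by simp
    finally have "avg n B < 1" .
    then obtain z where z: "z \<in> cube n" "B z < 1"
      using avg_mono[of n "\<lambda>_. 1" B] by force
    then have "E x z = D x" "E y (vxor z x) = D y" "E (vxor x y) z = D (vxor x y)"
      by (auto simp: B_def of_bool_def split: if_splits)
    moreover have "E (vxor x y) z = (E x z \<noteq> E y (vxor z x))"
      using vxor_assoc[OF z(1) x y] by (auto simp: E_def)
    ultimately show "D (vxor x y) = (D x \<noteq> D y)" by simp
  qed
qed

text \<open>Otherwise at least a quarter of the pairs violate multiplicativity, and there acceptance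
  needs a unanimous wrong decoding. For \<open>5 \<le> t\<close> the acceptance probability is then
  at most 3/4 + 3/32, just below 7/8.\<close>

lemma majority_multiplicative:
  assumes "7 / 8 < err (exact f) (mult_test n t p) (\<lambda>r. \<not> r)" "5 \<le> t" "additive_on_cube n D"
  shows "multiplicative_on_cube n D"
proof (rule ccontr)
  assume nm: "\<not> multiplicative_on_cube n D"
  let ?e = "(1 / 2) ^ t :: real"
  have dec: "err (exact f) (decode n t p x) (\<lambda>r. fst r \<longrightarrow> snd r = D x) \<le> ?e" for x
    by (rule decode_sound) (rule maj)
  define W where "W x y = bindP (decode n t p x) (\<lambda>a. bindP (decode n t p y) (\<lambda>b.
      bindP (decode n t p (meet x y)) (\<lambda>c.
        Ret (fst a \<and> fst b \<and> fst c \<and> snd c = (snd a \<and> snd b)))))" for x y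
  have W: "err (exact f) (W x y) (\<lambda>r. \<not> r)
      \<le> 1 - of_bool (D (meet x y) \<noteq> (D x \<and> D y)) + 3 * ?e" for x y
  proof (cases "D (meet x y) \<noteq> (D x \<and> D y)")
    case True
    have "err (exact f) (W x y) (\<lambda>r. \<not> r) \<le> ?e + (?e + (?e + 0))"
      unfolding W_def
      apply (rule order_trans[OF err_bind add_right_mono[OF dec]])
       apply (rule order_trans[OF err_bind add_right_mono[OF dec]])
        apply (rule order_trans[OF err_bind add_right_mono[OF dec]])
      using True by auto
    then show ?thesis using True by simp
  next
    case False
    have "err (exact f) (W x y) (\<lambda>r. \<not> r) \<le> 1" by (rule err_le_1)
    then show ?thesis using False by (simp add: add_increasing2)
  qed
  have "err (exact f) (mult_test n t p) (\<lambda>r. \<not> r)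
      = avg n (\<lambda>x. avg n (\<lambda>y. err (exact f) (W x y) (\<lambda>r. \<not> r)))"
    by (simp add: mult_test_def W_def)
  also have "\<dots> \<le> avg n (\<lambda>x. avg n (\<lambda>y.
      1 - of_bool (D (meet x y) \<noteq> (D x \<and> D y)) + 3 * ?e))"
    by (intro avg_mono W)
  also have "\<dots> \<le> 3 / 4 + 3 * ?e"
    using not_multiplicative_avg[OF assms(3) nm] by (simp add: avg_add avg_diff)
  also have "?e \<le> (1 / 2) ^ 5" using assms(2) by (intro power_decreasing) auto
  finally show False using assms(1) by (simp add: power_divide)
qed

end

lemma block_test_sound:
  assumes "1 / 3 < err (exact f) (block_test n t p) (\<lambda>r. \<not> r)" "5 \<le> t"
  obtains D where
    "(\<forall>x\<in>cube n. \<not> D x) \<or> (\<exists>c<n. \<forall>x\<in>cube n. D x = x ! c)"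
    "\<And>x. err (exact f) (decode1 n p x) (\<lambda>a. a = D x) \<le> 1 / 2"
proof -
  obtain D where D: "\<And>x. err (exact f) (decode1 n p x) (\<lambda>a. a = D x) \<le> 1 / 2"
    using decode1_majority by blast
  let ?lin = "err (exact f) (lin_test n p) (\<lambda>r. \<not> r)"
  let ?mult = "err (exact f) (mult_test n t p) (\<lambda>r. \<not> r)"
  have "err (exact f) (block_test n t p) (\<lambda>r. \<not> r)
      \<le> err (exact f) (rep 7 (lin_test n p)) (\<lambda>l. \<exists>a\<in>set l. \<not> a) + 0"
    unfolding block_test_def by (rule err_bind, rule err_bind_total) auto
  also have "\<dots> \<le> ?lin ^ 7" using err_rep_ex[of f 7 "lin_test n p" "\<lambda>r. \<not> r"] by simp
  finally have lin: "1 / 3 < ?lin ^ 7" using assms(1) by simp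
  have "5 / 6 < ?lin"
  proof (rule ccontr)
    assume "\<not> 5 / 6 < ?lin"
    then have "?lin ^ 7 \<le> (5 / 6) ^ 7" by (intro power_mono err_nonneg) simp
    then show False using lin by (simp add: power_divide)
  qed
  then have add: "additive_on_cube n D" by (rule majority_additive[OF D])
  have "err (exact f) (block_test n t p) (\<lambda>r. \<not> r)
      \<le> err (exact f) (rep 9 (mult_test n t p)) (\<lambda>l. \<exists>a\<in>set l. \<not> a)"
    unfolding block_test_def
    by (rule err_bind_total, rule order_trans[OF err_bind[where d = 0 and P = "\<lambda>l. \<exists>a\<in>set l. \<not> a"]])
      (auto simp: err_nonneg)
  also have "\<dots> \<le> ?mult ^ 9" using err_rep_ex[of f 9 "mult_test n t p" "\<lambda>r. \<not> r"] by simp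
  finally have mult: "1 / 3 < ?mult ^ 9" using assms(1) by simp
  have "7 / 8 < ?mult"
  proof (rule ccontr)
    assume "\<not> 7 / 8 < ?mult"
    then have "?mult ^ 9 \<le> (7 / 8) ^ 9" by (intro power_mono err_nonneg) simp
    then show False using mult by (simp add: power_divide)
  qed
  then have "multiplicative_on_cube n D"
    by (rule majority_multiplicative[OF D _ assms(2) add])
  then show ?thesis using that[OF additive_multiplicative_cases[OF add] D] by blast
qed

section \<open>Completeness of decoding for a literal under rare aborts\<close>

definition abort_on :: "(bool list \<Rightarrow> bool) \<Rightarrow> (bool list \<Rightarrow> bool) \<Rightarrow> bool list \<Rightarrow> bool option" where
  "abort_on bad f x = (if bad x then None else Some (f x))"

context
  fixes n :: nat and p :: "bool list \<Rightarrow> bool list" and f bad :: "bool list \<Rightarrow> bool"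
    and c :: nat and \<alpha> :: real
  assumes rare: "avg n (\<lambda>z. of_bool (bad (p z))) \<le> \<alpha>"
    and coord: "\<And>z x. z \<in> cube n \<Longrightarrow> x \<in> cube n \<Longrightarrow> (f (p z) \<noteq> f (p (vxor z x))) = x ! c"
    and c: "c < n"
begin

lemma decode1_complete:
  assumes x: "x \<in> cube n"
  shows "err (abort_on bad f) (decode1 n p x) (\<lambda>a. a = x ! c) \<le> 2 * \<alpha>"
proof -
  have "err (abort_on bad f) (decode1 n p x) (\<lambda>a. a = x ! c)
      \<le> avg n (\<lambda>z. of_bool (bad (p z)) + of_bool (bad (p (vxor z x))))"
    unfolding decode1_def err.simps
    by (intro avg_mono) (use coord x in \<open>auto simp: abort_on_def\<close>)
  also have "\<dots> = 2 * avg n (\<lambda>z. of_bool (bad (p z)))"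
    unfolding avg_add using avg_vxor[OF x, of "\<lambda>z. of_bool (bad (p z))"] by simp
  finally show ?thesis using rare by simp
qed

lemma decode_complete:
  assumes x: "x \<in> cube n" and t: "0 < t"
  shows "err (abort_on bad f) (decode n t p x) (\<lambda>r. r = (True, x ! c)) \<le> t * (2 * \<alpha>)"
proof -
  have "err (abort_on bad f) (decode n t p x) (\<lambda>r. r = (True, x ! c))
      \<le> err (abort_on bad f) (rep t (decode1 n p x)) (\<lambda>l. length l = t \<and> (\<forall>a\<in>set l. a = x ! c)) + 0"
    unfolding decode_def
  proof (rule err_bind)
    fix l assume "length l = t \<and> (\<forall>a\<in>set l. a = x ! c)"
    then show "err (abort_on bad f) (Ret (\<not> (True \<in> set l \<and> False \<in> set l), True \<in> set l))
        (\<lambda>r. r = (True, x ! c)) \<le> 0"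
      using t by (cases l; cases "x ! c") auto
  qed simp
  also have "\<dots> \<le> t * err (abort_on bad f) (decode1 n p x) (\<lambda>a. a = x ! c)"
    using err_rep_all[of _ t "decode1 n p x" "\<lambda>a. a = x ! c"] by simp
  also have "\<dots> \<le> t * (2 * \<alpha>)" by (intro mult_left_mono decode1_complete x) simp
  finally show ?thesis .
qed

text \<open>Without aborts a literal passes every test, so the bound is the number of queries times
  \<alpha>: \<open>7 * 4\<close> for linearity and \<open>9 * 6 * t\<close> for
  multiplicativity.\<close>

lemma block_test_complete:
  assumes t: "0 < t"
  shows "err (abort_on bad f) (block_test n t p) (\<lambda>r. r) \<le> (28 + 54 * real t) * \<alpha>"
proof -
  let ?g = "abort_on bad f"
  have \<alpha>: "0 \<le> \<alpha>" using rare avg_nonneg[of n "\<lambda>z. of_bool (bad (p z))"] by simp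
  have lin: "err ?g (lin_test n p) (\<lambda>r. r) \<le> 4 * \<alpha>"
  proof -
    have "err ?g (bindP (decode1 n p x) (\<lambda>a. bindP (decode1 n p x) (\<lambda>b. Ret (a = b)))) (\<lambda>r. r)
        \<le> 2 * \<alpha> + (2 * \<alpha> + 0)" if x: "x \<in> cube n" for x
      apply (rule order_trans[OF err_bind add_right_mono[OF decode1_complete[OF x]]])
       apply (rule order_trans[OF err_bind add_right_mono[OF decode1_complete[OF x]]])
      using \<alpha> by auto
    then show ?thesis unfolding lin_test_def err.simps by (intro avg_le) auto
  qed
  let ?d = "t * (2 * \<alpha>)"
  have mult: "err ?g (mult_test n t p) (\<lambda>r. r) \<le> 3 * ?d"
  proof -
    have "err ?g (bindP (decode n t p x) (\<lambda>a. bindP (decode n t p y) (\<lambda>b.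
          bindP (decode n t p (meet x y)) (\<lambda>e.
            Ret (fst a \<and> fst b \<and> fst e \<and> snd e = (snd a \<and> snd b)))))) (\<lambda>r. r)
        \<le> ?d + (?d + (?d + 0))" if x: "x \<in> cube n" and y: "y \<in> cube n" for x y
      apply (rule order_trans[OF err_bind add_right_mono[OF decode_complete[OF x t]]])
       apply (rule order_trans[OF err_bind add_right_mono[OF decode_complete[OF y t]]])
        apply (rule order_trans[OF err_bind add_right_mono[OF decode_complete[OF meet_cube[OF x y] t]]])
      using \<alpha> x y c by (auto simp: cube_def)
    then show ?thesis unfolding mult_test_def err.simps by (intro avg_le) (simp add: algebra_simps)
  qed
  have lin': "err ?g (rep 7 (lin_test n p)) (\<lambda>l. \<forall>a\<in>set l. a) \<le> 7 * (4 * \<alpha>)"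
    using err_rep_ball[of ?g 7 "lin_test n p" "\<lambda>r. r"] lin by simp
  have mult': "err ?g (rep 9 (mult_test n t p)) (\<lambda>l. \<forall>a\<in>set l. a) \<le> 9 * (3 * ?d)"
    using err_rep_ball[of ?g 9 "mult_test n t p" "\<lambda>r. r"] mult by simp
  have "err ?g (block_test n t p) (\<lambda>r. r) \<le> 7 * (4 * \<alpha>) + (9 * (3 * ?d) + 0)"
    unfolding block_test_def
    apply (rule order_trans[OF err_bind add_right_mono[OF lin']])
     apply (rule order_trans[OF err_bind add_right_mono[OF mult']])
    using \<alpha> by auto
  then show ?thesis by (simp add: algebra_simps)
qed

end

lemma spec_decode1:
  assumes "\<And>z. z \<in> cube n \<Longrightarrow> p z \<in> cube n" "x \<in> cube n"
  shows "spec n (decode1 n p x) 2 (\<lambda>_. True)"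
  using assms by (auto simp: decode1_def)

lemma spec_decode:
  assumes "\<And>z. z \<in> cube n \<Longrightarrow> p z \<in> cube n" "x \<in> cube n"
  shows "spec n (decode n t p x) (2 * t) (\<lambda>_. True)"
proof -
  have d: "spec n (decode1 n p x) 2 (\<lambda>_. True)"
    by (rule spec_decode1) (use assms in auto)
  have "spec n (decode n t p x) (t * 2 + 0) (\<lambda>_. True)"
    unfolding decode_def by (rule spec_bind[OF spec_rep[OF d]]) simp
  then show ?thesis by (simp add: mult.commute)
qed

lemma spec_block_test:
  assumes "\<And>z. z \<in> cube n \<Longrightarrow> p z \<in> cube n"
  shows "spec n (block_test n t p) (28 + 54 * t) (\<lambda>_. True)"
proof -
  have d1: "spec n (decode1 n p x) 2 (\<lambda>_. True)" if "x \<in> cube n" for x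
    by (rule spec_decode1) (use assms that in auto)
  have d: "spec n (decode n t p x) (2 * t) (\<lambda>_. True)" if "x \<in> cube n" for x
    by (rule spec_decode) (use assms that in auto)
  have lin: "spec n (lin_test n p) 4 (\<lambda>_. True)"
  proof -
    have "spec n (bindP (decode1 n p x) (\<lambda>a. bindP (decode1 n p x) (\<lambda>b. Ret (a = b))))
        (2 + (2 + 0)) (\<lambda>_. True)" if x: "x \<in> cube n" for x
      by (rule spec_bind[OF d1[OF x]], rule spec_bind[OF d1[OF x]]) auto
    then show ?thesis by (simp add: lin_test_def)
  qed
  have mult: "spec n (mult_test n t p) (6 * t) (\<lambda>_. True)"
  proof -
    have "spec n (bindP (decode n t p x) (\<lambda>a. bindP (decode n t p y) (\<lambda>b.
          bindP (decode n t p (meet x y)) (\<lambda>e.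
            Ret (fst a \<and> fst b \<and> fst e \<and> snd e = (snd a \<and> snd b))))))
        (2 * t + (2 * t + (2 * t + 0))) (\<lambda>_. True)" if x: "x \<in> cube n" and y: "y \<in> cube n" for x y
      by (rule spec_bind[OF d[OF x]], rule spec_bind[OF d[OF y]],
          rule spec_bind[OF d[OF meet_cube[OF x y]]]) auto
    then show ?thesis by (simp add: mult_test_def)
  qed
  have "spec n (block_test n t p) (7 * 4 + (9 * (6 * t) + 0)) (\<lambda>_. True)"
    unfolding block_test_def
    by (rule spec_bind[OF spec_rep[OF lin]], rule spec_bind[OF spec_rep[OF mult]]) auto
  then show ?thesis by simp
qed

lemma err_ball:
  "finite I \<Longrightarrow> err g A (\<lambda>a. \<forall>i\<in>I. P i a) \<le> (\<Sum>i\<in>I. err g A (P i)) + err g A (\<lambda>_. True)"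
proof (induction I rule: finite_induct)
  case (insert i I)
  have "err g A (\<lambda>a. \<forall>j\<in>insert i I. P j a) \<le> err g A (P i) + err g A (\<lambda>a. \<forall>j\<in>I. P j a)"
    using err_conj[of g A "P i" "\<lambda>a. \<forall>j\<in>I. P j a"] by simp
  then show ?case using insert by simp
qed simp

section \<open>Random partition into blocks\<close>

text \<open>One string of length \<open>n\<close> supplies the next bit of all block numbers, so
  \<open>a\<close> rounds from zero give the coordinates independent uniform numbers below
  \<open>2 ^ a\<close>.\<close>

primrec partition_prog :: "nat \<Rightarrow> nat \<Rightarrow> (nat \<Rightarrow> nat) \<Rightarrow> (nat \<Rightarrow> nat) prog" where
  "partition_prog n 0 blk = Ret blk"
| "partition_prog n (Suc a) blk =
     Rnd n (\<lambda>r. partition_prog n a (\<lambda>c. 2 * blk c + of_bool (r ! c)))"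

lemma spec_partition:
  "(\<And>c. blk c < 2 ^ j) \<Longrightarrow> spec n (partition_prog n a blk) 0 (\<lambda>blk'. \<forall>c. blk' c < 2 ^ (j + a))"
proof (induction a arbitrary: blk j)
  case (Suc a)
  have "2 * blk c + of_bool (r ! c) < 2 ^ Suc j" for c r
    using Suc.prems[of c] by (cases "r ! c") auto
  then have "spec n (partition_prog n a (\<lambda>c. 2 * blk c + of_bool (r ! c))) 0
      (\<lambda>blk'. \<forall>c. blk' c < 2 ^ (Suc j + a))" for r
    by (rule Suc.IH)
  then show ?case by simp
qed simp

text \<open>Numbers once distinct stay distinct when a bit is appended; equal ones are separated
  with probability 1/2 in each round.\<close>

lemma err_partition_pair:
  assumes "c < n" "c' < n" "c \<noteq> c'"
  shows "err g (partition_prog n a blk) (\<lambda>b. b c \<noteq> b c') \<le> of_bool (blk c = blk c') / 2 ^ a"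
proof (induction a arbitrary: blk)
  case (Suc a)
  define D where "D r \<longleftrightarrow> r ! c \<noteq> r ! c'" for r :: "bool list"
  have add: "additive_on_cube n D"
    using assms by (auto simp: additive_on_cube_def D_def cube_def)
  have ex: "map (\<lambda>d. d = c) [0..<n] \<in> cube n" "D (map (\<lambda>d. d = c) [0..<n])"
    using assms by (auto simp: D_def cube_def)
  have "err g (partition_prog n (Suc a) blk) (\<lambda>b. b c \<noteq> b c')
      \<le> avg n (\<lambda>r. of_bool (blk c = blk c') / 2 ^ a * (1 - of_bool (D r)))"
    unfolding partition_prog.simps err.simps
  proof (rule avg_mono)
    fix r
    have "of_bool (2 * blk c + of_bool (r ! c) = 2 * blk c' + of_bool (r ! c'))
        \<le> (of_bool (blk c = blk c') * (1 - of_bool (D r)) :: real)"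
      by (cases "r ! c"; cases "r ! c'") (auto simp: D_def, presburger+)
    then have "of_bool (2 * blk c + of_bool (r ! c) = 2 * blk c' + of_bool (r ! c')) / 2 ^ a
        \<le> (of_bool (blk c = blk c') * (1 - of_bool (D r)) / 2 ^ a :: real)"
      by (rule divide_right_mono) simp
    then show "err g (partition_prog n a (\<lambda>d. 2 * blk d + of_bool (r ! d))) (\<lambda>b. b c \<noteq> b c')
        \<le> of_bool (blk c = blk c') / 2 ^ a * (1 - of_bool (D r))"
      using Suc.IH[of "\<lambda>d. 2 * blk d + of_bool (r ! d)"] by simp
  qed
  also have "\<dots> = of_bool (blk c = blk c') / 2 ^ Suc a"
    unfolding avg_cmult avg_diff additive_avg_half[OF add ex] by simp
  finally show ?case .
qed simp

lemma err_partition_True: "err g (partition_prog n a blk) (\<lambda>_. True) = 0"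
  by (induction a arbitrary: blk) auto

lemma err_partition_inj:
  assumes "finite V" "V \<subseteq> {..<n}"
  shows "err g (partition_prog n a blk) (\<lambda>b. inj_on b V) \<le> real (card V) ^ 2 / 2 ^ a"
proof -
  let ?I = "{p \<in> V \<times> V. fst p \<noteq> snd p}"
  have fin: "finite ?I" by (rule finite_subset[of _ "V \<times> V"]) (use assms in auto)
  have "err g (partition_prog n a blk) (\<lambda>b. inj_on b V)
      \<le> err g (partition_prog n a blk) (\<lambda>b. \<forall>p\<in>?I. b (fst p) \<noteq> b (snd p))"
    by (rule err_mono) (auto simp: inj_on_def)
  also have "\<dots> \<le> (\<Sum>p\<in>?I. 1 / 2 ^ a)"
  proof (rule order_trans[OF err_ball[OF fin]], unfold err_partition_True add_0_right, rule sum_mono)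
    fix p assume "p \<in> ?I"
    then have "err g (partition_prog n a blk) (\<lambda>b. b (fst p) \<noteq> b (snd p))
        \<le> of_bool (blk (fst p) = blk (snd p)) / 2 ^ a"
      using assms by (intro err_partition_pair) auto
    also have "\<dots> \<le> 1 / 2 ^ a" by (intro divide_right_mono) auto
    finally show "err g (partition_prog n a blk) (\<lambda>b. b (fst p) \<noteq> b (snd p)) \<le> 1 / 2 ^ a" .
  qed
  also have "\<dots> = real (card ?I) / 2 ^ a" by simp
  also have "\<dots> \<le> real (card V) ^ 2 / 2 ^ a"
  proof (rule divide_right_mono)
    have "card ?I \<le> card (V \<times> V)" by (rule card_mono) (use assms in auto)
    then show "real (card ?I) \<le> real (card V) ^ 2"
      by (simp add: card_cartesian_product power2_eq_square flip: of_nat_mult)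
  qed simp
  finally show ?thesis .
qed

section \<open>Searching for relevant blocks\<close>

text \<open>An entry is a block number together with a base point for probing that block.\<close>

type_synonym entry = "nat \<times> bool list"

definition probe :: "(nat \<Rightarrow> nat) \<Rightarrow> entry \<Rightarrow> bool list \<Rightarrow> bool list" where
  "probe blk e z = mix (\<lambda>c. blk c \<noteq> fst e) (snd e) z"

text \<open>Leads from \<open>x\<close> at \<open>j = 0\<close> to the string that keeps
  \<open>x\<close> on the blocks in \<open>X\<close> only. Steps \<open>j\<close> and
  \<open>Suc j\<close> differ at most in block \<open>j\<close>, and not at all if
  \<open>j \<in> X\<close>.\<close>

definition hybrid :: "(nat \<Rightarrow> nat) \<Rightarrow> nat set \<Rightarrow> bool list \<Rightarrow> bool list \<Rightarrow> nat \<Rightarrow> bool list" where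
  "hybrid blk X x u j = mix (\<lambda>c. blk c \<in> X \<or> j \<le> blk c) x u"

text \<open>The invariant is that the value is \<open>b\<close> at \<open>lo\<close> and not
  \<open>b\<close> at \<open>lo + 2 ^ a\<close>; in a window of width 1 the value thus changes right
  after \<open>lo\<close>.\<close>

primrec bsearch :: "(nat \<Rightarrow> bool list) \<Rightarrow> bool \<Rightarrow> nat \<Rightarrow> nat \<Rightarrow> nat prog" where
  "bsearch pt b 0 lo = Ret lo"
| "bsearch pt b (Suc a) lo =
     Ask (pt (lo + 2 ^ a)) (\<lambda>c. if c = b then bsearch pt b a (lo + 2 ^ a) else bsearch pt b a lo)"

definition trial :: "nat \<Rightarrow> (nat \<Rightarrow> nat) \<Rightarrow> nat \<Rightarrow> nat set \<Rightarrow> entry option prog" where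
  "trial n blk a X = Rnd n (\<lambda>x. Rnd n (\<lambda>u.
     Ask (hybrid blk X x u 0) (\<lambda>b. Ask (hybrid blk X x u (2 ^ a)) (\<lambda>c.
       if b = c then Ret None
       else bindP (bsearch (hybrid blk X x u) b a 0) (\<lambda>j. Ret (Some (j, hybrid blk X x u j)))))))"

primrec search :: "nat \<Rightarrow> (nat \<Rightarrow> nat) \<Rightarrow> nat \<Rightarrow> nat \<Rightarrow> nat \<Rightarrow> entry list \<Rightarrow> entry list prog" where
  "search n blk a M 0 st = Ret st"
| "search n blk a M (Suc m) st =
     bindP (rep M (trial n blk a (fst ` set st))) (\<lambda>l.
       if \<exists>e. Some e \<in> set l then search n blk a M m ((SOME e. Some e \<in> set l) # st) else Ret st)"

definition unsettled :: "nat \<Rightarrow> (bool list \<Rightarrow> bool) \<Rightarrow> (nat \<Rightarrow> nat) \<Rightarrow> nat set \<Rightarrow> real" where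
  "unsettled n f blk X =
     avg n (\<lambda>x. avg n (\<lambda>u. of_bool (f x \<noteq> f (mix (\<lambda>c. blk c \<in> X) x u))))"

text \<open>The point \<open>v\<close> witnesses that the block is relevant around the base point.
  The last clause has to be recorded because the base point is kept and reused, so that its probes
  are no longer uniform.\<close>

definition good_entry ::
    "nat \<Rightarrow> (bool list \<Rightarrow> bool) \<Rightarrow> (bool list \<Rightarrow> bool) \<Rightarrow> real \<Rightarrow> (nat \<Rightarrow> nat) \<Rightarrow> entry \<Rightarrow> bool" where
  "good_entry n f bad \<alpha> blk e \<longleftrightarrow> snd e \<in> cube n \<and>
     (\<exists>v\<in>cube n. f v \<noteq> f (snd e) \<and> (\<forall>c<n. blk c \<noteq> fst e \<longrightarrow> v ! c = snd e ! c)) \<and>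
     avg n (\<lambda>z. of_bool (bad (probe blk e z))) \<le> \<alpha>"

lemma probe_cube [simp]: "snd e \<in> cube n \<Longrightarrow> probe blk e z \<in> cube n"
  by (simp add: probe_def)

lemma hybrid_cube [simp]: "x \<in> cube n \<Longrightarrow> hybrid blk X x u j \<in> cube n"
  by (simp add: hybrid_def)

lemma hybrid_0: "x \<in> cube n \<Longrightarrow> hybrid blk X x u 0 = x"
  by (rule cube_eqI[of _ n]) (auto simp: hybrid_def cube_def)

lemma hybrid_top:
  assumes "x \<in> cube n" "\<And>c. blk c < r"
  shows "hybrid blk X x u r = mix (\<lambda>c. blk c \<in> X) x u"
  by (rule cube_eqI[of _ n])
    (use assms in \<open>auto simp: hybrid_def cube_def not_le dest: leD\<close>)

lemma spec_bsearch:
  "(\<And>j. pt j \<in> cube n) \<Longrightarrow> spec n (bsearch pt b a lo) a (\<lambda>_. True)"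
  by (induction a arbitrary: lo) auto

lemma spec_trial: "spec n (trial n blk a X) (2 + a) (\<lambda>r. \<forall>e. r = Some e \<longrightarrow> snd e \<in> cube n)"
proof -
  have "spec n (bindP (bsearch (hybrid blk X x u) b a 0) (\<lambda>j. Ret (Some (j, hybrid blk X x u j))))
      (a + 0) (\<lambda>r. \<forall>e. r = Some e \<longrightarrow> snd e \<in> cube n)" if "x \<in> cube n" for x u b
    by (rule spec_bind[OF spec_bsearch]) (use that in auto)
  then show ?thesis by (auto simp: trial_def)
qed

lemma spec_search:
  assumes "\<forall>e\<in>set st. snd e \<in> cube n"
  shows "spec n (search n blk a M m st) (m * (M * (2 + a)))
    (\<lambda>st'. length st' \<le> length st + m \<and> (\<forall>e\<in>set st'. snd e \<in> cube n))"
  using assms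
proof (induction m arbitrary: st)
  case (Suc m)
  have "spec n (search n blk a M (Suc m) st) (M * (2 + a) + m * (M * (2 + a)))
    (\<lambda>st'. length st' \<le> length st + Suc m \<and> (\<forall>e\<in>set st'. snd e \<in> cube n))"
    unfolding search.simps
  proof (rule spec_bind[OF spec_rep[OF spec_trial]])
    fix l :: "entry option list"
    assume l: "length l = M \<and> (\<forall>r\<in>set l. \<forall>e. r = Some e \<longrightarrow> snd e \<in> cube n)"
    show "spec n (if \<exists>e. Some e \<in> set l then search n blk a M m ((SOME e. Some e \<in> set l) # st) else Ret st)
        (m * (M * (2 + a)))
        (\<lambda>st'. length st' \<le> length st + Suc m \<and> (\<forall>e\<in>set st'. snd e \<in> cube n))"
    proof (cases "\<exists>e. Some e \<in> set l")
      case True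
      then have "Some (SOME e. Some e \<in> set l) \<in> set l" by (rule someI_ex)
      then have "\<forall>e\<in>set ((SOME e. Some e \<in> set l) # st). snd e \<in> cube n"
        using l Suc.prems by fastforce
      from Suc.IH[OF this] show ?thesis using True by (auto intro: spec_mono)
    qed (use Suc.prems in auto)
  qed
  then show ?case by simp
qed simp

lemma bsearch_complete:
  assumes "\<And>j. j \<le> lo + 2 ^ a \<Longrightarrow> g (pt j) = Some (f (pt j))"
    and "f (pt lo) = b" "f (pt (lo + 2 ^ a)) \<noteq> b"
  shows "err g (bsearch pt b a lo) (\<lambda>j. j < lo + 2 ^ a \<and> f (pt j) \<noteq> f (pt (Suc j))) = 0"
  using assms
proof (induction a arbitrary: lo)
  case (Suc a)
  define mid where "mid = lo + 2 ^ a"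
  have g: "g (pt mid) = Some (f (pt mid))" by (rule Suc.prems) (simp add: mid_def)
  show ?case
  proof (cases "f (pt mid) = b")
    case True
    have "err g (bsearch pt b a mid) (\<lambda>j. j < mid + 2 ^ a \<and> f (pt j) \<noteq> f (pt (Suc j))) = 0"
      by (rule Suc.IH) (use Suc.prems True in \<open>auto simp: mid_def mult_2 add.assoc\<close>)
    then show ?thesis using g True by (simp add: mid_def mult_2 add.assoc)
  next
    case False
    have "err g (bsearch pt b a lo) (\<lambda>j. j < lo + 2 ^ Suc a \<and> f (pt j) \<noteq> f (pt (Suc j)))
        \<le> err g (bsearch pt b a lo) (\<lambda>j. j < lo + 2 ^ a \<and> f (pt j) \<noteq> f (pt (Suc j)))"
      by (rule err_mono) auto
    also have "\<dots> = 0"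
      by (rule Suc.IH) (use Suc.prems False in \<open>auto simp: mid_def\<close>)
    finally show ?thesis using g False
      by (simp add: mid_def[symmetric] antisym[OF _ err_nonneg])
  qed
qed auto

lemma trial_detects:
  assumes "\<And>c. blk c < 2 ^ a"
  shows "err (exact f) (trial n blk a X) (\<lambda>r. r \<noteq> None) \<le> 1 - unsettled n f blk X"
proof -
  have "err (exact f) (bindP (bsearch (hybrid blk X x u) b a 0)
      (\<lambda>j. Ret (Some (j, hybrid blk X x u j)))) (\<lambda>r. r \<noteq> None) \<le> 0" for x u b
    by (rule err_bind_total) auto
  then have "err (exact f) (trial n blk a X) (\<lambda>r. r \<noteq> None)
      \<le> avg n (\<lambda>x. avg n (\<lambda>u. 1 - of_bool (f x \<noteq> f (mix (\<lambda>c. blk c \<in> X) x u))))"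
    unfolding trial_def err.simps
    by (intro avg_mono) (auto simp: hybrid_0 hybrid_top assms)
  then show ?thesis by (simp add: avg_diff unsettled_def)
qed

text \<open>All \<open>2 ^ a + 1\<close> hybrids are charged, whichever of them the search visits:
  each is uniform for fixed \<open>j\<close>, hence bad with probability at most \<mu>. As a uniform
  base point with a uniform probe is again uniform, the bad fraction of the probes averages to at
  most \<mu> over base points, and Markov's inequality gives \<open>\<mu> / \<alpha>\<close> for
  each of the \<open>2 ^ a\<close> possible base points.\<close>

lemma trial_complete:
  assumes blk: "\<And>c. blk c < 2 ^ a"
    and rare: "avg n (\<lambda>x. of_bool (bad x)) \<le> \<mu>" and \<alpha>: "0 < \<alpha>"
  shows "err (abort_on bad f) (trial n blk a X)
      (\<lambda>r. \<forall>e. r = Some e \<longrightarrow> good_entry n f bad \<alpha> blk e \<and> fst e \<notin> X)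
    \<le> (2 ^ a + 1) * \<mu> + 2 ^ a * (\<mu> / \<alpha>)"
proof -
  let ?g = "abort_on bad f"
  let ?Q = "\<lambda>r. \<forall>e. r = Some e \<longrightarrow> good_entry n f bad \<alpha> blk e \<and> fst e \<notin> X"
  define W where "W j v = avg n (\<lambda>z. of_bool (bad (probe blk (j, v) z)))" for j v
  define B where "B x u = (\<Sum>j\<le>2 ^ a. of_bool (bad (hybrid blk X x u j))) +
      (\<Sum>j<2 ^ a. of_bool (\<not> W j (hybrid blk X x u j) \<le> \<alpha>) :: real)" for x u
  have avg_hybrid: "avg n (\<lambda>x. avg n (\<lambda>u. F (hybrid blk X x u j))) = avg n F" for F j
    unfolding hybrid_def by (rule avg_mix)
  have W: "avg n (\<lambda>v. of_bool (\<not> W j v \<le> \<alpha>)) \<le> \<mu> / \<alpha>" for j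
  proof -
    have "of_bool (\<not> W j v \<le> \<alpha>) \<le> 1 / \<alpha> * W j v" for v
      using \<alpha> avg_nonneg[of n "\<lambda>z. of_bool (bad (probe blk (j, v) z))"]
      by (auto simp: W_def[symmetric] field_simps)
    then have "avg n (\<lambda>v. of_bool (\<not> W j v \<le> \<alpha>)) \<le> avg n (\<lambda>v. 1 / \<alpha> * W j v)"
      by (intro avg_mono)
    also have "\<dots> = 1 / \<alpha> * avg n (\<lambda>x. of_bool (bad x))"
      unfolding avg_cmult W_def probe_def fst_conv snd_conv
        avg_mix[of n "\<lambda>x. of_bool (bad x)"] ..
    also have "\<dots> \<le> \<mu> / \<alpha>" using rare \<alpha> by (simp add: divide_right_mono)
    finally show ?thesis .
  qed
  define body where "body x u = Ask (hybrid blk X x u 0) (\<lambda>b. Ask (hybrid blk X x u (2 ^ a)) (\<lambda>c.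
       if b = c then Ret None
       else bindP (bsearch (hybrid blk X x u) b a 0) (\<lambda>j. Ret (Some (j, hybrid blk X x u j)))))" for x u
  have body: "err ?g (body x u) ?Q \<le> B x u" if x: "x \<in> cube n" and u: "u \<in> cube n" for x u
  proof -
    let ?h = "hybrid blk X x u"
    consider (bad) j where "j \<le> 2 ^ a" "bad (?h j)"
      | (heavy) j where "j < 2 ^ a" "\<not> W j (?h j) \<le> \<alpha>"
      | (ok) "\<And>j. j \<le> 2 ^ a \<Longrightarrow> \<not> bad (?h j)" "\<And>j. j < 2 ^ a \<Longrightarrow> W j (?h j) \<le> \<alpha>"
      by blast
    then show ?thesis
    proof cases
      case bad
      have "1 \<le> (\<Sum>j\<le>2 ^ a. of_bool (bad (?h j)) :: real)"
        using member_le_sum[of j "{..2 ^ a}" "\<lambda>j. of_bool (bad (?h j)) :: real"] bad by simp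
      moreover have "0 \<le> (\<Sum>j<2 ^ a. of_bool (\<not> W j (?h j) \<le> \<alpha>) :: real)" by (simp add: sum_nonneg)
      ultimately have "1 \<le> B x u" unfolding B_def by linarith
      then show ?thesis using err_le_1 order_trans by blast
    next
      case heavy
      have "1 \<le> (\<Sum>j<2 ^ a. of_bool (\<not> W j (?h j) \<le> \<alpha>) :: real)"
        using member_le_sum[of j "{..<2 ^ a}" "\<lambda>j. of_bool (\<not> W j (?h j) \<le> \<alpha>) :: real"] heavy by simp
      moreover have "0 \<le> (\<Sum>j\<le>2 ^ a. of_bool (bad (?h j)) :: real)" by (simp add: sum_nonneg)
      ultimately have "1 \<le> B x u" unfolding B_def by linarith
      then show ?thesis using err_le_1 order_trans by blast
    next
      case ok
      have g: "?g (?h j) = Some (f (?h j))" if "j \<le> 2 ^ a" for j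
        using ok(1)[OF that] by (simp add: abort_on_def)
      have "err ?g (body x u) ?Q \<le> 0"
      proof (cases "f (?h 0) = f (?h (2 ^ a))")
        case True
        then show ?thesis using g[of 0] g[of "2 ^ a"] by (simp add: body_def)
      next
        case False
        have "err ?g (bindP (bsearch ?h (f (?h 0)) a 0) (\<lambda>j. Ret (Some (j, ?h j)))) ?Q
            \<le> err ?g (bsearch ?h (f (?h 0)) a 0) (\<lambda>j. j < 0 + 2 ^ a \<and> f (?h j) \<noteq> f (?h (Suc j))) + 0"
        proof (rule err_bind)
          fix j assume j: "j < 0 + 2 ^ a \<and> f (?h j) \<noteq> f (?h (Suc j))"
          have "j \<notin> X"
          proof
            assume "j \<in> X"
            then have "?h j = ?h (Suc j)"
              by (intro cube_eqI[of _ n]) (use x in \<open>auto simp: hybrid_def cube_def Suc_le_eq dest: order.not_eq_order_implies_strict\<close>)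
            then show False using j by simp
          qed
          moreover have "good_entry n f bad \<alpha> blk (j, ?h j)"
            unfolding good_entry_def
          proof (intro conjI bexI[of _ "?h (Suc j)"])
            show "f (?h (Suc j)) \<noteq> f (snd (j, ?h j))" using j by simp
            show "\<forall>c<n. blk c \<noteq> fst (j, ?h j) \<longrightarrow> ?h (Suc j) ! c = snd (j, ?h j) ! c"
              using x by (auto simp: hybrid_def cube_def Suc_le_eq)
            show "avg n (\<lambda>z. of_bool (bad (probe blk (j, ?h j) z))) \<le> \<alpha>"
              using ok(2)[of j] j by (simp add: W_def)
          qed (use x in auto)
          ultimately show "err ?g (Ret (Some (j, ?h j))) ?Q \<le> 0" by simp
        qed simp
        also have "\<dots> = 0"
          using bsearch_complete[of 0 a ?g ?h f "f (?h 0)"] g False by auto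
        finally show ?thesis using g[of 0] g[of "2 ^ a"] False by (simp add: body_def)
      qed
      also have "0 \<le> B x u" by (auto simp: B_def intro!: add_nonneg_nonneg sum_nonneg)
      finally show ?thesis .
    qed
  qed
  have "err ?g (trial n blk a X) ?Q \<le> avg n (\<lambda>x. avg n (B x))"
    unfolding trial_def err.simps body_def[symmetric]
    using body unfolding body_def by (intro avg_mono) simp
  also have "avg n (\<lambda>x. avg n (B x)) = (\<Sum>j\<le>(2::nat) ^ a. avg n (\<lambda>x. of_bool (bad x)))
      + (\<Sum>j<2 ^ a. avg n (\<lambda>v. of_bool (\<not> W j v \<le> \<alpha>)))"
    unfolding B_def avg_add avg_sum
    using avg_hybrid[of "\<lambda>x. of_bool (bad x)"] avg_hybrid[of "\<lambda>v. of_bool (\<not> W _ v \<le> \<alpha>)"]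
    by simp
  also have "\<dots> \<le> (\<Sum>j\<le>(2::nat) ^ a. \<mu>) + (\<Sum>j<(2::nat) ^ a. \<mu> / \<alpha>)"
    by (intro add_mono sum_mono rare W)
  finally show ?thesis by (simp add: add.commute)
qed

text \<open>The blocks of good entries all meet \<open>V\<close>, so at most \<open>K\<close> of
  them are distinct and \<open>K\<close> successful rounds find every relevant block. An earlier
  stop with more than \<delta> unsettled means that \<open>M\<close> trials missed, which has
  probability at most \<open>(1 - \<delta>) ^ M\<close>. The term \<open>M * \<tau>\<close> is paid
  twice per round: for entries that are not good, and for the passage to the total oracle when
  misses are bounded.\<close>

lemma search_complete:
  fixes M K :: nat and V :: "nat set" and \<alpha> \<tau> \<delta> :: real
  assumes blk: "\<And>c. blk c < 2 ^ a" and V: "finite V" "card V \<le> K" "V \<subseteq> {..<n}"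
    and junta: "\<And>x y. x \<in> cube n \<Longrightarrow> y \<in> cube n \<Longrightarrow> (\<And>c. c \<in> V \<Longrightarrow> x ! c = y ! c) \<Longrightarrow> f x = f y"
    and tr: "\<And>X. err (abort_on bad f) (trial n blk a X)
      (\<lambda>r. \<forall>e. r = Some e \<longrightarrow> good_entry n f bad \<alpha> blk e \<and> fst e \<notin> X) \<le> \<tau>"
    and \<delta>: "0 \<le> \<delta>" "\<delta> \<le> 1"
    and st: "\<forall>e\<in>set st. good_entry n f bad \<alpha> blk e" "distinct (map fst st)" "length st + m = K"
  shows "err (abort_on bad f) (search n blk a M m st)
      (\<lambda>st'. (\<forall>e\<in>set st'. good_entry n f bad \<alpha> blk e) \<and> distinct (map fst st')
        \<and> unsettled n f blk (fst ` set st') \<le> \<delta>)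
    \<le> m * (2 * (M * \<tau>) + (1 - \<delta>) ^ M)"
  using st
proof (induction m arbitrary: st)
  case 0
  have sub: "fst ` set st \<subseteq> blk ` V"
  proof safe
    fix i v assume "(i, v) \<in> set st"
    then obtain v' where v': "v \<in> cube n" "v' \<in> cube n" "f v' \<noteq> f v"
        "\<forall>c<n. blk c \<noteq> i \<longrightarrow> v' ! c = v ! c"
      using 0 by (force simp: good_entry_def)
    then obtain c where "c \<in> V" "v' ! c \<noteq> v ! c" using junta by metis
    then show "fst (i, v) \<in> blk ` V" using v' V(3) by auto
  qed
  \<comment> \<open>All \<open>K\<close> rounds succeeded, so there are as many distinct blocks as
    \<open>V\<close> can occupy, and nothing is left unsettled.\<close>
  have "card (fst ` set st) = K" using 0 by (metis add_0_right distinct_card length_map set_map)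
  then have "card (blk ` V) \<le> card (fst ` set st)" using V card_image_le[of V blk] by simp
  then have eq: "fst ` set st = blk ` V" using sub V by (intro card_seteq) auto
  have "f x = f (mix (\<lambda>c. blk c \<in> fst ` set st) x u)" if "x \<in> cube n" for x u
    by (rule junta) (use that V eq in \<open>auto simp: cube_def\<close>)
  then have "unsettled n f blk (fst ` set st) = avg n (\<lambda>x. avg n (\<lambda>u. 0))"
    unfolding unsettled_def by (intro avg_cong) simp
  then show ?case using 0 \<delta> by simp
next
  case (Suc m)
  let ?g = "abort_on bad f" and ?X = "fst ` set st"
  let ?F = "\<lambda>st'. (\<forall>e\<in>set st'. good_entry n f bad \<alpha> blk e) \<and> distinct (map fst st')
        \<and> unsettled n f blk (fst ` set st') \<le> \<delta>"
  let ?G = "\<lambda>r. \<forall>e. r = Some e \<longrightarrow> good_entry n f bad \<alpha> blk e \<and> fst e \<notin> ?X"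
  let ?D = "\<lambda>l. unsettled n f blk ?X \<le> \<delta> \<or> (\<exists>r\<in>set l. r \<noteq> None)"
  have \<tau>: "0 \<le> \<tau>" using err_nonneg tr order_trans by blast
  have g: "?g x = None \<or> ?g x = Some (f x)" for x by (simp add: abort_on_def)
  have 1: "err ?g (rep M (trial n blk a ?X)) (\<lambda>l. \<forall>r\<in>set l. ?G r) \<le> M * \<tau>"
    by (rule order_trans[OF err_rep_ball]) (intro mult_left_mono tr, simp)
  have abort: "err ?g (rep M (trial n blk a ?X)) (\<lambda>_. True) \<le> M * \<tau>"
    by (rule order_trans[OF err_mono 1]) simp
  have 2: "err ?g (rep M (trial n blk a ?X)) ?D \<le> (1 - \<delta>) ^ M + M * \<tau>"
  proof (cases "unsettled n f blk ?X \<le> \<delta>")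
    case True
    then show ?thesis using abort \<delta> by (simp add: add_increasing)
  next
    case False
    have "err ?g (rep M (trial n blk a ?X)) ?D
        \<le> err (exact f) (rep M (trial n blk a ?X)) ?D + err ?g (rep M (trial n blk a ?X)) (\<lambda>_. True)"
      by (rule err_split_total) (rule g)
    also have "err (exact f) (rep M (trial n blk a ?X)) ?D
        \<le> err (exact f) (trial n blk a ?X) (\<lambda>r. r \<noteq> None) ^ M"
      by (rule order_trans[OF err_mono err_rep_ex]) simp
    also have "\<dots> \<le> (1 - \<delta>) ^ M"
      using trial_detects[of blk a f n ?X, OF blk] False
      by (intro power_mono err_nonneg) linarith
    finally show ?thesis using abort by linarith
  qed
  have "err ?g (search n blk a M (Suc m) st) ?F
      \<le> err ?g (rep M (trial n blk a ?X)) (\<lambda>l. (\<forall>r\<in>set l. ?G r) \<and> ?D l)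
        + m * (2 * (M * \<tau>) + (1 - \<delta>) ^ M)"
    unfolding search.simps
  proof (rule err_bind)
    fix l :: "entry option list" assume l: "(\<forall>r\<in>set l. ?G r) \<and> ?D l"
    show "err ?g (if \<exists>e. Some e \<in> set l then search n blk a M m ((SOME e. Some e \<in> set l) # st) else Ret st) ?F
        \<le> m * (2 * (M * \<tau>) + (1 - \<delta>) ^ M)"
    proof (cases "\<exists>e. Some e \<in> set l")
      case True
      define e where "e = (SOME e. Some e \<in> set l)"
      have "Some e \<in> set l" using True unfolding e_def by (rule someI_ex)
      then have "good_entry n f bad \<alpha> blk e" "fst e \<notin> ?X" using l by (metis (no_types, lifting))+
      then have "err ?g (search n blk a M m (e # st)) ?F \<le> m * (2 * (M * \<tau>) + (1 - \<delta>) ^ M)"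
        using Suc.prems by (intro Suc.IH) auto
      then show ?thesis using True by (simp add: e_def)
    next
      case False
      then have "unsettled n f blk ?X \<le> \<delta>" using l by auto
      moreover have "0 \<le> m * (2 * (M * \<tau>) + (1 - \<delta>) ^ M)" using \<tau> \<delta> by simp
      ultimately show ?thesis using False Suc.prems by simp
    qed
  qed (use \<tau> \<delta> in simp)
  also have "err ?g (rep M (trial n blk a ?X)) (\<lambda>l. (\<forall>r\<in>set l. ?G r) \<and> ?D l)
      \<le> 2 * (M * \<tau>) + (1 - \<delta>) ^ M"
    using err_conj[of ?g "rep M (trial n blk a ?X)" "\<lambda>l. \<forall>r\<in>set l. ?G r" ?D] 1 2 by linarith
  finally show ?case by (simp add: algebra_simps)
qed

section \<open>DNF formulas\<close>

definition evald :: "literal set set \<Rightarrow> bool list \<Rightarrow> bool" where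
  "evald h x \<longleftrightarrow> (\<exists>t\<in>h. satisfies x t)"

definition dnfs :: "nat \<Rightarrow> nat \<Rightarrow> nat \<Rightarrow> literal set set set" where
  "dnfs q L s = {h. h \<subseteq> {t. t \<subseteq> {..<q} \<times> UNIV \<and> card t \<le> L} \<and> card h \<le> s}"

text \<open>Subsets are read off from lists of length \<open>m\<close> over \<open>S\<close> and a
  padding symbol \<open>None\<close>.\<close>

lemma card_small_subsets:
  assumes "finite S"
  shows "finite {A. A \<subseteq> S \<and> card A \<le> m}" "card {A. A \<subseteq> S \<and> card A \<le> m} \<le> (card S + 1) ^ m"
proof -
  let ?L = "{l. set l \<subseteq> insert None (Some ` S) \<and> length l = m}"
  have fin: "finite ?L" by (rule finite_lists_length_eq) (use assms in simp)
  have "card ?L = (card S + 1) ^ m"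
    by (subst card_lists_length_eq) (use assms in \<open>auto simp: card_image card_insert_if\<close>)
  moreover have sub: "{A. A \<subseteq> S \<and> card A \<le> m} \<subseteq> (\<lambda>l. {a. Some a \<in> set l}) ` ?L"
  proof
    fix A assume "A \<in> {A. A \<subseteq> S \<and> card A \<le> m}"
    then have A: "A \<subseteq> S" "card A \<le> m" by auto
    then obtain xs where xs: "set xs = A" "length xs = card A"
      using assms finite_subset finite_distinct_list distinct_card by metis
    let ?l = "map Some xs @ replicate (m - card A) None"
    have "?l \<in> ?L" "A = {a. Some a \<in> set ?l}" using A xs by auto
    then show "A \<in> (\<lambda>l. {a. Some a \<in> set l}) ` ?L" by blast
  qed
  ultimately show "card {A. A \<subseteq> S \<and> card A \<le> m} \<le> (card S + 1) ^ m"
    using surj_card_le[OF fin sub] by simp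
  show "finite {A. A \<subseteq> S \<and> card A \<le> m}" using assms by simp
qed

lemma dnfs_bound:
  "finite (dnfs q L s)" "card (dnfs q L s) \<le> ((2 * q + 1) ^ L + 1) ^ s"
proof -
  let ?T = "{t. t \<subseteq> {..<q} \<times> (UNIV :: bool set) \<and> card t \<le> L}"
  have T: "finite ?T" "card ?T \<le> (2 * q + 1) ^ L"
    using card_small_subsets[of "{..<q} \<times> (UNIV :: bool set)" L]
    by (simp_all add: card_cartesian_product mult.commute)
  show "finite (dnfs q L s)" unfolding dnfs_def by (rule card_small_subsets) (rule T)
  have "card (dnfs q L s) \<le> (card ?T + 1) ^ s"
    unfolding dnfs_def by (rule card_small_subsets) (rule T)
  also have "\<dots> \<le> ((2 * q + 1) ^ L + 1) ^ s" using T by (intro power_mono) auto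
  finally show "card (dnfs q L s) \<le> ((2 * q + 1) ^ L + 1) ^ s" .
qed

text \<open>
  Substituting for each literal a conjunction of literals, with \<open>None\<close> for the constant false.
\<close>

definition subst_dnf :: "(literal \<Rightarrow> literal set option) \<Rightarrow> literal set set \<Rightarrow> literal set set" where
  "subst_dnf u h = (\<lambda>t. \<Union>l\<in>t. the (u l)) ` {t \<in> h. \<forall>l\<in>t. u l \<noteq> None}"

lemma evald_subst:
  assumes "\<And>t c b. t \<in> h \<Longrightarrow> (c, b) \<in> t \<Longrightarrow>
    y ! c = b \<longleftrightarrow> (\<exists>S. u (c, b) = Some S \<and> satisfies x S)"
  shows "evald (subst_dnf u h) x = evald h y"
proof -
  have "satisfies y t \<longleftrightarrow> (\<forall>l\<in>t. u l \<noteq> None) \<and> satisfies x (\<Union>l\<in>t. the (u l))" if "t \<in> h" for t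
  proof -
    have "satisfies y t \<longleftrightarrow> (\<forall>l\<in>t. \<exists>S. u l = Some S \<and> satisfies x S)"
      unfolding satisfies_def[of y] using assms[OF that] by fastforce
    also have "\<dots> \<longleftrightarrow> (\<forall>l\<in>t. u l \<noteq> None \<and> satisfies x (the (u l)))"
      by (intro ball_cong) auto
    also have "\<dots> \<longleftrightarrow> (\<forall>l\<in>t. u l \<noteq> None) \<and> satisfies x (\<Union>l\<in>t. the (u l))"
      unfolding satisfies_def by blast
    finally show ?thesis .
  qed
  then show ?thesis unfolding evald_def subst_dnf_def by auto
qed

lemma subst_dnf_terms:
  assumes "\<And>t l S. t \<in> h \<Longrightarrow> l \<in> t \<Longrightarrow> u l = Some S \<Longrightarrow> S \<subseteq> N" "t' \<in> subst_dnf u h"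
  shows "t' \<subseteq> N"
  using assms unfolding subst_dnf_def by fastforce

lemma card_subst_dnf: "finite h \<Longrightarrow> card (subst_dnf u h) \<le> card h"
  unfolding subst_dnf_def
  by (rule order_trans[OF card_image_le card_mono]) auto

lemma card_subst_dnf_term:
  assumes "\<And>t. t \<in> h \<Longrightarrow> finite t \<and> card t \<le> L"
    and "\<And>t l S. t \<in> h \<Longrightarrow> l \<in> t \<Longrightarrow> u l = Some S \<Longrightarrow> card S \<le> 1" "t' \<in> subst_dnf u h"
  shows "card t' \<le> L"
proof -
  obtain t where t: "t \<in> h" "\<forall>l\<in>t. u l \<noteq> None" "t' = (\<Union>l\<in>t. the (u l))"
    using assms(3) by (auto simp: subst_dnf_def)
  have "card t' \<le> (\<Sum>l\<in>t. card (the (u l)))"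
    unfolding t(3) by (rule card_UN_le) (use assms(1) t in auto)
  also have "\<dots> \<le> (\<Sum>l\<in>t. 1)" proof (rule sum_mono)
    fix l assume l: "l \<in> t"
    then obtain S where "u l = Some S" using t(2) by blast
    then show "card (the (u l)) \<le> 1" using assms(2)[OF t(1) l] by simp
  qed
  finally show ?thesis using assms(1)[OF t(1)] by simp
qed

lemma term_dnfI:
  assumes "finite h" "card h \<le> s" "\<And>t. t \<in> h \<Longrightarrow> t \<subseteq> {..<n} \<times> UNIV"
    and "\<And>x. x \<in> cube n \<Longrightarrow> g x = evald h x"
  shows "g \<in> term_dnf n s"
  unfolding term_dnf_def mem_Collect_eq
  by (intro exI[of _ h]) (use assms in \<open>simp add: evald_def\<close>)

text \<open>Each new literal halves the satisfying set, by flipping its variable. This is only an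
  inequality because a term may contain a variable together with its negation.\<close>

lemma avg_satisfies:
  assumes "finite t" "t \<subseteq> {..<n} \<times> UNIV"
  shows "avg n (\<lambda>x. of_bool (satisfies x t)) \<le> 1 / 2 ^ card t"
  using assms
proof (induction t rule: finite_induct)
  case empty
  show ?case by (simp add: avg_le)
next
  case (insert l t)
  obtain i b where l: "l = (i, b)" by force
  then have i: "i < n" using insert.prems by auto
  have t: "t \<subseteq> {..<n} \<times> UNIV" using insert.prems by auto
  let ?G = "\<lambda>x. of_bool (x ! i = b \<and> satisfies x t) :: real"
  let ?G' = "\<lambda>x. of_bool (x ! i \<noteq> b \<and> satisfies x t) :: real"
  have eq: "avg n (\<lambda>x. of_bool (satisfies x (insert l t))) = avg n ?G"
    by (rule avg_cong) (simp add: satisfies_def l)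
  show ?case
  proof (cases "(i, \<not> b) \<in> t")
    case True
    then have "avg n ?G = avg n (\<lambda>_. 0)"
      by (intro avg_cong) (auto simp: satisfies_def)
    then show ?thesis unfolding eq by simp
  next
    case False
    define e where "e = map (\<lambda>d. d = i) [0..<n]"
    have e: "e \<in> cube n" by (simp add: e_def cube_def)
    have nth: "vxor x e ! d = (x ! d \<noteq> (d = i))" if "x \<in> cube n" "d < n" for x d
      using that by (simp add: e_def cube_def)
    have ne: "fst l' \<noteq> i" "fst l' < n" if "l' \<in> t" for l'
    proof -
      show "fst l' < n" using t that by auto
      show "fst l' \<noteq> i"
      proof
        assume "fst l' = i"
        then have "l' = (i, b) \<or> l' = (i, \<not> b)" by (cases l') auto
        then show False using that False insert.hyps(2) l by auto
      qed
    qed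
    have sat: "satisfies (vxor x e) t = satisfies x t" if "x \<in> cube n" for x
    proof -
      have "vxor x e ! fst l' = x ! fst l'" if "l' \<in> t" for l'
        using nth[OF \<open>x \<in> cube n\<close> ne(2)[OF that]] ne(1)[OF that] by simp
      then show ?thesis unfolding satisfies_def by (intro ball_cong) auto
    qed
    have "avg n ?G = avg n (\<lambda>x. ?G (vxor x e))" by (rule avg_vxor[OF e, symmetric])
    also have "\<dots> = avg n ?G'"
      by (rule avg_cong) (use nth i sat in auto)
    finally have "2 * avg n ?G = avg n (\<lambda>x. ?G x + ?G' x)" by (simp add: avg_add)
    also have "\<dots> = avg n (\<lambda>x. of_bool (satisfies x t))" by (rule avg_cong) auto
    also have "\<dots> \<le> 1 / 2 ^ card t" using insert.IH t by simp
    finally show ?thesis unfolding eq using insert.hyps by (simp add: field_simps)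
  qed
qed

lemma avg_long_terms:
  assumes "finite h" "card h \<le> s" "\<And>t. t \<in> h \<Longrightarrow> t \<subseteq> {..<n} \<times> UNIV"
  shows "avg n (\<lambda>x. of_bool (evald h x \<noteq> evald {t \<in> h. card t \<le> L} x)) \<le> real s / 2 ^ L"
proof -
  let ?H = "{t \<in> h. L < card t}"
  have "avg n (\<lambda>x. of_bool (evald h x \<noteq> evald {t \<in> h. card t \<le> L} x))
      \<le> avg n (\<lambda>x. \<Sum>t\<in>?H. of_bool (satisfies x t))"
  proof (rule avg_mono)
    fix x
    show "of_bool (evald h x \<noteq> evald {t \<in> h. card t \<le> L} x)
        \<le> (\<Sum>t\<in>?H. of_bool (satisfies x t) :: real)"
    proof (cases "\<exists>t\<in>?H. satisfies x t")
      case True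
      then obtain t where "t \<in> ?H" "satisfies x t" by blast
      then have "1 \<le> (\<Sum>t\<in>?H. of_bool (satisfies x t) :: real)"
        using member_le_sum[of t ?H "\<lambda>t. of_bool (satisfies x t) :: real"] assms(1) by simp
      then show ?thesis by (auto simp: of_bool_def)
    next
      case False
      then have "evald h x = evald {t \<in> h. card t \<le> L} x"
        unfolding evald_def using leI by blast
      then show ?thesis by (simp add: sum_nonneg)
    qed
  qed
  also have "\<dots> = (\<Sum>t\<in>?H. avg n (\<lambda>x. of_bool (satisfies x t)))" by (rule avg_sum)
  also have "\<dots> \<le> (\<Sum>t\<in>?H. 1 / 2 ^ L)"
  proof (rule sum_mono)
    fix t assume t: "t \<in> ?H"
    have "avg n (\<lambda>x. of_bool (satisfies x t)) \<le> 1 / 2 ^ card t"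
      using assms(3)[of t] t finite_subset by (intro avg_satisfies) (auto intro: card_ge_0_finite)
    also have "\<dots> \<le> 1 / 2 ^ L"
      using t by (intro divide_left_mono power_increasing) auto
    finally show "avg n (\<lambda>x. of_bool (satisfies x t)) \<le> 1 / 2 ^ L" .
  qed
  also have "\<dots> = real (card ?H) / 2 ^ L" by simp
  also have "\<dots> \<le> real s / 2 ^ L"
    using assms card_mono[of h ?H] by (intro divide_right_mono) auto
  finally show ?thesis .
qed

section \<open>The tester\<close>

text \<open>
  Block \<open>is ! i\<close> is shifted by \<open>b ! i\<close>. As \<open>w\<close> is uniform, so is the shifted string, and yet
  all samples have known relevant coordinates relative to those of \<open>w\<close>.
\<close>

definition block_mask :: "nat \<Rightarrow> (nat \<Rightarrow> nat) \<Rightarrow> nat list \<Rightarrow> bool list \<Rightarrow> bool list" where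
  "block_mask n blk is b = map (\<lambda>c. \<exists>i<length is. is ! i = blk c \<and> b ! i) [0..<n]"

definition sample :: "nat \<Rightarrow> (nat \<Rightarrow> nat) \<Rightarrow> nat list \<Rightarrow> bool list \<Rightarrow> (bool list \<times> bool) prog" where
  "sample n blk is w = Rnd (length is) (\<lambda>b. Ask (vxor w (block_mask n blk is b)) (\<lambda>c. Ret (b, c)))"

text \<open>The default \<open>{}\<close> is the constant false, so that the result is a DNF of the
  class even when the examples are inconsistent; soundness relies on this.\<close>

definition hypothesis :: "nat \<Rightarrow> nat \<Rightarrow> nat \<Rightarrow> (bool list \<times> bool) list \<Rightarrow> literal set set" where
  "hypothesis q L s S =
     (if \<exists>h\<in>dnfs q L s. \<forall>(b, c)\<in>set S. c = evald h b
      then SOME h. h \<in> dnfs q L s \<and> (\<forall>(b, c)\<in>set S. c = evald h b) else {})"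

text \<open>Variable \<open>i\<close> of the hypothesis stands for the coordinate found by entry
  \<open>i\<close>, taken relative to \<open>w\<close>. Hence \<open>vxor x w\<close> is decoded,
  not \<open>x\<close>.\<close>

definition final_test ::
    "nat \<Rightarrow> nat \<Rightarrow> (nat \<Rightarrow> nat) \<Rightarrow> entry list \<Rightarrow> bool list \<Rightarrow> literal set set \<Rightarrow> bool prog" where
  "final_test n t blk st w h = Rnd n (\<lambda>x. Ask x (\<lambda>c.
     bindP (mapM (\<lambda>e. decode n t (probe blk e) (vxor x w)) st) (\<lambda>l.
       Ret ((\<forall>r\<in>set l. fst r) \<and> c = evald h (map snd l)))))"

definition verify ::
    "nat \<Rightarrow> nat \<Rightarrow> nat \<Rightarrow> nat \<Rightarrow> nat \<Rightarrow> nat \<Rightarrow> (nat \<Rightarrow> nat) \<Rightarrow> entry list \<Rightarrow> bool list \<Rightarrow> bool list prog" where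
  "verify n s L t m T blk st w =
     bindP (rep m (sample n blk (map fst st) w)) (\<lambda>S.
       rep T (final_test n t blk st w (hypothesis (length st) L s S)))"

text \<open>Roles of the parameters: terms are cut at \<open>L\<close> literals, \<open>K\<close>
  bounds the number of relevant variables, there are \<open>2 ^ a\<close> blocks, \<open>M\<close>
  trials per search round, \<open>t\<close> votes per decoding, \<open>m\<close> examples and
  \<open>T\<close> final comparisons.\<close>

definition dnf_tester ::
    "nat \<Rightarrow> nat \<Rightarrow> nat \<Rightarrow> nat \<Rightarrow> nat \<Rightarrow> nat \<Rightarrow> nat \<Rightarrow> nat \<Rightarrow> nat \<Rightarrow> bool prog" where
  "dnf_tester n s L K a M t m T =
     bindP (partition_prog n a (\<lambda>_. 0)) (\<lambda>blk. bindP (search n blk a M K []) (\<lambda>st.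
     bindP (mapM (\<lambda>e. block_test n t (probe blk e)) st) (\<lambda>oks. Rnd n (\<lambda>w.
     bindP (verify n s L t m T blk st w) (\<lambda>rs. Ret ((\<forall>r\<in>set oks. r) \<and> (\<forall>r\<in>set rs. r)))))))"

lemma block_mask_cube [simp]: "block_mask n blk is b \<in> cube n"
  by (simp add: block_mask_def cube_def)

lemma hypothesis_dnfs: "hypothesis q L s S \<in> dnfs q L s"
proof (cases "\<exists>h\<in>dnfs q L s. \<forall>(b, c)\<in>set S. c = evald h b")
  case True
  then have "\<exists>h. h \<in> dnfs q L s \<and> (\<forall>(b, c)\<in>set S. c = evald h b)" by blast
  from someI_ex[OF this] show ?thesis using True by (simp add: hypothesis_def)
qed (auto simp: hypothesis_def dnfs_def)

lemma hypothesis_consistent: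
  assumes "h \<in> dnfs q L s" "\<forall>(b, c)\<in>set S. c = evald h b"
  shows "\<forall>(b, c)\<in>set S. c = evald (hypothesis q L s S) b"
proof -
  have "\<exists>h. h \<in> dnfs q L s \<and> (\<forall>(b, c)\<in>set S. c = evald h b)" using assms by blast
  from someI_ex[OF this] show ?thesis using assms by (auto simp: hypothesis_def)
qed

lemma spec_sample: "w \<in> cube n \<Longrightarrow> spec n (sample n blk is w) 1 (\<lambda>_. True)"
  by (simp add: sample_def)

lemma spec_final_test:
  assumes st: "\<forall>e\<in>set st. snd e \<in> cube n" and w: "w \<in> cube n" and K: "length st \<le> K"
  shows "spec n (final_test n t blk st w h) (1 + K * (2 * t)) (\<lambda>_. True)"
proof -
  have "spec n (bindP (mapM (\<lambda>e. decode n t (probe blk e) (vxor x w)) st) (\<lambda>l.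
       Ret ((\<forall>r\<in>set l. fst r) \<and> c = evald h (map snd l)))) (length st * (2 * t) + 0) (\<lambda>_. True)"
    if "x \<in> cube n" for x c
    by (rule spec_bind[OF spec_mapM[where P = "\<lambda>_ _. True"]])
      (use st w that in \<open>auto intro!: spec_decode\<close>)
  then have "spec n (bindP (mapM (\<lambda>e. decode n t (probe blk e) (vxor x w)) st) (\<lambda>l.
       Ret ((\<forall>r\<in>set l. fst r) \<and> c = evald h (map snd l)))) (K * (2 * t)) (\<lambda>_. True)"
    if "x \<in> cube n" for x c
    using K by (intro spec_mono[OF _ _ TrueI]) (use that in auto)
  then show ?thesis by (simp add: final_test_def)
qed

lemma spec_verify:
  assumes st: "\<forall>e\<in>set st. snd e \<in> cube n" and w: "w \<in> cube n" and K: "length st \<le> K"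
  shows "spec n (verify n s L t m T blk st w) (m + T * (1 + K * (2 * t))) (\<lambda>_. True)"
proof -
  have "spec n (verify n s L t m T blk st w) (m * 1 + T * (1 + K * (2 * t))) (\<lambda>_. True)"
    unfolding verify_def
    by (rule spec_bind[OF spec_rep[OF spec_sample[OF w]]],
        rule spec_mono[OF spec_rep[OF spec_final_test[OF st w K]]]) auto
  then show ?thesis by simp
qed

lemma spec_dnf_tester:
  "spec n (dnf_tester n s L K a M t m T)
    (K * (M * (2 + a)) + (K * (28 + 54 * t) + (m + T * (1 + K * (2 * t))))) (\<lambda>_. True)"
proof -
  let ?V = "m + T * (1 + K * (2 * t))"
  have "spec n (dnf_tester n s L K a M t m T)
      (0 + (K * (M * (2 + a)) + (K * (28 + 54 * t) + (?V + 0)))) (\<lambda>_. True)"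
    unfolding dnf_tester_def
  proof (rule spec_bind[where P = "\<lambda>_. True"])
    show "spec n (partition_prog n a (\<lambda>_. 0)) 0 (\<lambda>_. True)"
      by (rule spec_mono[OF spec_partition[of _ 0]]) auto
    fix blk :: "nat \<Rightarrow> nat"
    show "spec n (bindP (search n blk a M K []) (\<lambda>st.
        bindP (mapM (\<lambda>e. block_test n t (probe blk e)) st) (\<lambda>oks. Rnd n (\<lambda>w.
        bindP (verify n s L t m T blk st w) (\<lambda>rs. Ret ((\<forall>r\<in>set oks. r) \<and> (\<forall>r\<in>set rs. r)))))))
        (K * (M * (2 + a)) + (K * (28 + 54 * t) + (?V + 0))) (\<lambda>_. True)"
    proof (rule spec_bind[OF spec_search])
      fix st :: "entry list"
      assume "length st \<le> length ([] :: entry list) + K \<and> (\<forall>e\<in>set st. snd e \<in> cube n)"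
      then have st: "length st \<le> K" "\<forall>e\<in>set st. snd e \<in> cube n" by auto
      have "spec n (mapM (\<lambda>e. block_test n t (probe blk e)) st) (length st * (28 + 54 * t))
          (list_all2 (\<lambda>_ _. True) st)"
        by (rule spec_mapM) (use st in \<open>auto intro!: spec_block_test\<close>)
      then have "spec n (mapM (\<lambda>e. block_test n t (probe blk e)) st) (K * (28 + 54 * t)) (\<lambda>_. True)"
        by (rule spec_mono) (use st in auto)
      then show "spec n (bindP (mapM (\<lambda>e. block_test n t (probe blk e)) st) (\<lambda>oks. Rnd n (\<lambda>w.
          bindP (verify n s L t m T blk st w) (\<lambda>rs. Ret ((\<forall>r\<in>set oks. r) \<and> (\<forall>r\<in>set rs. r))))))
          (K * (28 + 54 * t) + (?V + 0)) (\<lambda>_. True)"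
      proof (rule spec_bind)
        fix oks :: "bool list"
        have "spec n (bindP (verify n s L t m T blk st w) (\<lambda>rs. Ret ((\<forall>r\<in>set oks. r) \<and> (\<forall>r\<in>set rs. r))))
            (?V + 0) (\<lambda>_. True)" if "w \<in> cube n" for w
          by (rule spec_bind[OF spec_verify[OF st(2) that st(1)]]) simp
        then show "spec n (Rnd n (\<lambda>w. bindP (verify n s L t m T blk st w)
            (\<lambda>rs. Ret ((\<forall>r\<in>set oks. r) \<and> (\<forall>r\<in>set rs. r))))) (?V + 0) (\<lambda>_. True)"
          by simp
      qed
    qed simp
  qed
  then show ?thesis by simp
qed

section \<open>Soundness\<close>

text \<open>The function \<open>g\<close> composes the hypothesis with the decoded coordinates.
  Substituting literals and constants does not increase the number of terms, so \<open>g\<close> is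
  an \<open>s\<close>-term DNF and \<open>f\<close> differs from it with probability at least
  \<epsilon>. At such a point acceptance needs a unanimous wrong decoding for one of at most
  \<open>K\<close> entries.\<close>

lemma final_test_sound:
  assumes st: "length st \<le> K" and w: "w \<in> cube n" and h: "h \<in> dnfs (length st) L s"
    and D: "\<And>e. e \<in> set st \<Longrightarrow> (\<forall>x\<in>cube n. \<not> D e x) \<or> (\<exists>c<n. \<forall>x\<in>cube n. D e x = x ! c)"
    and maj: "\<And>e x. e \<in> set st \<Longrightarrow>
      err (exact f) (decode1 n (probe blk e) x) (\<lambda>a. a = D e x) \<le> 1 / 2"
    and far: "far n \<epsilon> (term_dnf n s) f"
  shows "err (exact f) (final_test n t blk st w h) (\<lambda>r. \<not> r) \<le> 1 - \<epsilon> + real K * (1 / 2) ^ t"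
proof -
  let ?q = "length st"
  define val where "val x = map (\<lambda>e. D e (vxor x w)) st" for x
  define g where "g x = evald h (val x)" for x
  define zero where "zero i \<longleftrightarrow> (\<forall>x\<in>cube n. \<not> D (st ! i) x)" for i
  define co where "co i = (SOME c. c < n \<and> (\<forall>x\<in>cube n. D (st ! i) x = x ! c))" for i
  have co: "co i < n" "\<And>x. x \<in> cube n \<Longrightarrow> D (st ! i) x = x ! co i" if "i < ?q" "\<not> zero i" for i
    using someI_ex[of "\<lambda>c. c < n \<and> (\<forall>x\<in>cube n. D (st ! i) x = x ! c)"] D[of "st ! i"] that
    unfolding zero_def co_def by auto
  \<comment> \<open>Variable \<open>i\<close> has the value
    \<open>x ! co i \<noteq> w ! co i\<close>, or is false if the decoded function is zero. In the
    latter case the negative literal becomes true, the empty conjunction \<open>Some {}\<close>, and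
    the positive one false, \<open>None\<close>.\<close>
  define u where "u = (\<lambda>(i, b). if zero i then (if b then None else Some {})
      else Some {(co i, b \<noteq> w ! co i)})"
  have hq: "fst l < ?q" if "t \<in> h" "l \<in> t" for t l
    using h that by (fastforce simp: dnfs_def)
  have g: "g \<in> term_dnf n s"
  proof (rule term_dnfI)
    have fin: "finite h" using h finite_subset[of h "Pow ({..<?q} \<times> UNIV)"] by (auto simp: dnfs_def)
    then show "finite (subst_dnf u h)" by (simp add: subst_dnf_def)
    show "card (subst_dnf u h) \<le> s"
      using card_subst_dnf[OF fin, of u] h by (simp add: dnfs_def)
    show "t \<subseteq> {..<n} \<times> UNIV" if "t \<in> subst_dnf u h" for t
    proof (rule subst_dnf_terms[OF _ that])
      fix t l S assume l: "t \<in> h" "l \<in> t" "u l = Some S"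
      obtain i b where ib: "l = (i, b)" by force
      then have "i < ?q" using hq[OF l(1,2)] by simp
      then show "S \<subseteq> {..<n} \<times> UNIV"
        using l(3) co(1)[of i] by (auto simp: u_def ib split: if_splits)
    qed
    fix x assume x: "x \<in> cube n"
    have "evald (subst_dnf u h) x = evald h (val x)"
    proof (rule evald_subst)
      fix t c b assume "t \<in> h" "(c, b) \<in> t"
      then have c: "c < ?q" using hq by fastforce
      have v: "val x ! c = D (st ! c) (vxor x w)" using c by (simp add: val_def)
      show "val x ! c = b \<longleftrightarrow> (\<exists>S. u (c, b) = Some S \<and> satisfies x S)"
      proof (cases "zero c")
        case True
        then have "\<not> val x ! c" using v x w by (simp add: zero_def)
        then show ?thesis using True by (auto simp: u_def satisfies_def)
      next
        case False
        then have "val x ! c = (x ! co c \<noteq> w ! co c)"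
          using v co[OF c False] x w by (simp add: cube_def)
        then show ?thesis using False by (auto simp: u_def satisfies_def)
      qed
    qed
    then show "g x = evald (subst_dnf u h) x" by (simp add: g_def)
  qed
  have dist: "\<epsilon> \<le> avg n (\<lambda>x. of_bool (f x \<noteq> g x))"
    using far g unfolding far_def prob_cube by blast
  define body where "body x = bindP (mapM (\<lambda>e. decode n t (probe blk e) (vxor x w)) st) (\<lambda>l.
       Ret ((\<forall>r\<in>set l. fst r) \<and> f x = evald h (map snd l)))" for x
  have "err (exact f) (body x) (\<lambda>r. \<not> r) \<le> 1 - of_bool (f x \<noteq> g x) + real K * (1 / 2) ^ t" for x
  proof (cases "f x = g x")
    case True
    then show ?thesis using err_le_1[of "exact f" "body x" "\<lambda>r. \<not> r"] by (simp add: add_increasing2)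
  next
    case False
    let ?P = "\<lambda>e r. fst r \<longrightarrow> snd r = D e (vxor x w)"
    have "err (exact f) (body x) (\<lambda>r. \<not> r)
        \<le> err (exact f) (mapM (\<lambda>e. decode n t (probe blk e) (vxor x w)) st) (list_all2 ?P st) + 0"
      unfolding body_def
    proof (rule err_bind)
      fix l :: "(bool \<times> bool) list" assume l: "list_all2 ?P st l"
      have "map snd l = val x" if "\<forall>r\<in>set l. fst r"
        unfolding val_def using l that by (induction st l rule: list_all2_induct) auto
      then show "err (exact f) (Ret ((\<forall>r\<in>set l. fst r) \<and> f x = evald h (map snd l))) (\<lambda>r. \<not> r) \<le> 0"
        using False by (auto simp: g_def)
    qed simp
    also have "\<dots> \<le> (\<Sum>e\<leftarrow>st. err (exact f) (decode n t (probe blk e) (vxor x w)) (?P e))"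
      using err_mapM[of "exact f" "\<lambda>e. decode n t (probe blk e) (vxor x w)" st ?P] by simp
    also have "\<dots> \<le> (\<Sum>e\<leftarrow>st. (1 / 2) ^ t)"
      by (rule sum_list_mono) (rule decode_sound, rule maj)
    also have "\<dots> \<le> real K * (1 / 2) ^ t"
      using st by (simp add: sum_list_triv mult_right_mono)
    finally show ?thesis using False by simp
  qed
  then have "err (exact f) (final_test n t blk st w h) (\<lambda>r. \<not> r)
      \<le> avg n (\<lambda>x. 1 - of_bool (f x \<noteq> g x) + real K * (1 / 2) ^ t)"
    unfolding final_test_def err.simps option.case body_def[symmetric] by (rule avg_mono)
  also have "\<dots> \<le> 1 - \<epsilon> + real K * (1 / 2) ^ t"
    using dist by (simp add: avg_add avg_diff)
  finally show ?thesis .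
qed

text \<open>The argument covers every entry list of length at most \<open>K\<close> and every
  sample. Either some block test accepts with probability at most 1/3, which suffices, or all blocks
  have decoders and each of the \<open>T\<close> final comparisons accepts with probability at most
  \<open>1 - \<epsilon> / 2\<close>.\<close>

lemma dnf_tester_sound:
  assumes far: "far n \<epsilon> (term_dnf n s) f"
    and t: "5 \<le> t" "real K * (1 / 2) ^ t \<le> \<epsilon> / 2" and T: "(1 - \<epsilon> / 2) ^ T \<le> 1 / 3"
  shows "err (exact f) (dnf_tester n s L K a M t m T) (\<lambda>r. \<not> r) \<le> 1 / 3"
  unfolding dnf_tester_def
proof (rule err_bind_total)
  fix blk :: "nat \<Rightarrow> nat"
  define rest where "rest = (\<lambda>st oks. Rnd n (\<lambda>w. bindP (verify n s L t m T blk st w)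
      (\<lambda>rs. Ret ((\<forall>r\<in>set oks. r) \<and> (\<forall>r\<in>set rs. r)))))"
  let ?tests = "\<lambda>st. mapM (\<lambda>e. block_test n t (probe blk e)) st"
  have main: "err (exact f) (bindP (?tests st) (rest st)) (\<lambda>r. \<not> r) \<le> 1 / 3"
    if st: "length st \<le> K" for st
  proof (cases "\<exists>e\<in>set st. err (exact f) (block_test n t (probe blk e)) (\<lambda>r. \<not> r) \<le> 1 / 3")
    case True
    then obtain e where e: "e \<in> set st"
      "err (exact f) (block_test n t (probe blk e)) (\<lambda>r. \<not> r) \<le> 1 / 3" by blast
    have "err (exact f) (bindP (?tests st) (rest st)) (\<lambda>r. \<not> r)
        \<le> err (exact f) (?tests st) (\<lambda>l. \<exists>a\<in>set l. \<not> a) + 0"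
    proof (rule err_bind)
      fix oks :: "bool list" assume oks: "\<exists>a\<in>set oks. \<not> a"
      have "err (exact f) (bindP (verify n s L t m T blk st w)
          (\<lambda>rs. Ret ((\<forall>r\<in>set oks. r) \<and> (\<forall>r\<in>set rs. r)))) (\<lambda>r. \<not> r) \<le> 0" for w
        by (rule err_bind_total) (use oks in auto)
      then show "err (exact f) (rest st oks) (\<lambda>r. \<not> r) \<le> 0"
        unfolding rest_def err.simps by (intro avg_le)
    qed simp
    also have "\<dots> \<le> 1 / 3"
      using err_mapM_member[OF e(1), of f "\<lambda>e. block_test n t (probe blk e)" "\<lambda>a. \<not> a"] e(2) by simp
    finally show ?thesis .
  next
    case False
    have "\<exists>D. ((\<forall>x\<in>cube n. \<not> D x) \<or> (\<exists>c<n. \<forall>x\<in>cube n. D x = x ! c)) \<and>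
        (\<forall>x. err (exact f) (decode1 n (probe blk e) x) (\<lambda>a. a = D x) \<le> 1 / 2)" if "e \<in> set st" for e
      using block_test_sound[of f n t "probe blk e"] False that t(1) by (metis not_le)
    then obtain D where D: "\<And>e. e \<in> set st \<Longrightarrow>
          (\<forall>x\<in>cube n. \<not> D e x) \<or> (\<exists>c<n. \<forall>x\<in>cube n. D e x = x ! c)"
        "\<And>e x. e \<in> set st \<Longrightarrow>
          err (exact f) (decode1 n (probe blk e) x) (\<lambda>a. a = D e x) \<le> 1 / 2"
      by metis
    have final: "err (exact f) (final_test n t blk st w (hypothesis (length st) L s S)) (\<lambda>r. \<not> r)
        \<le> 1 - \<epsilon> / 2" if w: "w \<in> cube n" for w S
      using final_test_sound[OF st w hypothesis_dnfs D far, where t = t] t(2) by (smt (verit) field_sum_of_halves)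
    have "err (exact f) (verify n s L t m T blk st w) (\<lambda>rs. \<exists>r\<in>set rs. \<not> r) \<le> 1 / 3"
      if w: "w \<in> cube n" for w
      unfolding verify_def
    proof (rule err_bind_total)
      fix S
      show "err (exact f) (rep T (final_test n t blk st w (hypothesis (length st) L s S)))
          (\<lambda>rs. \<exists>r\<in>set rs. \<not> r) \<le> 1 / 3"
        by (rule order_trans[OF err_rep_ex order_trans[OF power_mono[OF final[OF w] err_nonneg] T]])
    qed simp
    then have "err (exact f) (bindP (verify n s L t m T blk st w)
          (\<lambda>rs. Ret ((\<forall>r\<in>set oks. r) \<and> (\<forall>r\<in>set rs. r)))) (\<lambda>r. \<not> r) \<le> 1 / 3 + 0"
      if "w \<in> cube n" for w oks
      using that
      by (intro order_trans[OF err_bind[where d = 0 and P = "\<lambda>rs. \<exists>r\<in>set rs. \<not> r"]] add_right_mono) auto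
    then have "err (exact f) (rest st oks) (\<lambda>r. \<not> r) \<le> 1 / 3" for oks
      unfolding rest_def err.simps by (intro avg_le) simp
    then show ?thesis by (rule err_bind_total) simp
  qed
  have "err (exact f) (bindP (search n blk a M K []) (\<lambda>st. bindP (?tests st) (rest st))) (\<lambda>r. \<not> r)
      \<le> err (exact f) (search n blk a M K []) (\<lambda>_. True) + 1 / 3"
    by (rule err_bind_spec[OF spec_search]) (use main in auto)
  then show "err (exact f) (bindP (search n blk a M K []) (\<lambda>st. bindP (?tests st) (\<lambda>oks.
      Rnd n (\<lambda>w. bindP (verify n s L t m T blk st w)
        (\<lambda>rs. Ret ((\<forall>r\<in>set oks. r) \<and> (\<forall>r\<in>set rs. r))))))) (\<lambda>r. \<not> r) \<le> 1 / 3"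
    unfolding rest_def by simp
qed simp

section \<open>Completeness\<close>

text \<open>Occam's razor: a hypothesis more than \<delta> away from \<open>hs\<close> agrees with
  all \<open>m\<close> examples with probability at most \<open>(1 - \<delta>) ^ m\<close>, and a
  union bound over \<open>H\<close> follows. Aborts are counted twice, once for consistency of the
  examples with \<open>hs\<close> and once for the passage to the total oracle.\<close>

lemma learning_complete:
  fixes \<delta> :: real
  assumes H: "finite H" "hs \<in> H" and w: "w \<in> cube n"
    and hs: "\<And>b. b \<in> cube (length is) \<Longrightarrow> f (vxor w (block_mask n blk is b)) = evald hs b"
    and \<delta>: "0 \<le> \<delta>" "\<delta> \<le> 1"
  shows "err (abort_on bad f) (rep m (sample n blk is w)) (\<lambda>S. (\<forall>(b, c)\<in>set S. c = evald hs b) \<and>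
      (\<forall>h\<in>H. (\<forall>(b, c)\<in>set S. c = evald h b) \<longrightarrow>
        avg (length is) (\<lambda>b. of_bool (evald h b \<noteq> evald hs b)) \<le> \<delta>))
    \<le> 2 * (m * avg (length is) (\<lambda>b. of_bool (bad (vxor w (block_mask n blk is b)))))
      + card H * (1 - \<delta>) ^ m"
proof -
  let ?g = "abort_on bad f" and ?A = "sample n blk is w" and ?q = "length is"
  let ?B = "avg ?q (\<lambda>b. of_bool (bad (vxor w (block_mask n blk is b))))"
  let ?dist = "\<lambda>h. avg ?q (\<lambda>b. of_bool (evald h b \<noteq> evald hs b))"
  have 1: "err ?g (rep m ?A) (\<lambda>S. \<forall>(b, c)\<in>set S. c = evald hs b) \<le> m * ?B"
  proof -
    have "err ?g ?A (\<lambda>(b, c). c = evald hs b) \<le> ?B"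
      unfolding sample_def err.simps by (rule avg_mono) (use hs in \<open>auto simp: abort_on_def\<close>)
    then show ?thesis
      by (intro order_trans[OF err_rep_ball mult_left_mono]) auto
  qed
  have True: "err ?g (rep m ?A) (\<lambda>_. True) \<le> m * ?B"
    by (rule order_trans[OF err_mono 1]) simp
  let ?C = "\<lambda>h S. (\<forall>(b, c)\<in>set S. c = evald h b) \<longrightarrow> ?dist h \<le> \<delta>"
  have far: "err (exact f) (rep m ?A) (?C h) \<le> (1 - \<delta>) ^ m" for h
  proof (cases "?dist h \<le> \<delta>")
    case True
    then show ?thesis using \<delta> by simp
  next
    case False
    have "err (exact f) (rep m ?A) (?C h) \<le> err (exact f) ?A (\<lambda>(b, c). c \<noteq> evald h b) ^ m"
      by (rule order_trans[OF err_mono err_rep_ex]) auto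
    also have "err (exact f) ?A (\<lambda>(b, c). c \<noteq> evald h b)
        = avg ?q (\<lambda>b. 1 - of_bool (evald h b \<noteq> evald hs b))"
      unfolding sample_def err.simps by (rule avg_cong) (use hs in auto)
    also have "\<dots> = 1 - ?dist h" by (simp add: avg_diff)
    also have "(1 - ?dist h) ^ m \<le> (1 - \<delta>) ^ m"
      using False avg_le[of ?q "\<lambda>b. of_bool (evald h b \<noteq> evald hs b)" 1]
      by (intro power_mono) auto
    finally show ?thesis .
  qed
  have "err ?g (rep m ?A) (\<lambda>S. \<forall>h\<in>H. ?C h S)
      \<le> err (exact f) (rep m ?A) (\<lambda>S. \<forall>h\<in>H. ?C h S) + err ?g (rep m ?A) (\<lambda>_. True)"
    by (rule err_split_total) (simp add: abort_on_def)
  also have "err (exact f) (rep m ?A) (\<lambda>S. \<forall>h\<in>H. ?C h S) \<le> (\<Sum>h\<in>H. (1 - \<delta>) ^ m)"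
    using order_trans[OF err_ball[OF H(1), of "exact f" "rep m ?A" ?C] add_right_mono[OF sum_mono[OF far]]]
    by simp
  finally have 2: "err ?g (rep m ?A) (\<lambda>S. \<forall>h\<in>H. ?C h S) \<le> card H * (1 - \<delta>) ^ m + m * ?B"
    using True by simp
  show ?thesis
    using err_conj[of ?g "rep m ?A" "\<lambda>S. \<forall>(b, c)\<in>set S. c = evald hs b" "\<lambda>S. \<forall>h\<in>H. ?C h S"] 1 2
    by linarith
qed

section \<open>A short DNF whose variables lie in distinct blocks\<close>

locale short_dnf =
  fixes n s L :: nat and F :: "literal set set" and bad :: "bool list \<Rightarrow> bool"
    and blk :: "nat \<Rightarrow> nat" and \<alpha> :: real
  assumes F: "finite F" "card F \<le> s" "\<And>t. t \<in> F \<Longrightarrow> t \<subseteq> {..<n} \<times> UNIV \<and> card t \<le> L"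
    and inj: "inj_on blk (\<Union>t\<in>F. fst ` t)"
begin

definition V where "V = (\<Union>t\<in>F. fst ` t)"

abbreviation f where "f \<equiv> evald F"

lemma finite_terms: "t \<in> F \<Longrightarrow> finite t"
  using F(3) finite_subset[of t "{..<n} \<times> UNIV"] by auto

lemma V_less: "c \<in> V \<Longrightarrow> c < n"
  using F(3) by (fastforce simp: V_def)

lemma V_eqI: "c \<in> V \<Longrightarrow> c' \<in> V \<Longrightarrow> blk c = blk c' \<Longrightarrow> c = c'"
  using inj unfolding V_def[symmetric] by (rule inj_onD)

lemma junta: "(\<And>c. c \<in> V \<Longrightarrow> x ! c = y ! c) \<Longrightarrow> f x = f y"
proof -
  assume eq: "\<And>c. c \<in> V \<Longrightarrow> x ! c = y ! c"
  have "satisfies x t = satisfies y t" if "t \<in> F" for t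
    unfolding satisfies_def using eq that by (fastforce simp: V_def)
  then show ?thesis by (simp add: evald_def)
qed

text \<open>Two points that differ only inside the block of \<open>e\<close> give different values,
  so the block contains a variable \<open>c\<close> of the DNF, and by injectivity no other one.
  Probes therefore see \<open>f\<close> only through \<open>z ! c\<close>, with the two distinct
  values \<open>f v\<close> and \<open>f (snd e)\<close>.\<close>

lemma good_entry_coord:
  assumes "good_entry n f bad \<alpha> blk e"
  obtains c where "c \<in> V" "blk c = fst e"
    "\<And>z x. z \<in> cube n \<Longrightarrow> x \<in> cube n \<Longrightarrow> (f (probe blk e z) \<noteq> f (probe blk e (vxor z x))) = x ! c"
proof -
  obtain v where v: "v \<in> cube n" "snd e \<in> cube n" "f v \<noteq> f (snd e)"
      "\<And>c. c < n \<Longrightarrow> blk c \<noteq> fst e \<Longrightarrow> v ! c = snd e ! c"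
    using assms by (auto simp: good_entry_def)
  then obtain c where c: "c \<in> V" "v ! c \<noteq> snd e ! c" using junta by metis
  then have blk: "blk c = fst e" using v(4) V_less by metis
  have probe: "f (probe blk e z) = f y"
    if "y \<in> cube n" "z ! c = y ! c" "\<And>d. d < n \<Longrightarrow> blk d \<noteq> fst e \<Longrightarrow> y ! d = snd e ! d" for y z
  proof (rule junta)
    fix d assume d: "d \<in> V"
    show "probe blk e z ! d = y ! d"
    proof (cases "blk d = fst e")
      case True
      then have "d = c" using V_eqI d c(1) blk by simp
      then show ?thesis using that(2) True V_less[OF d] v(2) by (simp add: probe_def cube_def)
    next
      case False
      then show ?thesis using that(3)[of d] V_less[OF d] v(2) by (simp add: probe_def cube_def)
    qed
  qed
  have eq: "f (probe blk e z) = (if z ! c = v ! c then f v else f (snd e))" for z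
    using probe[OF v(1), of z] probe[OF v(2), of z] v(4) c(2) by auto
  have "(f (probe blk e z) \<noteq> f (probe blk e (vxor z x))) = x ! c" if "z \<in> cube n" "x \<in> cube n" for z x
    using that V_less[OF c(1)] v(3) unfolding eq by (auto simp: cube_def)
  then show ?thesis using that c(1) blk by blast
qed

context
  fixes st :: "entry list"
  assumes good: "\<And>e. e \<in> set st \<Longrightarrow> good_entry n f bad \<alpha> blk e" and dist: "distinct (map fst st)"
begin

definition coord where
  "coord e = (SOME c. c \<in> V \<and> blk c = fst e \<and> (\<forall>z\<in>cube n. \<forall>x\<in>cube n.
     (f (probe blk e z) \<noteq> f (probe blk e (vxor z x))) = x ! c))"

lemma coord:
  assumes "e \<in> set st"
  shows "coord e \<in> V" "blk (coord e) = fst e"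
    "\<And>z x. z \<in> cube n \<Longrightarrow> x \<in> cube n \<Longrightarrow>
      (f (probe blk e z) \<noteq> f (probe blk e (vxor z x))) = x ! coord e"
proof -
  have "\<exists>c. c \<in> V \<and> blk c = fst e \<and> (\<forall>z\<in>cube n. \<forall>x\<in>cube n.
     (f (probe blk e z) \<noteq> f (probe blk e (vxor z x))) = x ! c)"
    using good_entry_coord[OF good[OF assms]] by metis
  from someI_ex[OF this] show "coord e \<in> V" "blk (coord e) = fst e"
    "\<And>z x. z \<in> cube n \<Longrightarrow> x \<in> cube n \<Longrightarrow>
      (f (probe blk e z) \<noteq> f (probe blk e (vxor z x))) = x ! coord e"
    unfolding coord_def by auto
qed

lemma rare: "e \<in> set st \<Longrightarrow> avg n (\<lambda>z. of_bool (bad (probe blk e z))) \<le> \<alpha>"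
  using good by (simp add: good_entry_def)

abbreviation mask where "mask \<equiv> block_mask n blk (map fst st)"

lemma index_unique: "i < length st \<Longrightarrow> j < length st \<Longrightarrow> fst (st ! i) = fst (st ! j) \<Longrightarrow> i = j"
  using dist by (metis distinct_conv_nth length_map nth_map)

lemma mask_at:
  assumes "c < n" "i < length st" "fst (st ! i) = blk c"
  shows "mask b ! c = b ! i"
proof -
  have "(\<exists>j<length st. fst (st ! j) = blk c \<and> b ! j) = b ! i"
    using assms index_unique by metis
  then show ?thesis using assms by (simp add: block_mask_def cong: conj_cong)
qed

lemma mask_outside: "c < n \<Longrightarrow> blk c \<notin> fst ` set st \<Longrightarrow> \<not> mask b ! c"
  by (auto simp: block_mask_def image_iff) (metis fst_conv nth_mem prod.collapse)

definition coords where "coords x = map (\<lambda>e. x ! coord e) st"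

text \<open>Shifting by \<open>mask b\<close> adds \<open>b\<close> to the coordinates and keeps
  \<open>x\<close> uniform; averaging over \<open>b\<close> as well makes the coordinates uniform.
  This turns accuracy on examples into accuracy at uniform points.\<close>

lemma avg_coords:
  "avg n (\<lambda>x. G (coords x)) = avg (length st) G"
proof -
  let ?q = "length st"
  have cube: "coords x \<in> cube ?q" for x by (simp add: coords_def cube_def)
  have shift: "coords (vxor x (mask b)) = vxor b (coords x)" if x: "x \<in> cube n" and b: "b \<in> cube ?q" for x b
  proof (rule cube_eqI[of _ ?q])
    fix i assume i: "i < ?q"
    let ?c = "coord (st ! i)"
    have c: "?c < n" "blk ?c = fst (st ! i)" using coord[of "st ! i"] i V_less by auto
    then have "mask b ! ?c = b ! i" using mask_at i by simp
    moreover have "mask b \<in> cube n" by simp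
    ultimately show "coords (vxor x (mask b)) ! i = vxor b (coords x) ! i"
      using x b i c by (auto simp: coords_def cube_def)
  qed (use b cube in auto)
  have "avg n (\<lambda>x. G (coords (vxor x (mask b)))) = avg n (\<lambda>x. G (coords x))" for b
    by (rule avg_vxor) simp
  then have "avg n (\<lambda>x. G (coords x)) = avg ?q (\<lambda>b. avg n (\<lambda>x. G (coords (vxor x (mask b)))))"
    by (simp only: avg_const)
  also have "\<dots> = avg ?q (\<lambda>b. avg n (\<lambda>x. G (vxor b (coords x))))"
    by (intro avg_cong arg_cong[of _ _ G] shift)
  also have "\<dots> = avg n (\<lambda>x. avg ?q (\<lambda>b. G (vxor b (coords x))))" by (rule avg_swap)
  also have "\<dots> = avg n (\<lambda>x. avg ?q G)" by (intro avg_cong avg_vxor cube)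
  also have "\<dots> = avg ?q G" by simp
  finally show ?thesis .
qed

definition index where "index c = (SOME i. i < length st \<and> fst (st ! i) = blk c)"

lemma index: "blk c \<in> fst ` set st \<Longrightarrow> index c < length st \<and> fst (st ! index c) = blk c"
  unfolding index_def by (rule someI_ex) (metis imageE in_set_conv_nth)

context
  fixes w :: "bool list"
  assumes w: "w \<in> cube n"
begin

text \<open>The target of learning: \<open>f\<close> with all blocks not found frozen to
  \<open>w\<close>, as a DNF in the coordinates relative to \<open>w\<close>. A literal in a found
  block becomes one literal, any other a constant, so no term grows beyond \<open>L\<close>.\<close>

definition restricted where
  "restricted = subst_dnf (\<lambda>(c, b).
     if blk c \<in> fst ` set st then Some {(index c, b \<noteq> w ! c)}
     else if w ! c = b then Some {} else None) F"

lemma restricted_dnfs: "restricted \<in> dnfs (length st) L s"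
proof -
  let ?u = "\<lambda>(c, b). if blk c \<in> fst ` set st then Some {(index c, b \<noteq> w ! c)}
     else if w ! c = b then Some {} else None"
  have "t \<subseteq> {..<length st} \<times> UNIV" if "t \<in> restricted" for t
    using that unfolding restricted_def
  proof (rule subst_dnf_terms[rotated])
    fix t l S
    assume "(case l of (c, b) \<Rightarrow> if blk c \<in> fst ` set st then Some {(index c, b \<noteq> w ! c)}
      else if w ! c = b then Some {} else None) = Some S"
    then show "S \<subseteq> {..<length st} \<times> UNIV"
      using index[of "fst l"] by (cases l) (simp split: if_splits, blast+)
  qed
  moreover have "card t \<le> L" if t: "t \<in> restricted" for t
    by (rule card_subst_dnf_term[OF _ _ t[unfolded restricted_def]])
      (use F(3) finite_terms in \<open>auto split: if_splits\<close>)
  moreover have "card restricted \<le> s"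
    unfolding restricted_def using card_subst_dnf[OF F(1), of ?u] F(2) by simp
  ultimately show ?thesis by (auto simp: dnfs_def)
qed

lemma evald_restricted:
  assumes b: "b \<in> cube (length st)"
  shows "evald restricted b = f (vxor w (mask b))"
  unfolding restricted_def
proof (rule evald_subst)
  fix t c v assume "t \<in> F" "(c, v) \<in> t"
  then have c: "c \<in> V" "c < n" using V_less by (force simp: V_def)+
  have m: "mask b \<in> cube n" by simp
  have nth: "vxor w (mask b) ! c = (w ! c \<noteq> mask b ! c)" using c w m by (simp add: cube_def)
  show "vxor w (mask b) ! c = v \<longleftrightarrow> (\<exists>S. (case (c, v) of (c, b) \<Rightarrow>
      if blk c \<in> fst ` set st then Some {(index c, b \<noteq> w ! c)}
      else if w ! c = b then Some {} else None) = Some S \<and> satisfies b S)"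
  proof (cases "blk c \<in> fst ` set st")
    case True
    then have "mask b ! c = b ! index c" using index mask_at c by blast
    then show ?thesis using True by (auto simp: nth satisfies_def)
  next
    case False
    then show ?thesis using mask_outside[OF c(2) False, of b] by (auto simp: nth satisfies_def)
  qed
qed

text \<open>On relevant variables in found blocks the shift by the mask restores \<open>x\<close>,
  elsewhere it leaves \<open>w\<close>. So the target disagrees with \<open>f\<close> only where the
  blocks not found matter, which \<open>unsettled\<close> measures on average over
  \<open>w\<close>.\<close>

lemma restricted_coords:
  assumes x: "x \<in> cube n"
  shows "evald restricted (coords (vxor x w)) = f (mix (\<lambda>c. blk c \<in> fst ` set st) x w)"
proof -
  have "coords (vxor x w) \<in> cube (length st)" by (simp add: coords_def cube_def)
  then have "evald restricted (coords (vxor x w)) = f (vxor w (mask (coords (vxor x w))))"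
    by (rule evald_restricted)
  also have "\<dots> = f (mix (\<lambda>c. blk c \<in> fst ` set st) x w)"
  proof (rule junta)
    fix c assume cV: "c \<in> V"
    let ?m = "mask (coords (vxor x w))"
    have c: "c < n" and m: "?m \<in> cube n" using V_less[OF cV] by auto
    have nth: "vxor w ?m ! c = (w ! c \<noteq> ?m ! c)" using c w m by (simp add: cube_def)
    show "vxor w ?m ! c = mix (\<lambda>c. blk c \<in> fst ` set st) x w ! c"
    proof (cases "blk c \<in> fst ` set st")
      case True
      let ?e = "st ! index c"
      have e: "?e \<in> set st" "fst ?e = blk c" "index c < length st" using index[OF True] by auto
      then have "coord ?e = c" using coord[OF e(1)] V_eqI cV by simp
      then have "coords (vxor x w) ! index c = (x ! c \<noteq> w ! c)"
        using e x w c by (simp add: coords_def cube_def)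
      then have "?m ! c = (x ! c \<noteq> w ! c)" using mask_at[OF c e(3) e(2)] by simp
      then show ?thesis using nth True x c by (auto simp: cube_def)
    next
      case False
      then show ?thesis using mask_outside[OF c False] nth x c by (simp add: cube_def)
    qed
  qed
  finally show ?thesis .
qed

text \<open>The summands in turn: the point itself is bad, overwriting the blocks not found by
  \<open>w\<close> changes \<open>f\<close>, the hypothesis errs on the decoded coordinates, or a
  decoding fails.\<close>

lemma final_test_complete:
  fixes \<mu> \<delta> :: real
  assumes \<mu>: "avg n (\<lambda>x. of_bool (bad x)) \<le> \<mu>" and t: "0 < t" and K: "length st \<le> K" and \<alpha>: "0 \<le> \<alpha>"
    and h: "avg (length st) (\<lambda>b. of_bool (evald h b \<noteq> evald restricted b)) \<le> \<delta>"
  shows "err (abort_on bad f) (final_test n t blk st w h) (\<lambda>r. r)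
    \<le> \<mu> + avg n (\<lambda>x. of_bool (f x \<noteq> f (mix (\<lambda>c. blk c \<in> fst ` set st) x w))) + \<delta> + K * (t * (2 * \<alpha>))"
proof -
  let ?g = "abort_on bad f"
  let ?X = "\<lambda>x. mix (\<lambda>c. blk c \<in> fst ` set st) x w"
  define B where "B x = of_bool (bad x) + of_bool (f x \<noteq> f (?X x))
    + of_bool (evald h (coords (vxor x w)) \<noteq> evald restricted (coords (vxor x w)))
    + real K * (t * (2 * \<alpha>))" for x
  have \<alpha>': "0 \<le> real K * (t * (2 * \<alpha>))" using \<alpha> by simp
  define body where "body x b = bindP (mapM (\<lambda>e. decode n t (probe blk e) (vxor x w)) st) (\<lambda>l.
       Ret ((\<forall>r\<in>set l. fst r) \<and> b = evald h (map snd l)))" for x b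
  have "err ?g (Ask x (body x)) (\<lambda>r. r) \<le> B x" if x: "x \<in> cube n" for x
  proof (cases "bad x \<or> f x \<noteq> evald h (coords (vxor x w))")
    case True
    then have "1 \<le> B x"
      using \<alpha>' restricted_coords[OF x] by (auto simp: B_def of_bool_def)
    then show ?thesis using err_le_1 order_trans by blast
  next
    case False
    let ?P = "\<lambda>e r. r = (True, vxor x w ! coord e)"
    have "err ?g (body x (f x)) (\<lambda>r. r)
        \<le> err ?g (mapM (\<lambda>e. decode n t (probe blk e) (vxor x w)) st) (list_all2 ?P st) + 0"
      unfolding body_def
    proof (rule err_bind)
      fix l :: "(bool \<times> bool) list" assume l: "list_all2 ?P st l"
      have "l = map (\<lambda>e. (True, vxor x w ! coord e)) st"
        using l by (induction st l rule: list_all2_induct) auto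
      then show "err ?g (Ret ((\<forall>r\<in>set l. fst r) \<and> f x = evald h (map snd l))) (\<lambda>r. r) \<le> 0"
        using False by (auto simp: coords_def comp_def)
    qed simp
    also have "\<dots> \<le> (\<Sum>e\<leftarrow>st. err ?g (decode n t (probe blk e) (vxor x w)) (?P e))"
      using err_mapM[of ?g "\<lambda>e. decode n t (probe blk e) (vxor x w)" st ?P] by simp
    also have "\<dots> \<le> (\<Sum>e\<leftarrow>st. t * (2 * \<alpha>))"
    proof (rule sum_list_mono)
      fix e assume e: "e \<in> set st"
      show "err ?g (decode n t (probe blk e) (vxor x w)) (?P e) \<le> t * (2 * \<alpha>)"
        by (rule decode_complete[where p = "probe blk e" and bad = bad and f = f, OF rare[OF e] _ V_less[OF coord(1)[OF e]] vxor_cube[OF x w] t])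
          (rule coord(3)[OF e])
    qed
    also have "\<dots> \<le> K * (t * (2 * \<alpha>))"
      using K \<alpha> by (simp add: sum_list_triv mult_right_mono)
    finally have "err ?g (body x (f x)) (\<lambda>r. r) \<le> K * (t * (2 * \<alpha>))" .
    moreover have "real K * (t * (2 * \<alpha>)) \<le> B x" by (simp add: B_def)
    moreover have "err ?g (Ask x (body x)) (\<lambda>r. r) = err ?g (body x (f x)) (\<lambda>r. r)"
      using False by (simp add: abort_on_def)
    ultimately show ?thesis by linarith
  qed
  then have "err ?g (final_test n t blk st w h) (\<lambda>r. r) \<le> avg n B"
    unfolding final_test_def err.simps(3) body_def by (rule avg_mono)
  also have "avg n B = avg n (\<lambda>x. of_bool (bad x)) + avg n (\<lambda>x. of_bool (f x \<noteq> f (?X x)))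
      + avg (length st) (\<lambda>b. of_bool (evald h b \<noteq> evald restricted b)) + K * (t * (2 * \<alpha>))"
    using avg_vxor[OF w, of "\<lambda>x. of_bool (evald h (coords x) \<noteq> evald restricted (coords x))"]
      avg_coords[of "\<lambda>b. of_bool (evald h b \<noteq> evald restricted b)"]
    unfolding B_def avg_add by simp
  finally show ?thesis using \<mu> h by linarith
qed

lemma verify_complete:
  fixes \<mu> \<delta> :: real
  assumes \<mu>: "avg n (\<lambda>x. of_bool (bad x)) \<le> \<mu>" and t: "0 < t" and K: "length st \<le> K" and \<alpha>: "0 \<le> \<alpha>"
    and \<delta>: "0 \<le> \<delta>" "\<delta> \<le> 1"
  shows "err (abort_on bad f) (verify n s L t m T blk st w) (\<lambda>rs. \<forall>r\<in>set rs. r)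
    \<le> 2 * (m * avg (length st) (\<lambda>b. of_bool (bad (vxor w (mask b)))))
      + card (dnfs (length st) L s) * (1 - \<delta>) ^ m
      + T * (\<mu> + avg n (\<lambda>x. of_bool (f x \<noteq> f (mix (\<lambda>c. blk c \<in> fst ` set st) x w)))
        + \<delta> + K * (t * (2 * \<alpha>)))"
proof -
  let ?g = "abort_on bad f" and ?H = "dnfs (length st) L s"
  let ?e = "\<mu> + avg n (\<lambda>x. of_bool (f x \<noteq> f (mix (\<lambda>c. blk c \<in> fst ` set st) x w)))
        + \<delta> + K * (t * (2 * \<alpha>))"
  let ?P = "\<lambda>S. (\<forall>(b, c)\<in>set S. c = evald restricted b) \<and>
      (\<forall>h\<in>?H. (\<forall>(b, c)\<in>set S. c = evald h b) \<longrightarrow>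
        avg (length st) (\<lambda>b. of_bool (evald h b \<noteq> evald restricted b)) \<le> \<delta>)"
  have "0 \<le> \<mu>" using \<mu> avg_nonneg[of n "\<lambda>x. of_bool (bad x)"] by simp
  then have e: "0 \<le> ?e" using \<alpha> \<delta> by (auto intro!: add_nonneg_nonneg avg_nonneg)
  have "err ?g (verify n s L t m T blk st w) (\<lambda>rs. \<forall>r\<in>set rs. r)
      \<le> err ?g (rep m (sample n blk (map fst st) w)) ?P + T * ?e"
    unfolding verify_def
  proof (rule err_bind)
    fix S assume S: "?P S"
    then have "avg (length st) (\<lambda>b. of_bool (evald (hypothesis (length st) L s S) b \<noteq> evald restricted b)) \<le> \<delta>"
      using hypothesis_consistent[OF restricted_dnfs] hypothesis_dnfs by blast
    from final_test_complete[OF \<mu> t K \<alpha> this]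
    show "err ?g (rep T (final_test n t blk st w (hypothesis (length st) L s S))) (\<lambda>rs. \<forall>r\<in>set rs. r)
        \<le> T * ?e"
      by (intro order_trans[OF err_rep_ball mult_left_mono]) auto
  qed (use e in simp)
  also have "err ?g (rep m (sample n blk (map fst st) w)) ?P
      \<le> 2 * (m * avg (length st) (\<lambda>b. of_bool (bad (vxor w (mask b))))) + card ?H * (1 - \<delta>) ^ m"
    using learning_complete[OF dnfs_bound(1) restricted_dnfs w, of "map fst st" f blk \<delta> bad m]
      evald_restricted \<delta> by simp
  finally show ?thesis by simp
qed

end

text \<open>The shared \<open>w\<close> makes the examples dependent, so learning is analysed for
  fixed \<open>w\<close> and only the resulting bound is averaged. The two terms that depend on
  \<open>w\<close> enter linearly: the bad fraction averages to at most \<mu>, since a shifted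
  uniform \<open>w\<close> is uniform, and the unsettled one to at most \<delta>.\<close>

lemma avg_verify_complete:
  fixes \<mu> \<delta> :: real
  assumes \<mu>: "avg n (\<lambda>x. of_bool (bad x)) \<le> \<mu>" and t: "0 < t" and K: "length st \<le> K" and \<alpha>: "0 \<le> \<alpha>"
    and \<delta>: "0 \<le> \<delta>" "\<delta> \<le> 1" and settled: "unsettled n f blk (fst ` set st) \<le> \<delta>"
  shows "avg n (\<lambda>w. err (abort_on bad f) (verify n s L t m T blk st w) (\<lambda>rs. \<forall>r\<in>set rs. r))
    \<le> 2 * (m * \<mu>) + card (dnfs (length st) L s) * (1 - \<delta>) ^ m + T * (\<mu> + 2 * \<delta> + K * (t * (2 * \<alpha>)))"
proof -
  let ?B = "\<lambda>w. avg (length st) (\<lambda>b. of_bool (bad (vxor w (mask b))) :: real)"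
  let ?U = "\<lambda>w. avg n (\<lambda>x. of_bool (f x \<noteq> f (mix (\<lambda>c. blk c \<in> fst ` set st) x w)) :: real)"
  let ?C = "card (dnfs (length st) L s) * (1 - \<delta>) ^ m + T * (\<mu> + \<delta> + K * (t * (2 * \<alpha>)))"
  have B: "avg n ?B \<le> \<mu>"
  proof -
    have "avg n ?B = avg (length st) (\<lambda>b. avg n (\<lambda>w. of_bool (bad (vxor w (mask b)))))"
      by (rule avg_swap)
    also have "\<dots> = avg (length st) (\<lambda>b. avg n (\<lambda>x. of_bool (bad x)))"
      by (intro avg_cong avg_vxor) simp
    finally show ?thesis using \<mu> by simp
  qed
  have U: "avg n ?U \<le> \<delta>"
  proof -
    have "avg n ?U = unsettled n f blk (fst ` set st)" unfolding unsettled_def by (rule avg_swap)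
    then show ?thesis using settled by simp
  qed
  have "avg n (\<lambda>w. err (abort_on bad f) (verify n s L t m T blk st w) (\<lambda>rs. \<forall>r\<in>set rs. r))
      \<le> avg n (\<lambda>w. (2 * m) * ?B w + T * ?U w + ?C)"
  proof (rule avg_mono)
    fix w assume w: "w \<in> cube n"
    show "err (abort_on bad f) (verify n s L t m T blk st w) (\<lambda>rs. \<forall>r\<in>set rs. r)
        \<le> (2 * m) * ?B w + T * ?U w + ?C"
      using verify_complete[OF w \<mu> t K \<alpha> \<delta>, of m T] by (simp add: algebra_simps)
  qed
  also have "\<dots> = (2 * m) * avg n ?B + T * avg n ?U + ?C"
    unfolding avg_add avg_cmult avg_const ..
  also have "\<dots> \<le> (2 * m) * \<mu> + T * \<delta> + ?C"
    using B U by (intro add_mono mult_left_mono) auto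
  finally show ?thesis by (simp add: algebra_simps)
qed

lemma tests_complete:
  assumes K: "length st \<le> K" and \<alpha>: "0 \<le> \<alpha>" and t: "0 < t"
  shows "err (abort_on bad f) (mapM (\<lambda>e. block_test n t (probe blk e)) st) (\<lambda>l. \<forall>r\<in>set l. r)
    \<le> K * ((28 + 54 * real t) * \<alpha>)"
proof -
  let ?g = "abort_on bad f"
  have "err ?g (mapM (\<lambda>e. block_test n t (probe blk e)) st) (\<lambda>l. \<forall>r\<in>set l. r)
      \<le> err ?g (mapM (\<lambda>e. block_test n t (probe blk e)) st) (list_all2 (\<lambda>_ r. r) st)"
    by (rule err_mono) (auto simp: list_all2_conv_all_nth in_set_conv_nth)
  also have "\<dots> \<le> (\<Sum>e\<leftarrow>st. err ?g (block_test n t (probe blk e)) (\<lambda>r. r))" by (rule err_mapM)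
  also have "\<dots> \<le> (\<Sum>e\<leftarrow>st. (28 + 54 * real t) * \<alpha>)"
  proof (rule sum_list_mono)
    fix e assume e: "e \<in> set st"
    show "err ?g (block_test n t (probe blk e)) (\<lambda>r. r) \<le> (28 + 54 * real t) * \<alpha>"
      by (rule block_test_complete[where p = "probe blk e" and bad = bad and f = f, OF rare[OF e] _ V_less[OF coord(1)[OF e]] t]) (rule coord(3)[OF e])
  qed
  also have "\<dots> \<le> K * ((28 + 54 * real t) * \<alpha>)"
    using K \<alpha> by (simp add: sum_list_triv mult_right_mono)
  finally show ?thesis .
qed

end

end

text \<open>The summands account in turn for relevant variables that share a block, the search, the
  block tests, and learning with the final comparisons.\<close>

lemma dnf_tester_complete:
  fixes n s L K a M t m T N :: nat and \<mu> \<alpha> \<delta> \<tau> :: real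
  defines "\<tau> \<equiv> (2 ^ a + 1) * \<mu> + 2 ^ a * (\<mu> / \<alpha>)"
  assumes F: "finite F" "card F \<le> s" "\<And>t. t \<in> F \<Longrightarrow> t \<subseteq> {..<n} \<times> UNIV \<and> card t \<le> L"
    and \<mu>: "avg n (\<lambda>x. of_bool (bad x)) \<le> \<mu>" and \<alpha>: "0 < \<alpha>" and \<delta>: "0 \<le> \<delta>" "\<delta> \<le> 1"
    and t: "0 < t" and K: "s * L \<le> K"
    and H: "\<And>q. q \<le> K \<Longrightarrow> card (dnfs q L s) \<le> N"
  shows "err (abort_on bad (evald F)) (dnf_tester n s L K a M t m T) (\<lambda>r. r)
    \<le> real K ^ 2 / 2 ^ a + K * (2 * (M * \<tau>) + (1 - \<delta>) ^ M) + K * ((28 + 54 * real t) * \<alpha>)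
      + (2 * (m * \<mu>) + N * (1 - \<delta>) ^ m + T * (\<mu> + 2 * \<delta> + K * (t * (2 * \<alpha>))))"
proof -
  let ?f = "evald F"
  let ?g = "abort_on bad ?f"
  define W where "W = (\<Union>t\<in>F. fst ` t)"
  have fin: "finite t" if "t \<in> F" for t
    using F(3)[OF that] finite_subset[of t "{..<n} \<times> UNIV"] by auto
  have "finite W" using F(1) fin by (auto simp: W_def)
  moreover have "W \<subseteq> {..<n}" using F(3) by (fastforce simp: W_def)
  ultimately have W: "finite W" "W \<subseteq> {..<n}" .
  have "card W \<le> (\<Sum>t\<in>F. card (fst ` t))" unfolding W_def by (rule card_UN_le) (rule F)
  also have "\<dots> \<le> (\<Sum>t\<in>F. L)"
    by (rule sum_mono) (use F(3) fin card_image_le order_trans in blast)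
  also have "\<dots> \<le> K" using order_trans[OF mult_le_mono1[OF F(2)] K] by (simp only: sum_constant of_nat_id)
  finally have cW: "card W \<le> K" .
  have \<mu>0: "0 \<le> \<mu>" using \<mu> avg_nonneg[of n "\<lambda>x. of_bool (bad x)"] by simp
  have \<tau>0: "0 \<le> \<tau>" using \<mu>0 \<alpha> by (simp add: \<tau>_def)
  let ?R = "2 * (m * \<mu>) + N * (1 - \<delta>) ^ m + T * (\<mu> + 2 * \<delta> + K * (t * (2 * \<alpha>)))"
  have R0: "0 \<le> ?R" using \<mu>0 \<delta> \<alpha> by simp
  have S0: "0 \<le> K * ((28 + 54 * real t) * \<alpha>)" using \<alpha> by simp
  have M0: "0 \<le> K * (2 * (M * \<tau>) + (1 - \<delta>) ^ M)" using \<tau>0 \<delta> by simp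
  define rest where "rest = (\<lambda>blk st oks. Rnd n (\<lambda>w. bindP (verify n s L t m T blk st w)
      (\<lambda>rs. Ret ((\<forall>r\<in>set oks. r) \<and> (\<forall>r\<in>set rs. r)))))"
  let ?tests = "\<lambda>blk st. mapM (\<lambda>e. block_test n t (probe blk e)) st"
  have blk_case: "err ?g (bindP (search n blk a M K []) (\<lambda>st. bindP (?tests blk st) (rest blk st))) (\<lambda>r. r)
      \<le> K * (2 * (M * \<tau>) + (1 - \<delta>) ^ M) + (K * ((28 + 54 * real t) * \<alpha>) + ?R)"
    if blk: "inj_on blk W" "\<And>c. blk c < 2 ^ a" for blk
  proof -
    interpret short_dnf n s L F bad blk \<alpha>
      by unfold_locales (use F blk W_def in auto)
    let ?P = "\<lambda>st'. (\<forall>e\<in>set st'. good_entry n ?f bad \<alpha> blk e) \<and> distinct (map fst st')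
        \<and> unsettled n ?f blk (fst ` set st') \<le> \<delta>"
    have search: "err ?g (search n blk a M K []) ?P \<le> K * (2 * (M * \<tau>) + (1 - \<delta>) ^ M)"
    proof (rule search_complete[OF blk(2) W(1) cW W(2)])
      show "?f x = ?f y" if "\<And>c. c \<in> W \<Longrightarrow> x ! c = y ! c" for x y
        by (rule junta) (use that in \<open>simp add: V_def W_def\<close>)
      show "err ?g (trial n blk a X)
          (\<lambda>r. \<forall>e. r = Some e \<longrightarrow> good_entry n ?f bad \<alpha> blk e \<and> fst e \<notin> X) \<le> \<tau>" for X
        unfolding \<tau>_def by (rule trial_complete[OF blk(2) \<mu> \<alpha>])
    qed (use \<delta> in auto)
    have "err ?g (bindP (search n blk a M K []) (\<lambda>st. bindP (?tests blk st) (rest blk st))) (\<lambda>r. r)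
        \<le> err ?g (search n blk a M K []) ?P + (K * ((28 + 54 * real t) * \<alpha>) + ?R)"
    proof (rule err_bind_spec[OF spec_search])
      fix st :: "entry list"
      assume P: "?P st" and "length st \<le> length ([] :: entry list) + K \<and> (\<forall>e\<in>set st. snd e \<in> cube n)"
      then have len: "length st \<le> K" by simp
      have good: "\<And>e. e \<in> set st \<Longrightarrow> good_entry n ?f bad \<alpha> blk e" and dist: "distinct (map fst st)"
        and set: "unsettled n ?f blk (fst ` set st) \<le> \<delta>" using P by auto
      have verify: "avg n (\<lambda>w. err ?g (verify n s L t m T blk st w) (\<lambda>rs. \<forall>r\<in>set rs. r)) \<le> ?R"
      proof -
        have "card (dnfs (length st) L s) * (1 - \<delta>) ^ m \<le> N * (1 - \<delta>) ^ m"
          using H[OF len] \<delta> by (intro mult_right_mono) auto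
        then show ?thesis
          using avg_verify_complete[OF good dist \<mu> t len less_imp_le[OF \<alpha>] \<delta> set, of m T] by linarith
      qed
      have "err ?g (bindP (?tests blk st) (rest blk st)) (\<lambda>r. r)
          \<le> err ?g (?tests blk st) (\<lambda>l. \<forall>r\<in>set l. r) + ?R"
      proof (rule err_bind)
        fix oks :: "bool list" assume oks: "\<forall>r\<in>set oks. r"
        have "err ?g (bindP (verify n s L t m T blk st w) (\<lambda>rs. Ret ((\<forall>r\<in>set oks. r) \<and> (\<forall>r\<in>set rs. r)))) (\<lambda>r. r)
            \<le> err ?g (verify n s L t m T blk st w) (\<lambda>rs. \<forall>r\<in>set rs. r) + 0" for w
          by (rule err_bind) (use oks in auto)
        then have "err ?g (rest blk st oks) (\<lambda>r. r)
            \<le> avg n (\<lambda>w. err ?g (verify n s L t m T blk st w) (\<lambda>rs. \<forall>r\<in>set rs. r))"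
          unfolding rest_def err.simps by (intro avg_mono) simp
        then show "err ?g (rest blk st oks) (\<lambda>r. r) \<le> ?R" using verify by linarith
      qed (rule R0)
      then show "err ?g (bindP (?tests blk st) (rest blk st)) (\<lambda>r. r) \<le> K * ((28 + 54 * real t) * \<alpha>) + ?R"
        using tests_complete[OF good dist len less_imp_le[OF \<alpha>] t] by linarith
    next
      show "0 \<le> K * ((28 + 54 * real t) * \<alpha>) + ?R" using S0 R0 by (rule add_nonneg_nonneg)
    qed simp
    then show ?thesis using search by linarith
  qed
  have "dnf_tester n s L K a M t m T = bindP (partition_prog n a (\<lambda>_. 0)) (\<lambda>blk.
      bindP (search n blk a M K []) (\<lambda>st. bindP (?tests blk st) (rest blk st)))"
    by (simp only: dnf_tester_def rest_def)
  then have "err ?g (dnf_tester n s L K a M t m T) (\<lambda>r. r)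
      \<le> err ?g (partition_prog n a (\<lambda>_. 0)) (\<lambda>blk. inj_on blk W)
        + (K * (2 * (M * \<tau>) + (1 - \<delta>) ^ M) + (K * ((28 + 54 * real t) * \<alpha>) + ?R))"
  proof (simp only:, intro err_bind_spec[where R = "\<lambda>blk. \<forall>c. blk c < 2 ^ a"])
    show "spec n (partition_prog n a (\<lambda>_. 0)) 0 (\<lambda>blk. \<forall>c. blk c < 2 ^ a)"
      using spec_partition[of "\<lambda>_. 0" 0 n a] by simp
  qed (use blk_case in blast, intro add_nonneg_nonneg M0 S0 R0)
  also have "err ?g (partition_prog n a (\<lambda>_. 0)) (\<lambda>blk. inj_on blk W) \<le> real (card W) ^ 2 / 2 ^ a"
    by (rule err_partition_inj) (use W in auto)
  also have "\<dots> \<le> real K ^ 2 / 2 ^ a" using cW by (intro divide_right_mono power_mono) auto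
  finally show ?thesis by simp
qed

section \<open>Choice of the parameters\<close>

text \<open>From \<open>1 - \<delta> \<le> exp (- \<delta>)\<close> and
  \<open>2 \<le> exp 1\<close>.\<close>

lemma power_complement_le:
  assumes "0 \<le> (\<delta>::real)" "\<delta> \<le> 1" "real k \<le> \<delta> * real M"
  shows "(1 - \<delta>) ^ M \<le> 1 / 2 ^ k"
proof -
  have "(1 - \<delta>) ^ M \<le> exp (- \<delta>) ^ M"
    using exp_ge_add_one_self[of "- \<delta>"] assms by (intro power_mono) auto
  also have "\<dots> = exp (- (\<delta> * M))" by (simp add: exp_of_nat_mult[symmetric] mult.commute)
  also have "\<dots> \<le> exp (- real k)" using assms by simp
  also have "\<dots> = 1 / exp 1 ^ k" by (simp add: exp_minus exp_of_nat_mult[symmetric] field_simps)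
  also have "\<dots> \<le> 1 / 2 ^ k"
    using exp_ge_add_one_self[of 1] by (intro divide_left_mono power_mono) auto
  finally show ?thesis .
qed

locale tester_params =
  fixes s lg :: nat and \<epsilon> :: real
  assumes s: "1 \<le> s" and \<epsilon>: "0 < \<epsilon>" "\<epsilon> \<le> 1" and lg: "2 + s / \<epsilon> \<le> 2 ^ lg"
begin

text \<open>Estimates are made in powers of \<open>Z = 2 ^ lg\<close>, which bounds
  \<open>s\<close>, \<open>1 / \<epsilon>\<close> and \<open>lg\<close>. With
  \<open>2 ^ a = Z ^ 16\<close> and \<open>\<alpha> = 1 / Z ^ 15\<close>, bad points cost the search
  at most \<open>Z ^ 46 / 2 ^ L\<close>, which \<open>L = 60 * lg\<close> beats. For soundness
  \<open>2 ^ t = Z ^ 8\<close> exceeds \<open>2 * K / \<epsilon>\<close>. With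
  \<open>\<delta> = \<epsilon> / 100\<close>, \<open>\<delta> * M\<close> is at least
  \<open>10 * lg\<close>, and \<open>\<delta> * m\<close> at least \<open>12 * lg * K\<close>, twice
  the bound on the logarithm of the number of hypotheses.\<close>

definition "L = 60 * lg"
definition "K = s * L"
definition "a = 16 * lg"
definition "t = 8 * lg"
definition "M = nat \<lceil>1000 * lg / \<epsilon>\<rceil>"
definition "m = nat \<lceil>1200 * lg * K / \<epsilon>\<rceil>"
definition "T = nat \<lceil>4 / \<epsilon>\<rceil>"

definition Z :: real where "Z = 2 ^ lg"

lemma s_div_\<epsilon>: "1 \<le> s / \<epsilon>" "1 / \<epsilon> \<le> s / \<epsilon>" "real s \<le> s / \<epsilon>"
proof -
  show "1 / \<epsilon> \<le> s / \<epsilon>" using s \<epsilon> by (simp add: divide_right_mono)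
  moreover have "1 \<le> 1 / \<epsilon>" using \<epsilon> by simp
  ultimately show "1 \<le> s / \<epsilon>" by linarith
  have "real s * \<epsilon> \<le> real s * 1" using \<epsilon> by (intro mult_left_mono) auto
  then show "real s \<le> s / \<epsilon>" using \<epsilon> by (simp add: field_simps)
qed

lemma lg_ge_2: "2 \<le> lg"
proof (rule ccontr)
  assume "\<not> 2 \<le> lg"
  then have "(2::real) ^ lg \<le> 2 ^ 1" by (intro power_increasing) auto
  then show False using lg s_div_\<epsilon> by simp
qed

lemma Z: "4 \<le> Z" "real s \<le> Z" "1 / \<epsilon> \<le> Z" "real lg \<le> Z"
proof -
  have "(2::real) ^ 2 \<le> 2 ^ lg" using lg_ge_2 by (intro power_increasing) auto
  then show "4 \<le> Z" by (simp add: Z_def)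
  show "real s \<le> Z" using lg s_div_\<epsilon> unfolding Z_def by linarith
  show "1 / \<epsilon> \<le> Z" using lg s_div_\<epsilon> unfolding Z_def by linarith
  have "lg < 2 ^ lg" by (rule less_exp)
  then show "real lg \<le> Z" unfolding Z_def by (metis less_imp_le of_nat_le_iff of_nat_numeral of_nat_power)
qed

lemma Z1: "real s \<le> Z ^ 1" "1 / \<epsilon> \<le> Z ^ 1" "real lg \<le> Z ^ 1"
  using Z by simp_all

text \<open>Products are bounded by adding exponents; constants enter through
  \<open>4 \<le> Z\<close>, and a surplus of \<open>Z ^ 4\<close> in a denominator yields
  1/256.\<close>

lemma Z_mult: "0 \<le> x \<Longrightarrow> 0 \<le> y \<Longrightarrow> x \<le> Z ^ i \<Longrightarrow> y \<le> Z ^ j \<Longrightarrow> x * y \<le> Z ^ (i + j)"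
  unfolding power_add using Z by (intro mult_mono) auto

lemma Z_const: "numeral k \<le> (4::real) ^ i \<Longrightarrow> numeral k \<le> Z ^ i"
  by (erule order_trans) (rule power_mono, use Z in auto)

lemma Z_div: "x \<le> Z ^ i \<Longrightarrow> i + 4 \<le> j \<Longrightarrow> x / Z ^ j \<le> 1 / 256"
proof -
  assume x: "x \<le> Z ^ i" and ij: "i + 4 \<le> j"
  have Z0: "0 < Z" using Z(1) by simp
  have "(4::real) ^ 4 \<le> Z ^ 4" using Z(1) by (intro power_mono) auto
  then have "Z ^ i * 256 \<le> Z ^ i * Z ^ 4" using Z0 by (intro mult_left_mono) auto
  also have "\<dots> \<le> Z ^ j" unfolding power_add[symmetric]
    using ij Z(1) by (intro power_increasing) auto
  finally have "x * 256 \<le> Z ^ j" using x by linarith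
  then show ?thesis using Z0 by (simp add: field_simps)
qed

lemma K: "real K = 60 * s * lg" "real K \<le> Z ^ 5" "1 \<le> K"
proof -
  show K: "real K = 60 * s * lg" by (simp add: K_def L_def)
  have "60 * real s * real lg \<le> Z ^ (3 + 1 + 1)"
    by (intro Z_mult Z1 Z_const) auto
  then show "real K \<le> Z ^ 5" by (simp add: K)
  show "1 \<le> K" using s lg_ge_2 by (simp add: K_def L_def)
qed

lemma nat_ceiling_le: "1 \<le> x \<Longrightarrow> real (nat \<lceil>x / \<epsilon>\<rceil>) \<le> (x + 1) / \<epsilon>"
proof -
  assume x: "1 \<le> x"
  have "real (nat \<lceil>x / \<epsilon>\<rceil>) \<le> x / \<epsilon> + 1" using x \<epsilon> by (simp add: of_nat_ceiling)
  moreover have "1 \<le> 1 / \<epsilon>" using \<epsilon> by simp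
  ultimately show ?thesis by (simp add: add_divide_distrib)
qed

lemma nat_ceiling_ge: "x \<le> \<epsilon> * real (nat \<lceil>x / \<epsilon>\<rceil>)"
  using real_nat_ceiling_ge[of "x / \<epsilon>"] \<epsilon> by (simp add: field_simps)

lemma T: "real T \<le> 5 / \<epsilon>" "real T \<le> Z ^ 3" "4 \<le> \<epsilon> * T"
proof -
  show T: "real T \<le> 5 / \<epsilon>" unfolding T_def using nat_ceiling_le[of 4] by simp
  have "5 * (1 / \<epsilon>) \<le> Z ^ (2 + 1)" by (intro Z_mult Z1 Z_const) (use \<epsilon> in auto)
  then show "real T \<le> Z ^ 3" using T by simp
  show "4 \<le> \<epsilon> * T" unfolding T_def by (rule nat_ceiling_ge)
qed

lemma M: "real M \<le> 1001 * lg * (1 / \<epsilon>)" "real M \<le> Z ^ 7" "1000 * lg \<le> \<epsilon> * M"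
proof -
  have "real M \<le> (1000 * lg + 1) / \<epsilon>"
    unfolding M_def using nat_ceiling_le[of "1000 * real lg"] lg_ge_2 by (simp add: add.commute)
  also have "\<dots> \<le> 1001 * lg / \<epsilon>" using lg_ge_2 \<epsilon> by (intro divide_right_mono) auto
  finally show M: "real M \<le> 1001 * lg * (1 / \<epsilon>)" by simp
  have "1001 * real lg * (1 / \<epsilon>) \<le> Z ^ (5 + 1 + 1)" by (intro Z_mult Z1 Z_const) (use \<epsilon> in auto)
  then show "real M \<le> Z ^ 7" using M by simp
  show "1000 * lg \<le> \<epsilon> * M" unfolding M_def using nat_ceiling_ge[of "1000 * real lg"] by simp
qed

lemma m: "real m \<le> 1201 * (lg * K) * (1 / \<epsilon>)" "real m \<le> Z ^ 13" "1200 * (lg * K) \<le> \<epsilon> * m"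
proof -
  have "1 \<le> lg * K" using lg_ge_2 K(3) by simp
  then have lgK: "1 \<le> real lg * real K" by (metis of_nat_1 of_nat_le_iff of_nat_mult)
  have "real m \<le> (1200 * (lg * K) + 1) / \<epsilon>"
    unfolding m_def using nat_ceiling_le[of "1200 * (real lg * real K)"] lgK
    by (simp add: mult.assoc add.commute)
  also have "\<dots> \<le> 1201 * (lg * K) / \<epsilon>" using lgK \<epsilon> by (intro divide_right_mono) auto
  finally show m: "real m \<le> 1201 * (lg * K) * (1 / \<epsilon>)" by simp
  have "1201 * (real lg * real K) * (1 / \<epsilon>) \<le> Z ^ (6 + (1 + 5) + 1)"
    by (intro Z_mult Z1 Z_const K(2)) (use \<epsilon> in auto)
  then show "real m \<le> Z ^ 13" using m by simp
  show "1200 * (lg * K) \<le> \<epsilon> * m"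
    unfolding m_def using nat_ceiling_ge[of "1200 * (real lg * real K)"] by (simp add: mult.assoc)
qed

lemma Z_power: "2 ^ (i * lg) = Z ^ i"
  by (simp add: Z_def mult.commute flip: power_mult)

lemma sound_bounds: "5 \<le> t" "real K * (1 / 2) ^ t \<le> \<epsilon> / 2" "(1 - \<epsilon> / 2) ^ T \<le> 1 / 3"
proof -
  show "5 \<le> t" using lg_ge_2 by (simp add: t_def)
  have Z0: "0 < Z" using Z by simp
  have "K * (2 / \<epsilon>) \<le> Z ^ (5 + (1 + 1))"
  proof -
    have "2 * (1 / \<epsilon>) \<le> Z ^ (1 + 1)" by (intro Z_mult Z1 Z_const) (use \<epsilon> in auto)
    then show ?thesis using K(2) \<epsilon> by (intro Z_mult) auto
  qed
  also have "\<dots> \<le> Z ^ 8" using Z by (intro power_increasing) auto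
  finally have "K / Z ^ 8 \<le> \<epsilon> / 2" using Z0 \<epsilon> by (simp add: field_simps)
  then show "real K * (1 / 2) ^ t \<le> \<epsilon> / 2" by (simp add: t_def Z_power power_divide)
  have "(1 - \<epsilon> / 2) ^ T \<le> 1 / 2 ^ 2"
    by (rule power_complement_le) (use \<epsilon> T in auto)
  then show "(1 - \<epsilon> / 2) ^ T \<le> 1 / 3" by simp
qed

lemma dnfs_card_bound:
  assumes "q \<le> K" shows "card (dnfs q L s) \<le> 2 ^ (6 * lg * K)"
proof -
  have L: "1 \<le> L" using lg_ge_2 by (simp add: L_def)
  have "(2 * q + 1) ^ L + 1 \<le> (2 * K + 2) ^ L"
  proof -
    \<comment> \<open>Strictness of this inequality absorbs the \<open>+ 1\<close> for the padding
      symbol.\<close>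
    have "(2 * q + 1) ^ L < (2 * K + 2) ^ L" using assms L by (intro power_strict_mono) auto
    then show ?thesis by simp
  qed
  then have "((2 * q + 1) ^ L + 1) ^ s \<le> ((2 * K + 2) ^ L) ^ s" by (rule power_mono) simp
  also have "\<dots> = (2 * K + 2) ^ K" by (metis K_def mult.commute power_mult)
  also have "2 * K + 2 \<le> 2 ^ (6 * lg)"
  proof -
    have "4 * real K \<le> Z ^ (1 + 5)" by (intro Z_mult Z_const K(2)) auto
    then have "real (2 * K + 2) \<le> real (2 ^ (6 * lg))" using K(3) by (simp add: Z_power)
    then show ?thesis by (simp only: of_nat_le_iff)
  qed
  then have "(2 * K + 2) ^ K \<le> (2 ^ (6 * lg)) ^ K" by (intro power_mono) auto
  finally show ?thesis using dnfs_bound(2)[of q L s] by (simp add: power_mult)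
qed

definition \<delta> where "\<delta> = \<epsilon> / 100"
definition \<alpha> where "\<alpha> = 1 / Z ^ 15"
definition \<mu> where "\<mu> = s / 2 ^ L"

text \<open>Eight contributions are at most 1/256 each. The only substantial one is
  \<open>T * (2 * \<delta>)\<close>, at most 1/10 by the choice of \<delta>.\<close>

lemma complete_bound:
  "real K ^ 2 / 2 ^ a
    + K * (2 * (M * ((2 ^ a + 1) * \<mu> + 2 ^ a * (\<mu> / \<alpha>))) + (1 - \<delta>) ^ M)
    + K * ((28 + 54 * real t) * \<alpha>)
    + (2 * (m * \<mu>) + real (2 ^ (6 * lg * K)) * (1 - \<delta>) ^ m
      + T * (\<mu> + 2 * \<delta> + K * (t * (2 * \<alpha>)))) \<le> 1 / 3"
proof -
  have Z0: "0 < Z" "1 \<le> Z" using Z by auto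
  have a: "2 ^ a = Z ^ 16" and \<mu>: "\<mu> = s / Z ^ 60" by (simp_all add: a_def \<mu>_def L_def Z_power)
  have \<delta>: "0 \<le> \<delta>" "\<delta> \<le> 1" using \<epsilon> by (auto simp: \<delta>_def)
  have 1: "real K ^ 2 / 2 ^ a \<le> 1 / 256"
    unfolding a using power_mono[OF K(2), of 2] by (intro Z_div[where i = 10]) auto
  have 2: "K * (2 * (M * ((2 ^ a + 1) * \<mu> + 2 ^ a * (\<mu> / \<alpha>)))) \<le> 1 / 256"
  proof -
    have "Z ^ 16 + 1 + Z ^ 16 * Z ^ 15 \<le> 3 * Z ^ 31"
    proof -
      have "Z ^ 16 \<le> Z ^ 31" using Z0 by (intro power_increasing) auto
      moreover have "1 \<le> Z ^ 31" using Z0 by (intro one_le_power) auto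
      moreover have "Z ^ 16 * Z ^ 15 = Z ^ 31" by (simp flip: power_add)
      ultimately show ?thesis by linarith
    qed
    also have "\<dots> \<le> Z ^ (1 + 31)" by (intro Z_mult Z_const) (use Z0 in auto)
    finally have "real K * (2 * (real M * ((Z ^ 16 + 1 + Z ^ 16 * Z ^ 15) * real s)))
        \<le> Z ^ (5 + (1 + (7 + ((1 + 31) + 1))))"
      by (intro Z_mult K(2) M(2) Z1 Z_const) (use Z0 in auto)
    from Z_div[OF this, of 60]
    have "real K * (2 * (real M * ((Z ^ 16 + 1 + Z ^ 16 * Z ^ 15) * real s))) / Z ^ 60 \<le> 1 / 256" by simp
    then show ?thesis unfolding a \<mu> \<alpha>_def by (simp add: algebra_simps add_divide_distrib)
  qed
  have 3: "K * (1 - \<delta>) ^ M \<le> 1 / 256"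
  proof -
    have "(1 - \<delta>) ^ M \<le> 1 / 2 ^ (10 * lg)"
      by (rule power_complement_le) (use \<delta> M(3) in \<open>auto simp: \<delta>_def\<close>)
    then have "K * (1 - \<delta>) ^ M \<le> K * (1 / Z ^ 10)"
      unfolding Z_power by (rule mult_left_mono) simp
    also have "\<dots> \<le> 1 / 256" using Z_div[OF K(2), of 10] by simp
    finally show ?thesis .
  qed
  have 4: "K * ((28 + 54 * real t) * \<alpha>) \<le> 1 / 256"
  proof -
    have "28 + 54 * real t \<le> 460 * real lg" using lg_ge_2 by (simp add: t_def)
    also have "\<dots> \<le> Z ^ (5 + 1)" by (intro Z_mult Z1 Z_const) auto
    finally have "real K * (28 + 54 * real t) \<le> Z ^ (5 + (5 + 1))"
      by (intro Z_mult K(2)) auto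
    from Z_div[OF this, of 15] show ?thesis by (simp add: \<alpha>_def)
  qed
  have 5: "2 * (m * \<mu>) \<le> 1 / 256"
  proof -
    have "2 * (real m * real s) \<le> Z ^ (1 + (13 + 1))"
      by (intro Z_mult m(2) Z1 Z_const) auto
    from Z_div[OF this, of 60] show ?thesis by (simp add: \<mu>)
  qed
  have 6: "real (2 ^ (6 * lg * K)) * (1 - \<delta>) ^ m \<le> 1 / 256"
  proof -
    have "(1 - \<delta>) ^ m \<le> 1 / 2 ^ (12 * lg * K)"
      by (rule power_complement_le) (use \<delta> m(3) in \<open>auto simp: \<delta>_def\<close>)
    then have "real (2 ^ (6 * lg * K)) * (1 - \<delta>) ^ m \<le> 2 ^ (6 * lg * K) * (1 / 2 ^ (12 * lg * K))"
      by (intro mult_mono) (use \<delta> in auto)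
    also have "\<dots> = 1 / 2 ^ (6 * lg * K)"
    proof -
      have "12 * lg * K = 6 * lg * K + 6 * lg * K" by simp
      then show ?thesis by (simp only: power_add) simp
    qed
    also have "\<dots> \<le> 1 / 2 ^ (4 * lg)"
    proof -
      have "4 * lg * 1 \<le> 6 * lg * K" using K(3) by (intro mult_le_mono) auto
      then show ?thesis by (intro divide_left_mono power_increasing) auto
    qed
    also have "\<dots> \<le> 1 / 256" unfolding Z_power using Z_div[of 1 0 4] by simp
    finally show ?thesis .
  qed
  have 7: "T * (\<mu> + 2 * \<delta> + K * (t * (2 * \<alpha>))) \<le> 1 / 256 + 1 / 10 + 1 / 256"
  proof -
    have "real T * real s \<le> Z ^ (3 + 1)" by (intro Z_mult T(2) Z1) auto
    from Z_div[OF this, of 60] have "T * \<mu> \<le> 1 / 256" by (simp add: \<mu>)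
    moreover have "T * (2 * \<delta>) \<le> 1 / 10"
      using mult_right_mono[OF T(1), of "\<epsilon> / 50"] \<epsilon> by (simp add: \<delta>_def)
    moreover have "T * (K * (t * (2 * \<alpha>))) \<le> 1 / 256"
    proof -
      have "real T * (real K * (16 * real lg)) \<le> Z ^ (3 + (5 + (2 + 1)))"
        by (intro Z_mult T(2) K(2) Z1 Z_const) auto
      from Z_div[OF this, of 15] show ?thesis by (simp add: \<alpha>_def t_def)
    qed
    ultimately show ?thesis by (simp add: distrib_left)
  qed
  have "K * (2 * (M * ((2 ^ a + 1) * \<mu> + 2 ^ a * (\<mu> / \<alpha>))) + (1 - \<delta>) ^ M) \<le> 1 / 256 + 1 / 256"
    using 2 3 by (simp add: distrib_left)
  then show ?thesis using 1 4 5 6 7 by linarith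
qed

text \<open>The search dominates: \<open>K\<close>, \<open>M\<close> and \<open>a\<close> contribute
  a factor \<open>lg\<close> each. Decoding all coordinates is affordable in the final comparisons
  because only \<open>T\<close>, of order \<open>1 / \<epsilon>\<close>, of them are made.\<close>

lemma query_bound:
  "real (K * (M * (2 + a)) + (K * (28 + 54 * t) + (m + T * (1 + K * (2 * t)))))
    \<le> 1200000 * (s / \<epsilon>) * real lg ^ 3"
proof -
  have l: "1 \<le> real lg" using lg_ge_2 by simp
  then have l23: "real lg ^ 2 \<le> real lg ^ 3" "1 \<le> real lg ^ 2" by (auto intro: power_increasing one_le_power)
  let ?S = "real s / \<epsilon>"
  have S: "0 \<le> ?S" "1 / \<epsilon> \<le> ?S" "real s \<le> ?S" using s_div_\<epsilon> \<epsilon> by auto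
  have up: "c * ?S * real lg ^ 2 \<le> c * ?S * real lg ^ 3" if "0 \<le> c" for c
    using l23 S(1) that by (intro mult_left_mono mult_nonneg_nonneg) auto
  have "real (K * (M * (2 + a))) \<le> (60 * s * lg) * (1001 * lg * (1 / \<epsilon>) * (18 * lg))"
    unfolding of_nat_mult K(1) using M(1) l \<epsilon> by (intro mult_left_mono mult_mono) (auto simp: a_def)
  also have "\<dots> = 1081080 * ?S * real lg ^ 3" by (simp add: power3_eq_cube)
  finally have 1: "real (K * (M * (2 + a))) \<le> 1081080 * ?S * real lg ^ 3" .
  have "real (K * (28 + 54 * t)) \<le> (60 * s * lg) * (460 * lg)"
    unfolding of_nat_mult K(1) using l by (intro mult_left_mono) (auto simp: t_def)
  also have "\<dots> = 27600 * real s * real lg ^ 2" by (simp add: power2_eq_square)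
  also have "\<dots> \<le> 27600 * ?S * real lg ^ 2" using S by (intro mult_right_mono mult_left_mono) auto
  finally have 2: "real (K * (28 + 54 * t)) \<le> 27600 * ?S * real lg ^ 3" using up[of 27600] by linarith
  have "real m \<le> 72060 * ?S * real lg ^ 2" using m(1) by (simp add: K(1) power2_eq_square mult_ac)
  then have 3: "real m \<le> 72060 * ?S * real lg ^ 3" using up[of 72060] by linarith
  have "1 \<le> real s * real lg ^ 2" using s l23 mult_mono[of 1 "real s" 1 "real lg ^ 2"] by simp
  then have "1 + K * (2 * t) \<le> 961 * (real s * real lg ^ 2)"
    by (simp add: K(1) t_def power2_eq_square mult_ac)
  then have "real (T * (1 + K * (2 * t))) \<le> 5 / \<epsilon> * (961 * (real s * real lg ^ 2))"
    unfolding of_nat_mult using T(1) \<epsilon> by (intro mult_mono) auto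
  also have "\<dots> = 4805 * ?S * real lg ^ 2" by simp
  finally have 4: "real (T * (1 + K * (2 * t))) \<le> 4805 * ?S * real lg ^ 3" using up[of 4805] by linarith
  have "0 \<le> ?S * real lg ^ 3" using S(1) by (intro mult_nonneg_nonneg) auto
  moreover have "x1 + (x2 + (x3 + x4)) \<le> 1200000 * y"
    if "0 \<le> y" "x1 \<le> 1081080 * y" "x2 \<le> 27600 * y" "x3 \<le> 72060 * y" "x4 \<le> 4805 * y"
    for x1 x2 x3 x4 y :: real
    using that by linarith
  ultimately show ?thesis using 1 2 3 4 unfolding of_nat_add mult.assoc[of _ ?S] by blast
qed

definition tester where "tester n = dnf_tester n s L K a M t m T"

lemma tester_accepts:
  assumes "f \<in> term_dnf n s"
  shows "pmf (run f (to_alg (tester n))) True \<ge> 2 / 3"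
proof -
  obtain D :: "literal set set" where D: "finite D" "card D \<le> s" "\<And>t. t \<in> D \<Longrightarrow> t \<subseteq> {..<n} \<times> UNIV"
    "\<And>x. x \<in> cube n \<Longrightarrow> f x = evald D x"
    using assms by (auto simp: term_dnf_def evald_def)
  define F where "F = {t \<in> D. card t \<le> L}"
  define bad where "bad x \<longleftrightarrow> f x \<noteq> evald F x" for x
  have F: "finite F" "card F \<le> s" "\<And>t. t \<in> F \<Longrightarrow> t \<subseteq> {..<n} \<times> UNIV \<and> card t \<le> L"
    using D card_mono[of D F] by (auto simp: F_def)
  have bad: "avg n (\<lambda>x. of_bool (bad x)) \<le> \<mu>"
  proof -
    have "avg n (\<lambda>x. of_bool (bad x)) = avg n (\<lambda>x. of_bool (evald D x \<noteq> evald F x))"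
      using D(4) by (intro avg_cong) (simp add: bad_def)
    then show ?thesis using avg_long_terms[OF D(1-3), of L] by (simp add: F_def \<mu>_def)
  qed
  have "err (exact f) (tester n) (\<lambda>r. r = True) \<le> err (abort_on bad (evald F)) (tester n) (\<lambda>r. r = True)"
    by (rule err_oracle_mono) (auto simp: abort_on_def bad_def)
  also have "\<dots> \<le> 1 / 3"
  proof -
    have \<alpha>: "0 < \<alpha>" using Z by (simp add: \<alpha>_def)
    have \<delta>: "0 \<le> \<delta>" "\<delta> \<le> 1" using \<epsilon> by (auto simp: \<delta>_def)
    have t: "0 < t" using lg_ge_2 by (simp add: t_def)
    have K: "s * L \<le> K" by (simp add: K_def)
    show ?thesis
      using order_trans[OF dnf_tester_complete[OF F bad \<alpha> \<delta> t K dnfs_card_bound] complete_bound]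
      by (simp add: tester_def)
  qed
  finally show ?thesis unfolding pmf_run by simp
qed

lemma tester_rejects:
  assumes "far n \<epsilon> (term_dnf n s) f"
  shows "pmf (run f (to_alg (tester n))) False \<ge> 2 / 3"
  using dnf_tester_sound[OF assms sound_bounds, of L a M m] unfolding pmf_run tester_def by simp

lemma spec_tester: "spec n (tester n)
    (K * (M * (2 + a)) + (K * (28 + 54 * t) + (m + T * (1 + K * (2 * t))))) (\<lambda>_. True)"
  unfolding tester_def by (rule spec_dnf_tester)

lemma two_sided_tester: "two_sided_tester n (term_dnf n s) \<epsilon> (to_alg (tester n))"
  unfolding two_sided_tester_def
  using spec_queries_in_cube[OF spec_tester] tester_accepts tester_rejects by blast

lemma tester_queries: "real (num_queries f (to_alg (tester n))) \<le> 1200000 * (s / \<epsilon>) * real lg ^ 3"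
  using spec_num_queries[OF spec_tester, of f] query_bound by (meson of_nat_le_iff order_trans)

end

theorem theorem15:
  "\<exists>(A :: nat \<Rightarrow> nat \<Rightarrow> real \<Rightarrow> query_alg) (c :: real) (k :: nat).
     \<forall>(n :: nat) (s :: nat) (\<epsilon> :: real). s \<ge> 1 \<longrightarrow> \<epsilon> > 0 \<longrightarrow>
       two_sided_tester n (term_dnf n s) \<epsilon> (A n s \<epsilon>) \<and>
       (\<forall>f. real (num_queries f (A n s \<epsilon>)) \<le>
              c * (real s / \<epsilon>) * (log 2 (2 + real s / \<epsilon>)) ^ k)"
proof -
  define l where "l s \<epsilon> = nat \<lceil>log 2 (2 + real s / \<epsilon>)\<rceil>" for s \<epsilon>
  \<comment> \<open>For \<open>\<epsilon> > 1\<close> no function is far, since the constant false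
    is an \<open>s\<close>-term DNF and no probability exceeds 1; accepting without queries is then
    correct.\<close>
  define A where "A n s \<epsilon> = (if \<epsilon> \<le> 1 then to_alg (tester_params.tester s (l s \<epsilon>) \<epsilon> n) else Verdict True)"
    for n s \<epsilon>
  have main: "two_sided_tester n (term_dnf n s) \<epsilon> (A n s \<epsilon>) \<and>
      (\<forall>f. real (num_queries f (A n s \<epsilon>)) \<le> 9600000 * (real s / \<epsilon>) * (log 2 (2 + real s / \<epsilon>)) ^ 3)"
    if s: "1 \<le> s" and \<epsilon>: "0 < \<epsilon>" for n s \<epsilon>
  proof -
    let ?l = "log 2 (2 + real s / \<epsilon>)"
    have S: "0 \<le> real s / \<epsilon>" using \<epsilon> by simp
    have l1: "1 \<le> ?l" using S by (subst le_log_iff) auto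
    show ?thesis
    proof (cases "\<epsilon> \<le> 1")
      case True
      have "?l \<le> real (l s \<epsilon>)" by (simp add: l_def real_nat_ceiling_ge)
      then have "2 + real s / \<epsilon> \<le> 2 powr real (l s \<epsilon>)" using S by (subst (asm) log_le_iff) auto
      then have "2 + real s / \<epsilon> \<le> 2 ^ l s \<epsilon>" by (simp add: powr_realpow)
      then interpret tester_params s "l s \<epsilon>" \<epsilon> using s \<epsilon> True by unfold_locales
      \<comment> \<open>Rounding up adds at most 1, hence at most a factor 2 as the logarithm is at
        least 1; its cube turns 1200000 into 9600000.\<close>
      have "real (l s \<epsilon>) \<le> ?l + 1" using l1 by (simp add: l_def of_nat_ceiling)
      then have "real (l s \<epsilon>) ^ 3 \<le> (2 * ?l) ^ 3" using l1 by (intro power_mono) auto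
      then have "1200000 * (s / \<epsilon>) * real (l s \<epsilon>) ^ 3 \<le> 1200000 * (s / \<epsilon>) * (2 * ?l) ^ 3"
        using S by (intro mult_left_mono) auto
      also have "\<dots> = 9600000 * (s / \<epsilon>) * ?l ^ 3" by (simp add: power_mult_distrib)
      finally show ?thesis
        using True two_sided_tester[where n = n] order_trans[OF tester_queries[where n = n]] by (auto simp: A_def)
    next
      case False
      have "(\<lambda>_. False) \<in> term_dnf n s" by (rule term_dnfI[of "{}"]) (auto simp: evald_def)
      moreover have "measure_pmf.prob (pmf_of_set (cube n)) {x. f x \<noteq> False} < \<epsilon>" for f
        using measure_pmf.prob_le_1[of "pmf_of_set (cube n)" "{x. f x \<noteq> False}"] False by linarith
      ultimately have "\<not> far n \<epsilon> (term_dnf n s) f" for f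
        unfolding far_def by (metis (no_types, lifting) not_less)
      then show ?thesis using False S l1 by (simp add: A_def two_sided_tester_def)
    qed
  qed
  show ?thesis by (rule exI[of _ A], rule exI[of _ 9600000], rule exI[of _ 3]) (use main in blast)
qed

end
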